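(* Let $M$ be a positive integer, and let $G_1,G_2,\dots$ be a sequence of finite graphs with maximal degree at most $M$ (elements of $\mathcal G^0_M$) such that the measures $\Psi(G_j)$ converge weakly, as $j\to\infty$, to some $\mu\in\mathfrak M_M$. Then $\mu$ is hyperfinite (as a measure) if and only if the collection of finite graphs $\{G_1,G_2,\dots\}$ is hyperfinite (as a collection of graphs).
   Context: Graphs are undirected. For a set of edges $S\subset E(G)$, $G\setminus S$ is the graph with vertex set $V(G)$ and edge set $E(G)\setminus S$. A graph is locally finite if each vertex is incident with only finitely many edges. **Hyperfinite collections of finite graphs.** Let $\epsilon>0$ and let $k$ be a positive integer. A collection $\mathcal G$ of finite graphs is $(k,\epsilon)$-hyperfinite if every $G\in\mathcal G$ has a set of edges $S\subset E(G)$ such that $|S|\le \epsilon\,|V(G)|$ and every connected component of $G\setminus S$ has at most $k$ vertices. The collection $\mathcal G$ is hyperfinite if for every $\epsilon>0$ there is a finite $k=k(\epsilon)$ such that $\mathcal G$ is $(k,\epsilon)$-hyperfinite. **Spaces of rooted graphs and measures.** A rooted graph is a pair $(G,o)$ with $o\in V(G)$; an isomorphism of rooted graphs $(G,o)\to(G',o')$ is a graph isomorphism mapping $o$ to $o'$. Let $\widehat{\mathcal G}$ be the set of isomorphism classes of connected, locally finite rooted graphs, and $\widehat{\mathcal G}_M\subset\widehat{\mathcal G}$ the subset of those with maximal degree at most $M$. For $r\ge 0$ let $B_G(o,r)$ be the subgraph of $G$ spanned by the vertices at distance at most $r$ from $o$. Metrize $\widehat{\mathcal G}$ by $\rho((G,o),(G',o'))=1/(r+1)$,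 where $r\ge 0$ is the largest integer such that $(B_G(o,r),o)$ and $(B_{G'}(o',r),o')$ are isomorphic as rooted graphs, and $\rho=0$ if $(G,o)$ and $(G',o')$ are isomorphic. Let $\mathfrak M$ (respectively $\mathfrak M_M$) be the space of Borel probability measures on $\widehat{\mathcal G}$ (respectively $\widehat{\mathcal G}_M$) with respect to $\rho$, with the topology of weak convergence. **The map $\Psi$.** Let $\mathcal G^0_M$ be the set of isomorphism classes of (nonempty) finite graphs, not necessarily connected, with maximal degree at most $M$. For $G\in\mathcal G^0_M$, choose $o\in V(G)$ uniformly at random and let $G_o$ be the connected component of $o$ in $G$; $\Psi(G)\in\mathfrak M_M$ is the law of the isomorphism class of $(G_o,o)$. **Unimodular measures.** A measure $\mu\in\mathfrak M$ is unimodular (satisfies the intrinsic Mass Transport Principle) if for every non-negative Borel function $f(G,x,y)$ of a connected locally finite graph $G$ and two vertices $x,y$ of it, depending only on the isomorphism type of the triple $(G,x,y)$, $$\int \sum_{x\in V(G)} f(G,x,o)\,d\mu(G,o)=\int \sum_{y\in V(G)} f(G,o,y)\,d\mu(G,o).$$ Let $\mathcal U$ be the set of unimodular $\mu\in\mathfrak M$ and $\mathcal U_M:=\mathcal U\cap\mathfrak M_M$. Each $\Psi(G)$, $G\in\mathcal G^0_M$, lies in $\mathcal U_M$, and $\mathcal U_M$ is closed in $\mathfrak M_M$, so weak limits of measures $\Psi(G_j)$ lie in $\mathcal U_M$. A probability measure $\nu$ on (isomorphism classes of) triples $(G,o,S)$, with $(G,o)$ a connected locally finite rooted graph and $S\subset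 E(G)$ (with the analogous local topology, isomorphisms being required to preserve $S$, and its Borel $\sigma$-field), is called unimodular if for every non-negative Borel function $f(G,S,x,y)$ depending only on the isomorphism type of $(G,S,x,y)$, $$\int \sum_{x\in V(G)} f(G,S,x,o)\,d\nu(G,o,S)=\int \sum_{y\in V(G)} f(G,S,o,y)\,d\nu(G,o,S).$$ **Hyperfinite measures.** A measure $\mu\in\mathcal U$ is $(k,\epsilon)$-hyperfinite if there is a unimodular probability measure $\nu$ on triples $(G,o,S)$ with $S\subset E(G)$ such that the projection of $\nu$ to $(G,o)$ is $\mu$, $\nu$-almost surely every connected component of $G\setminus S$ has at most $k$ vertices, and the $\nu$-expected number of edges of $S$ incident to $o$ is at most $2\epsilon$. A measure $\mu\in\mathcal U$ is hyperfinite if for every $\epsilon>0$ there is a finite $k=k(\epsilon)$ such that $\mu$ is $(k,\epsilon)$-hyperfinite. *)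

theory Defs
  imports "HOL-Probability.Probability"
begin

section \<open>Undirected graphs\<close>

record 'v ugraph =
  verts :: "'v set"
  edges :: "'v set set"

definition is_graph :: "'v ugraph \<Rightarrow> bool" where
  "is_graph G \<longleftrightarrow> (\<forall>e\<in>edges G. \<exists>u\<in>verts G. \<exists>v\<in>verts G. u \<noteq> v \<and> e = {u, v})"

definition incident_edges :: "'v set set \<Rightarrow> 'v \<Rightarrow> 'v set set" where
  "incident_edges E v = {e \<in> E. v \<in> e}"

definition locally_finite :: "'v ugraph \<Rightarrow> bool" where
  "locally_finite G \<longleftrightarrow> (\<forall>v\<in>verts G. finite (incident_edges (edges G) v))"

definition max_degree_le :: "nat \<Rightarrow> 'v ugraph \<Rightarrow> bool" where
  "max_degree_le M G \<longleftrightarrow> locally_finite G \<and> (\<forall>v\<in>verts G. card (incident_edges (edges G) v) \<le> M)"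

definition adj :: "'v ugraph \<Rightarrow> 'v \<Rightarrow> 'v \<Rightarrow> bool" where
  "adj G u v \<longleftrightarrow> {u, v} \<in> edges G"

definition comp_verts :: "'v ugraph \<Rightarrow> 'v \<Rightarrow> 'v set" where
  "comp_verts G v = {u. (adj G)\<^sup>*\<^sup>* v u}"

definition connected_graph :: "'v ugraph \<Rightarrow> bool" where
  "connected_graph G \<longleftrightarrow> verts G \<noteq> {} \<and> (\<forall>v\<in>verts G. comp_verts G v = verts G)"

definition delete_edges :: "'v ugraph \<Rightarrow> 'v set set \<Rightarrow> 'v ugraph" where
  "delete_edges G S = \<lparr>verts = verts G, edges = edges G - S\<rparr>"

definition induced :: "'v ugraph \<Rightarrow> 'v set \<Rightarrow> 'v ugraph" where
  "induced G W = \<lparr>verts = W, edges = {e \<in> edges G. e \<subseteq> W}\<rparr>"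

definition component :: "'v ugraph \<Rightarrow> 'v \<Rightarrow> 'v ugraph" where
  "component G v = induced G (comp_verts G v)"

definition components_le :: "nat \<Rightarrow> 'v ugraph \<Rightarrow> bool" where
  "components_le k G \<longleftrightarrow> (\<forall>v\<in>verts G. finite (comp_verts G v) \<and> card (comp_verts G v) \<le> k)"

definition ball_verts :: "'v ugraph \<Rightarrow> 'v \<Rightarrow> nat \<Rightarrow> 'v set" where
  "ball_verts G x r = {v. \<exists>n\<le>r. (adj G ^^ n) x v}"


section \<open>Hyperfinite collections of finite graphs\<close>

definition fin_graphs :: "nat \<Rightarrow> 'v ugraph set" where
  "fin_graphs M = {G. is_graph G \<and> finite (verts G) \<and> verts G \<noteq> {} \<and> max_degree_le M G}"

definition hyperfinite_graphs_at :: "nat \<Rightarrow> real \<Rightarrow> 'v ugraph set \<Rightarrow> bool" where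
  "hyperfinite_graphs_at k \<epsilon> \<G> \<longleftrightarrow>
     (\<forall>G\<in>\<G>. \<exists>S. S \<subseteq> edges G \<and> real (card S) \<le> \<epsilon> * real (card (verts G)) \<and>
        components_le k (delete_edges G S))"

definition hyperfinite_graphs :: "'v ugraph set \<Rightarrow> bool" where
  "hyperfinite_graphs \<G> \<longleftrightarrow> (\<forall>\<epsilon>>0. \<exists>k>0. hyperfinite_graphs_at k \<epsilon> \<G>)"


section \<open>Rooted graphs up to isomorphism, and the local metric\<close>

text \<open>
  A quadruple \<open>(G, S, x, D)\<close> is a graph with a set \<open>S\<close> of marked edges, a root \<open>x\<close> and a
  set \<open>D\<close> of marked vertices. The four kinds of objects needed below are
  \<open>(G, {}, o, {})\<close> for \<open>(G, o)\<close>, \<open>(G, S, o, {})\<close> for \<open>(G, o, S)\<close>,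
  \<open>(G, {}, x, {y})\<close> for \<open>(G, x, y)\<close> and \<open>(G, S, x, {y})\<close> for \<open>(G, S, x, y)\<close>.
\<close>

type_synonym 'v mgraph = "'v ugraph \<times> 'v set set \<times> 'v \<times> 'v set"

definition mgraphs :: "'v mgraph set" where
  "mgraphs = {(G, S, x, D). is_graph G \<and> connected_graph G \<and> locally_finite G \<and>
     S \<subseteq> edges G \<and> x \<in> verts G \<and> D \<subseteq> verts G}"

definition mg_iso :: "'v mgraph \<Rightarrow> 'w mgraph \<Rightarrow> bool" where
  "mg_iso = (\<lambda>(G, S, x, D) (G', S', x', D').
     \<exists>\<phi>. bij_betw \<phi> (verts G) (verts G') \<and> (\<lambda>e. \<phi> ` e) ` edges G = edges G' \<and>
         (\<lambda>e. \<phi> ` e) ` S = S' \<and> \<phi> x = x' \<and> \<phi> ` D = D')"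

definition mg_ball :: "nat \<Rightarrow> 'v mgraph \<Rightarrow> 'v mgraph" where
  "mg_ball r = (\<lambda>(G, S, x, D). let B = ball_verts G x r in
     (induced G B, {e \<in> S. e \<subseteq> B}, x, D \<inter> B))"

text \<open>
  Connected locally finite graphs are countable, so every isomorphism class has
  representatives with vertices in \<^typ>\<open>nat\<close>; the class of a graph on any vertex type is
  identified with the set of these representatives.
\<close>

type_synonym mclass = "nat mgraph set"

definition iso_class :: "'v mgraph \<Rightarrow> mclass" where
  "iso_class g = {h \<in> mgraphs. mg_iso g h}"

definition rep :: "mclass \<Rightarrow> nat mgraph" where
  "rep c = (SOME g. g \<in> c)"

definition rooted_space :: "mclass set" where
  "rooted_space = {iso_class (G, {}, x, {}) | (G :: nat ugraph) x. (G, {}, x, {}) \<in> mgraphs}"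

definition rooted_space_deg :: "nat \<Rightarrow> mclass set" where
  "rooted_space_deg M = {iso_class (G, {}, x, {}) | (G :: nat ugraph) x.
     (G, {}, x, {}) \<in> mgraphs \<and> max_degree_le M G}"

definition birooted_space :: "mclass set" where
  "birooted_space = {iso_class (G, {}, x, {y}) | (G :: nat ugraph) x y. (G, {}, x, {y}) \<in> mgraphs}"

definition marked_rooted_space :: "mclass set" where
  "marked_rooted_space = {iso_class (G, S, x, {}) | (G :: nat ugraph) S x. (G, S, x, {}) \<in> mgraphs}"

definition marked_birooted_space :: "mclass set" where
  "marked_birooted_space =
     {iso_class (G, S, x, {y}) | (G :: nat ugraph) S x y. (G, S, x, {y}) \<in> mgraphs}"

definition balls_agree :: "nat \<Rightarrow> mclass \<Rightarrow> mclass \<Rightarrow> bool" where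
  "balls_agree r c d \<longleftrightarrow> (\<exists>g\<in>c. \<exists>h\<in>d. mg_iso (mg_ball r g) (mg_ball r h))"

text \<open>
  The value \<open>2\<close> is only used in the birooted spaces, where already the balls of radius \<open>0\<close>
  can disagree (when exactly one of the second vertices equals the root). On the other
  spaces the balls of radius \<open>0\<close> are always isomorphic.
\<close>

definition local_dist :: "mclass \<Rightarrow> mclass \<Rightarrow> real" where
  "local_dist c d =
     (if c = d then 0
      else if \<exists>r. balls_agree r c d then 1 / (real (GREATEST r. balls_agree r c d) + 1)
      else 2)"

definition local_topology :: "mclass set \<Rightarrow> mclass topology" where
  "local_topology X = Metric_space.mtopology X local_dist"

definition local_borel :: "mclass set \<Rightarrow> mclass measure" where
  "local_borel X = sigma X {U. openin (local_topology X) U}"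

definition prob_measures :: "mclass set \<Rightarrow> mclass measure set" where
  "prob_measures X = {\<mu>. prob_space \<mu> \<and> sets \<mu> = sets (local_borel X)}"

definition weakly_converges :: "mclass set \<Rightarrow> (nat \<Rightarrow> mclass measure) \<Rightarrow> mclass measure \<Rightarrow> bool" where
  "weakly_converges X \<mu>s \<mu> \<longleftrightarrow>
     (\<forall>f :: mclass \<Rightarrow> real. continuous_map (local_topology X) euclideanreal f \<and> bounded (f ` X) \<longrightarrow>
        (\<lambda>j. \<integral>c. f c \<partial>\<mu>s j) \<longlonglongrightarrow> (\<integral>c. f c \<partial>\<mu>))"

definition Psi :: "nat \<Rightarrow> 'v ugraph \<Rightarrow> mclass measure" where
  "Psi M G = distr (uniform_count_measure (verts G)) (local_borel (rooted_space_deg M))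
     (\<lambda>x. iso_class (component G x, {}, x, {}))"

text \<open>A measure on the degree-bounded space, viewed as a measure on the full space.\<close>

definition extend_measure_to_rooted :: "mclass measure \<Rightarrow> mclass measure" where
  "extend_measure_to_rooted \<mu> = distr \<mu> (local_borel rooted_space) (\<lambda>c. c)"


section \<open>Unimodular and hyperfinite measures\<close>

definition mass_in :: "(mclass \<Rightarrow> ennreal) \<Rightarrow> mclass \<Rightarrow> ennreal" where
  "mass_in f c = (case rep c of (G, S, z, D) \<Rightarrow>
     \<integral>\<^sup>+ x. f (iso_class (G, S, x, {z})) \<partial>count_space (verts G))"

definition mass_out :: "(mclass \<Rightarrow> ennreal) \<Rightarrow> mclass \<Rightarrow> ennreal" where
  "mass_out f c = (case rep c of (G, S, z, D) \<Rightarrow>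
     \<integral>\<^sup>+ y. f (iso_class (G, S, z, {y})) \<partial>count_space (verts G))"

definition mass_transport :: "mclass set \<Rightarrow> mclass measure \<Rightarrow> bool" where
  "mass_transport X2 \<mu> \<longleftrightarrow>
     (\<forall>f \<in> borel_measurable (local_borel X2).
        (\<integral>\<^sup>+ c. mass_in f c \<partial>\<mu>) = (\<integral>\<^sup>+ c. mass_out f c \<partial>\<mu>))"

definition unimodular :: "mclass measure set" where
  "unimodular = {\<mu> \<in> prob_measures rooted_space. mass_transport birooted_space \<mu>}"

definition unimodular_marked :: "mclass measure set" where
  "unimodular_marked =
     {\<nu> \<in> prob_measures marked_rooted_space. mass_transport marked_birooted_space \<nu>}"

definition forget_marks :: "mclass \<Rightarrow> mclass" where
  "forget_marks c = (case rep c of (G, S, x, D) \<Rightarrow> iso_class (G, {}, x, {}))"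

definition hyperfinite_measure_at :: "nat \<Rightarrow> real \<Rightarrow> mclass measure \<Rightarrow> bool" where
  "hyperfinite_measure_at k \<epsilon> \<mu> \<longleftrightarrow> \<mu> \<in> unimodular \<and>
     (\<exists>\<nu> \<in> unimodular_marked.
        distr \<nu> (local_borel rooted_space) forget_marks = \<mu> \<and>
        (AE c in \<nu>. case rep c of (G, S, x, D) \<Rightarrow> components_le k (delete_edges G S)) \<and>
        (\<integral>\<^sup>+ c. (case rep c of (G, S, x, D) \<Rightarrow> of_nat (card (incident_edges S x))) \<partial>\<nu>)
          \<le> ennreal (2 * \<epsilon>))"

definition hyperfinite_measure :: "mclass measure \<Rightarrow> bool" where
  "hyperfinite_measure \<mu> \<longleftrightarrow> (\<forall>\<epsilon>>0. \<exists>k>0. hyperfinite_measure_at k \<epsilon> \<mu>)"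

end

theory Submission
  imports Defs
begin

text \<open>
  An isomorphism class is determined by the types of its balls (Koenig's lemma), and for bounded
  degree there are finitely many types of each radius; so functions of a fixed ball are continuous,
  and they generate the Borel sets.

  If the graphs are hyperfinite, choose edge sets \<open>S\<^sub>j\<close> and let the frequencies of all local
  events in \<open>(G\<^sub>j, S\<^sub>j)\<close> converge along a suitable filter (compactness of a power of \<open>[0,1]\<close>).
  By compactness the limit is countably additive on the algebra of local events, hence a measure
  \<open>\<nu>\<close> (Caratheodory). Mass transport holds for each finite graph by exchanging two sums and passes
  to the limit for local functions, which suffices.

  Conversely, let \<open>\<nu>\<close> witness that \<open>\<mu>\<close> is hyperfinite. For a function \<open>w\<close> of triples \<open>(G, o, D)\<close>,
  \<open>D\<close> a small vertex set containing \<open>o\<close>, put \<open>N w = \<integral> \<Sum>\<^sub>D w (G, o, D) d\<mu>\<close> and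
  \<open>K w = \<integral> w (G, o, C\<^sub>o) d\<nu>\<close>, where \<open>C\<^sub>o\<close> is the component of \<open>o\<close> in \<open>G\<close> without \<open>S\<close>. An almost
  minimizer \<open>w\<close> of \<open>N (w\<^sup>2) - 2 K w\<close> among local functions satisfies \<open>N (w g) \<approx> K g\<close> for all bounded
  local \<open>g\<close>, so it acts as a local version of the conditional probability that \<open>D\<close> is a component.
  Averaging over the root within \<open>D\<close> does not increase the functional, by unimodularity. Evaluated
  on \<open>G\<^sub>j\<close>, such a \<open>w\<close> is a fractional cover of almost all vertices by small sets of small total
  boundary, and choosing relatively cheap sets greedily turns it into a partition.
\<close>

section \<open>Balls and components, and how partial maps carry them\<close>

section \<open>Balls and clusters\<close>

text \<open>For the converse, the obstacle is that the marks of \<open>\<nu>\<close> are extra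
  randomness: they are no function of \<open>(G, o)\<close>, and weak convergence hands over to the
  finite graphs only integrals of functions of unmarked balls. So the partition is relaxed to
  weights on candidate sets, for which two expectations suffice, the boundary cost and the
  probability of being undercovered. The natural weight, the conditional probability that D is the
  component of the root, is merely measurable. Let m be the measure with integral \<open>N\<close>
  and p its density for \<open>K\<close>; as \<open>K\<close> is at most \<open>N\<close> on
  nonnegative functions, p lies in [0,1], and the functional is the squared distance to p in L2(m)
  up to a constant. Local functions come close enough to the infimum without p ever being
  constructed, and only a one-sided estimate against two test functions is used. Averaging over the
  root matters because a cover needs one weight per set, whichever member it is seen from. Rounding
  has cost 4a/t + Mt per vertex: a bounds the fractional cost, and t is the fraction of vertices
  that may be left over and isolated.\<close>

lemma adj_sym: "adj G u v \<longleftrightarrow> adj G v u"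
  by (simp add: adj_def insert_commute)

lemma adj_verts: "is_graph G \<Longrightarrow> adj G u v \<Longrightarrow> u \<in> verts G \<and> v \<in> verts G \<and> u \<noteq> v"
  unfolding is_graph_def adj_def by (metis doubleton_eq_iff)

lemma edges_subset: "is_graph G \<Longrightarrow> e \<in> edges G \<Longrightarrow> e \<subseteq> verts G"
  unfolding is_graph_def by auto

lemma edgeE:
  assumes "is_graph G" "e \<in> edges G"
  obtains u v where "u \<in> verts G" "v \<in> verts G" "u \<noteq> v" "e = {u, v}" "adj G u v"
  using assms unfolding is_graph_def adj_def by metis

lemma ball_verts_0 [simp]: "ball_verts G x 0 = {x}"
  by (auto simp: ball_verts_def)

lemma ball_verts_Suc:
  "ball_verts G x (Suc r) = ball_verts G x r \<union> {v. \<exists>u\<in>ball_verts G x r. adj G u v}"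
proof (intro equalityI subsetI)
  fix v assume "v \<in> ball_verts G x (Suc r)"
  then obtain n where n: "n \<le> Suc r" "(adj G ^^ n) x v" by (auto simp: ball_verts_def)
  show "v \<in> ball_verts G x r \<union> {v. \<exists>u\<in>ball_verts G x r. adj G u v}"
  proof (cases "n \<le> r")
    case True
    then show ?thesis using n by (auto simp: ball_verts_def)
  next
    case False
    with n have "(adj G ^^ Suc r) x v" by (simp add: le_Suc_eq)
    then obtain u where "(adj G ^^ r) x u" "adj G u v" by (auto elim: relpowp_Suc_E)
    then show ?thesis by (auto simp: ball_verts_def)
  qed
next
  fix v assume "v \<in> ball_verts G x r \<union> {v. \<exists>u\<in>ball_verts G x r. adj G u v}"
  then show "v \<in> ball_verts G x (Suc r)"
  proof
    assume "v \<in> ball_verts G x r" then show ?thesis by (auto simp: ball_verts_def intro: le_SucI)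
  next
    assume "v \<in> {v. \<exists>u\<in>ball_verts G x r. adj G u v}"
    then obtain u n where "n \<le> r" "(adj G ^^ n) x u" "adj G u v" by (auto simp: ball_verts_def)
    then show ?thesis unfolding ball_verts_def using relpowp_Suc_I[of n "adj G" x u v] by (auto intro!: exI[of _ "Suc n"])
  qed
qed

lemma center_in_ball [simp]: "x \<in> ball_verts G x r"
  by (induction r) (auto simp: ball_verts_Suc)

lemma ball_verts_mono: "r \<le> s \<Longrightarrow> ball_verts G x r \<subseteq> ball_verts G x s"
  by (auto simp: ball_verts_def intro: order_trans)

lemma ball_verts_trans:
  assumes "y \<in> ball_verts G x s"
  shows "ball_verts G y t \<subseteq> ball_verts G x (s + t)"
proof (induction t)
  case 0
  then show ?case using assms by simp
next
  case (Suc t)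
  then show ?case by (auto simp: ball_verts_Suc)
qed

lemma ball_verts_sym:
  assumes "y \<in> ball_verts G x r" shows "x \<in> ball_verts G y r"
proof -
  have "(adj G ^^ n) a b \<Longrightarrow> (adj G ^^ n) b a" for n a b
  proof (induction n arbitrary: b)
    case (Suc n)
    then obtain u where "(adj G ^^ n) a u" "adj G u b" by (auto elim: relpowp_Suc_E)
    then have "adj G b u" "(adj G ^^ n) u a" using Suc.IH by (auto simp: adj_sym)
    then show ?case by (rule relpowp_Suc_I2)
  qed auto
  then show ?thesis using assms by (auto simp: ball_verts_def)
qed

lemma comp_verts_ball: "comp_verts G x = (\<Union>r. ball_verts G x r)"
  unfolding comp_verts_def ball_verts_def rtranclp_power using order_refl by blast

lemma ball_subset_comp: "ball_verts G x r \<subseteq> comp_verts G x"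
  by (auto simp: comp_verts_ball)

lemma ball_subset_verts:
  assumes "is_graph G" "x \<in> verts G" shows "ball_verts G x r \<subseteq> verts G"
  using assms by (induction r) (auto simp: ball_verts_Suc dest: adj_verts)

lemma comp_subset_verts: "is_graph G \<Longrightarrow> x \<in> verts G \<Longrightarrow> comp_verts G x \<subseteq> verts G"
  using ball_subset_verts by (fastforce simp: comp_verts_ball)

lemma comp_verts_sym: "y \<in> comp_verts G x \<Longrightarrow> x \<in> comp_verts G y"
  using ball_verts_sym by (fastforce simp: comp_verts_ball)

lemma comp_verts_eq:
  assumes "y \<in> comp_verts G x" shows "comp_verts G y = comp_verts G x"
  using assms comp_verts_sym[OF assms] unfolding comp_verts_def by (auto intro: rtranclp_trans)

lemma self_in_comp [simp]: "x \<in> comp_verts G x"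
  by (simp add: comp_verts_def)

lemma adj_in_comp: "u \<in> comp_verts G x \<Longrightarrow> adj G u v \<Longrightarrow> v \<in> comp_verts G x"
  unfolding comp_verts_def by auto

lemma comp_inv:
  assumes "v \<in> comp_verts H x" "x \<in> A" "\<And>u v. u \<in> A \<Longrightarrow> adj H u v \<Longrightarrow> v \<in> A"
  shows "v \<in> A"
proof -
  have "(adj H)\<^sup>*\<^sup>* x v" using assms by (simp add: comp_verts_def)
  then show ?thesis by (induction rule: rtranclp_induct) (use assms in auto)
qed

lemma neighbours:
  assumes "finite (incident_edges (edges G) u)"
  shows "finite {v. adj G u v}" "card {v. adj G u v} \<le> card (incident_edges (edges G) u)"
proof -
  have i: "inj_on (\<lambda>v. {u, v}) {v. adj G u v}"
    by (auto simp: inj_on_def doubleton_eq_iff)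
  have s: "(\<lambda>v. {u, v}) ` {v. adj G u v} \<subseteq> incident_edges (edges G) u"
    by (auto simp: adj_def incident_edges_def)
  show "finite {v. adj G u v}" using finite_subset[OF s assms] finite_imageD[OF _ i] by blast
  show "card {v. adj G u v} \<le> card (incident_edges (edges G) u)" by (rule card_inj_on_le[OF i s assms])
qed

lemma finite_ball:
  assumes "is_graph G" "locally_finite G" "x \<in> verts G"
  shows "finite (ball_verts G x r)"
proof (induction r)
  case (Suc r)
  have "{v. \<exists>u\<in>ball_verts G x r. adj G u v} = (\<Union>u\<in>ball_verts G x r. {v. adj G u v})" by auto
  moreover have "finite {v. adj G u v}" if "u \<in> ball_verts G x r" for u
    using that assms ball_subset_verts[OF assms(1,3)] by (auto simp: locally_finite_def intro!: neighbours(1))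
  ultimately show ?case using Suc by (simp add: ball_verts_Suc)
qed simp

lemma card_ball:
  assumes "is_graph G" "max_degree_le M G" "x \<in> verts G"
  shows "card (ball_verts G x r) \<le> (M + 1) ^ r"
proof (induction r)
  case (Suc r)
  let ?B = "ball_verts G x r"
  have lf: "locally_finite G" using assms by (simp add: max_degree_le_def)
  have fB: "finite ?B" by (rule finite_ball[OF assms(1) lf assms(3)])
  have nb: "finite (incident_edges (edges G) u)" "card (incident_edges (edges G) u) \<le> M" if "u \<in> ?B" for u
    using that assms ball_subset_verts[OF assms(1,3)] by (auto simp: max_degree_le_def locally_finite_def)
  have "card (\<Union>u\<in>?B. {v. adj G u v}) \<le> (\<Sum>u\<in>?B. card {v. adj G u v})"
    by (rule card_UN_le[OF fB])
  also have "\<dots> \<le> (\<Sum>u\<in>?B. M)"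
    by (intro sum_mono order_trans[OF neighbours(2) nb(2)] nb(1))
  finally have 1: "card (\<Union>u\<in>?B. {v. adj G u v}) \<le> card ?B * M" by simp
  have "ball_verts G x (Suc r) = ?B \<union> (\<Union>u\<in>?B. {v. adj G u v})" by (auto simp: ball_verts_Suc)
  then have "card (ball_verts G x (Suc r)) \<le> card ?B + card ?B * M"
    using card_Un_le[of ?B "\<Union>u\<in>?B. {v. adj G u v}"] 1 by simp
  also have "\<dots> = (M + 1) * card ?B" by simp
  also have "\<dots> \<le> (M + 1) * (M + 1) ^ r" using Suc by (intro mult_left_mono) auto
  finally show ?case by simp
qed simp

lemma ball_stable:
  assumes "ball_verts H x (Suc i) = ball_verts H x i" "i \<le> j"
  shows "ball_verts H x j = ball_verts H x i"
  using assms(2)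
proof (induction j rule: dec_induct)
  case (step j)
  then show ?case using assms(1) by (simp add: ball_verts_Suc)
qed simp

text \<open>As long as the balls have not exhausted the component, each step adds a vertex.\<close>

lemma comp_eq_ball:
  assumes fin: "finite (ball_verts H x k)" and "card (ball_verts H x k) \<le> k"
  shows "comp_verts H x = ball_verts H x k"
proof (cases "\<exists>i<k. ball_verts H x (Suc i) = ball_verts H x i")
  case True
  then obtain i where i: "i < k" "ball_verts H x (Suc i) = ball_verts H x i" by auto
  have "ball_verts H x j \<subseteq> ball_verts H x k" for j
  proof (cases "j \<le> i")
    case True then show ?thesis using i by (intro ball_verts_mono) auto
  next
    case False then show ?thesis using ball_stable[OF i(2), of j] i by (simp add: ball_verts_mono)
  qed
  then show ?thesis by (auto simp: comp_verts_ball)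
next
  case False
  have "i \<le> k \<Longrightarrow> card (ball_verts H x i) \<ge> Suc i" for i
  proof (induction i)
    case (Suc i)
    have "ball_verts H x i \<subset> ball_verts H x (Suc i)"
      using False Suc.prems ball_verts_mono[of i "Suc i" H x] by (metis Suc_le_lessD le_SucI order_refl psubsetI)
    moreover have "finite (ball_verts H x (Suc i))"
      using finite_subset[OF ball_verts_mono[OF Suc.prems] fin] .
    ultimately have "card (ball_verts H x i) < card (ball_verts H x (Suc i))"
      by (rule psubset_card_mono[rotated])
    then show ?case using Suc by simp
  qed simp
  from this[of k] assms show ?thesis by simp
qed

text \<open>The number k serves both as radius and as size bound: a ball that keeps growing for k
  steps has more than k vertices. This turns a condition on components into one that a bounded
  neighbourhood decides.\<close>

lemma small_comp_iff:
  "finite (comp_verts H x) \<and> card (comp_verts H x) \<le> k \<longleftrightarrow>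
   finite (ball_verts H x k) \<and> card (ball_verts H x k) \<le> k"
  using comp_eq_ball[of H x k] ball_subset_comp[of H x k]
  by (metis card_mono finite_subset order_trans)

text \<open>Induction on the radius. The map need not be onto the second graph, so the hypothesis
  that the second ball stays inside the image of the window \<open>W\<close> supplies preimages of
  newly reached vertices. It serves for relabellings, induced subgraphs and edge-deleted graphs
  alike.\<close>

lemma ball_transport:
  assumes inj: "inj_on \<phi> W"
    and adj: "\<And>u v. u \<in> W \<Longrightarrow> v \<in> W \<Longrightarrow> adj H u v \<longleftrightarrow> adj H' (\<phi> u) (\<phi> v)"
    and W: "ball_verts H y t \<subseteq> W" and W': "ball_verts H' (\<phi> y) t \<subseteq> \<phi> ` W"
  shows "ball_verts H' (\<phi> y) t = \<phi> ` ball_verts H y t"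
  using W W'
proof (induction t)
  case (Suc t)
  have IH: "ball_verts H' (\<phi> y) t = \<phi> ` ball_verts H y t"
    using Suc by (auto simp: ball_verts_Suc)
  show ?case
  proof (intro equalityI subsetI)
    fix v' assume v': "v' \<in> ball_verts H' (\<phi> y) (Suc t)"
    then obtain v where v: "v \<in> W" "v' = \<phi> v" using Suc.prems by auto
    from v' IH consider "v' \<in> \<phi> ` ball_verts H y t" | u where "u \<in> ball_verts H y t" "adj H' (\<phi> u) v'"
      by (auto simp: ball_verts_Suc)
    then show "v' \<in> \<phi> ` ball_verts H y (Suc t)"
    proof cases
      case 2
      then have "u \<in> W" using Suc.prems by (auto simp: ball_verts_Suc)
      then show ?thesis using 2 v adj[of u v] by (auto simp: ball_verts_Suc)
    qed (auto simp: ball_verts_Suc)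
  next
    fix v' assume "v' \<in> \<phi> ` ball_verts H y (Suc t)"
    then obtain v where v: "v \<in> ball_verts H y (Suc t)" "v' = \<phi> v" by auto
    then consider "v \<in> ball_verts H y t" | u where "u \<in> ball_verts H y t" "adj H u v"
      by (auto simp: ball_verts_Suc)
    then show "v' \<in> ball_verts H' (\<phi> y) (Suc t)"
    proof cases
      case 1 then show ?thesis using v IH by (auto simp: ball_verts_Suc)
    next
      case 2
      then have "u \<in> W" "v \<in> W" using Suc.prems v by (auto simp: ball_verts_Suc)
      then show ?thesis using 2 v adj[of u v] IH by (auto simp: ball_verts_Suc)
    qed
  qed
qed simp

lemma adj_induced [simp]: "adj (induced G W) u v \<longleftrightarrow> adj G u v \<and> u \<in> W \<and> v \<in> W"
  by (auto simp: adj_def induced_def)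

lemma verts_induced [simp]: "verts (induced G W) = W"
  by (simp add: induced_def)

lemma edges_induced [simp]: "edges (induced G W) = {e \<in> edges G. e \<subseteq> W}"
  by (simp add: induced_def)

lemma verts_delete [simp]: "verts (delete_edges G S) = verts G"
  by (simp add: delete_edges_def)

lemma edges_delete [simp]: "edges (delete_edges G S) = edges G - S"
  by (simp add: delete_edges_def)

lemma adj_delete: "adj (delete_edges G S) u v \<longleftrightarrow> adj G u v \<and> {u, v} \<notin> S"
  by (simp add: adj_def)

lemma is_graph_delete: "is_graph G \<Longrightarrow> is_graph (delete_edges G S)"
  by (auto simp: is_graph_def)

lemma ball_induced:
  assumes "ball_verts G y t \<subseteq> W"
  shows "ball_verts (induced G W) y t = ball_verts G y t"
proof -
  have "ball_verts (induced G W) y t \<subseteq> ball_verts G y t"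
    by (induction t) (auto simp: ball_verts_Suc)
  then show ?thesis using ball_transport[of id W "G" "induced G W" y t] assms by auto
qed

lemma ball_delete_subset: "ball_verts (delete_edges G S) x t \<subseteq> ball_verts G x t"
  by (induction t) (auto simp: ball_verts_Suc adj_delete)

lemma is_graph_induced: "is_graph G \<Longrightarrow> is_graph (induced G W)"
  unfolding is_graph_def by (auto simp: subset_iff) (metis insertI1 insert_commute)

lemma ugraph_eqI: "verts G = verts H \<Longrightarrow> edges G = edges H \<Longrightarrow> (G :: 'v ugraph) = H"
  by (rule ugraph.equality) auto

section \<open>Relabelling, isomorphism classes and the choice of representatives\<close>

section \<open>Relabelling of marked graphs\<close>

definition gmap :: "('v \<Rightarrow> 'w) \<Rightarrow> 'v ugraph \<Rightarrow> 'w ugraph" where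
  "gmap \<phi> G = \<lparr>verts = \<phi> ` verts G, edges = (\<lambda>e. \<phi> ` e) ` edges G\<rparr>"

definition mg_map :: "('v \<Rightarrow> 'w) \<Rightarrow> 'v mgraph \<Rightarrow> 'w mgraph" where
  "mg_map \<phi> = (\<lambda>(G, S, x, D). (gmap \<phi> G, (\<lambda>e. \<phi> ` e) ` S, \<phi> x, \<phi> ` D))"

definition wf_mg :: "'v mgraph \<Rightarrow> bool" where
  "wf_mg = (\<lambda>(G, S, x, D). is_graph G \<and> S \<subseteq> edges G \<and> x \<in> verts G \<and> D \<subseteq> verts G)"

lemma verts_gmap [simp]: "verts (gmap \<phi> G) = \<phi> ` verts G"
  and edges_gmap [simp]: "edges (gmap \<phi> G) = (\<lambda>e. \<phi> ` e) ` edges G"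
  by (simp_all add: gmap_def)

lemma mgraphs_wf: "g \<in> mgraphs \<Longrightarrow> wf_mg g"
  by (auto simp: mgraphs_def wf_mg_def)

lemma mg_iso_iff: "mg_iso g h \<longleftrightarrow> (\<exists>\<phi>. inj_on \<phi> (verts (fst g)) \<and> h = mg_map \<phi> g)"
proof -
  obtain G S x D G' S' x' D' where gh: "g = (G, S, x, D)" "h = (G', S', x', D')"
    by (metis prod_cases4)
  show ?thesis unfolding gh mg_iso_def mg_map_def gmap_def bij_betw_def
    by (auto intro!: ugraph_eqI)
qed

lemma mg_map_comp: "mg_map \<psi> (mg_map \<phi> g) = mg_map (\<psi> \<circ> \<phi>) g"
  by (cases g) (auto simp: mg_map_def gmap_def image_comp comp_def image_image)

text \<open>Weaker than \<open>wf_mg\<close>, but enough to invert a relabelling. Balls satisfy it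
  for arbitrary quadruples, so \<open>local_dist\<close> is symmetric on all arguments, as
  \<open>Metric_space\<close> demands.\<close>

definition carried :: "'v mgraph \<Rightarrow> bool" where
  "carried = (\<lambda>(G, S, x, D). edges G \<subseteq> Pow (verts G) \<and> S \<subseteq> Pow (verts G) \<and> x \<in> verts G \<and> D \<subseteq> verts G)"

lemma wf_carried: "wf_mg g \<Longrightarrow> carried g"
  using edges_subset by (fastforce simp: wf_mg_def carried_def)

lemma carried_map_cong:
  assumes "carried g" "\<And>v. v \<in> verts (fst g) \<Longrightarrow> \<phi> v = \<psi> v"
  shows "mg_map \<phi> g = mg_map \<psi> g"
proof -
  obtain G S x D where g: "g = (G, S, x, D)" by (metis prod_cases4)
  have e: "\<phi> ` e = \<psi> ` e" if "e \<subseteq> verts G" for e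
    using that assms g by (auto intro!: image_cong)
  have 1: "edges G \<subseteq> Pow (verts G)" "S \<subseteq> Pow (verts G)" "x \<in> verts G" "D \<subseteq> verts G"
    using assms(1) g by (auto simp: carried_def)
  have "(\<lambda>e. \<phi> ` e) ` T = (\<lambda>e. \<psi> ` e) ` T" if "T \<subseteq> Pow (verts G)" for T
    using that by (intro image_cong e) auto
  then show ?thesis using e[of "verts G"] e[of D] 1 assms(2)[of x]
    by (auto simp: g mg_map_def gmap_def)
qed

lemmas mg_map_cong = carried_map_cong[OF wf_carried]

lemma mg_map_id: "mg_map (\<lambda>x. x) g = g"
  by (cases g) (auto simp: mg_map_def gmap_def)

lemma verts_mg_map [simp]: "verts (fst (mg_map \<phi> g)) = \<phi> ` verts (fst g)"
  by (cases g) (simp add: mg_map_def)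

lemma carried_iso_sym:
  assumes "carried g" "mg_iso g h" shows "mg_iso h g"
proof -
  obtain \<phi> where \<phi>: "inj_on \<phi> (verts (fst g))" "h = mg_map \<phi> g" using assms by (auto simp: mg_iso_iff)
  let ?\<psi> = "inv_into (verts (fst g)) \<phi>"
  have "mg_map ?\<psi> h = mg_map (\<lambda>x. x) g"
    unfolding \<phi>(2) mg_map_comp using \<phi>(1) by (intro carried_map_cong assms) auto
  moreover have "inj_on ?\<psi> (verts (fst h))" using \<phi> by (simp add: inj_on_inv_into)
  ultimately show ?thesis unfolding mg_iso_iff by (metis mg_map_id)
qed

lemmas mg_iso_sym = carried_iso_sym[OF wf_carried]

lemma mg_iso_trans:
  assumes "mg_iso g h" "mg_iso h k" shows "mg_iso g k"
proof -
  obtain \<phi> \<psi> where "inj_on \<phi> (verts (fst g))" "h = mg_map \<phi> g" "inj_on \<psi> (verts (fst h))" "k = mg_map \<psi> h"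
    using assms by (auto simp: mg_iso_iff)
  then show ?thesis unfolding mg_iso_iff
    by (intro exI[of _ "\<psi> \<circ> \<phi>"]) (auto simp: mg_map_comp intro: comp_inj_on)
qed

lemma is_graph_gmap: "inj_on \<phi> (verts G) \<Longrightarrow> is_graph G \<Longrightarrow> is_graph (gmap \<phi> G)"
  unfolding is_graph_def by (fastforce dest: inj_onD)

lemma image_mem_edges_iff:
  assumes "inj_on \<phi> A" "\<forall>e\<in>S. e \<subseteq> A" "e \<subseteq> A"
  shows "\<phi> ` e \<in> (\<lambda>e. \<phi> ` e) ` S \<longleftrightarrow> e \<in> S"
  using assms inj_on_image_eq_iff[OF assms(1)] by auto

lemma adj_gmap:
  assumes "inj_on \<phi> (verts G)" "is_graph G" "u \<in> verts G" "v \<in> verts G"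
  shows "adj (gmap \<phi> G) (\<phi> u) (\<phi> v) \<longleftrightarrow> adj G u v"
  using image_mem_edges_iff[OF assms(1), of "edges G" "{u, v}"] assms edges_subset[OF assms(2)]
  by (auto simp: adj_def)

lemma ball_gmap:
  assumes "inj_on \<phi> (verts G)" "is_graph G" "x \<in> verts G"
  shows "ball_verts (gmap \<phi> G) (\<phi> x) r = \<phi> ` ball_verts G x r"
proof (rule ball_transport[OF assms(1)])
  show "ball_verts (gmap \<phi> G) (\<phi> x) r \<subseteq> \<phi> ` verts G"
    using ball_subset_verts[OF is_graph_gmap[OF assms(1,2)], of "\<phi> x"] assms(3) by simp
  show "ball_verts G x r \<subseteq> verts G" by (rule ball_subset_verts[OF assms(2,3)])
qed (simp add: adj_gmap assms)

lemma comp_gmap: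
  assumes "inj_on \<phi> (verts G)" "is_graph G" "x \<in> verts G"
  shows "comp_verts (gmap \<phi> G) (\<phi> x) = \<phi> ` comp_verts G x"
  by (simp add: comp_verts_ball ball_gmap[OF assms] image_UN)

lemma incident_gmap:
  assumes "inj_on \<phi> (verts G)" "\<forall>e\<in>S. e \<subseteq> verts G" "x \<in> verts G"
  shows "incident_edges ((\<lambda>e. \<phi> ` e) ` S) (\<phi> x) = (\<lambda>e. \<phi> ` e) ` incident_edges S x"
    "card (incident_edges ((\<lambda>e. \<phi> ` e) ` S) (\<phi> x)) = card (incident_edges S x)"
proof -
  show 1: "incident_edges ((\<lambda>e. \<phi> ` e) ` S) (\<phi> x) = (\<lambda>e. \<phi> ` e) ` incident_edges S x"
  proof -
    have "\<phi> x \<in> \<phi> ` e \<longleftrightarrow> x \<in> e" if "e \<in> S" for e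
      using that assms(2) by (intro inj_on_image_mem_iff[OF assms(1,3)]) auto
    then show ?thesis unfolding incident_edges_def by auto
  qed
  have "inj_on (\<lambda>e. \<phi> ` e) (incident_edges S x)"
    using assms by (auto simp: incident_edges_def intro!: inj_on_subset[OF inj_on_image_Pow[OF assms(1)]])
  then show "card (incident_edges ((\<lambda>e. \<phi> ` e) ` S) (\<phi> x)) = card (incident_edges S x)"
    unfolding 1 by (rule card_image)
qed

lemma locally_finite_gmap:
  assumes "inj_on \<phi> (verts G)" "is_graph G" "locally_finite G" shows "locally_finite (gmap \<phi> G)"
  using assms incident_gmap(1)[OF assms(1), of "edges G"] edges_subset[OF assms(2)]
  by (auto simp: locally_finite_def)

lemma max_degree_gmap:
  assumes "inj_on \<phi> (verts G)" "is_graph G" "max_degree_le M G" shows "max_degree_le M (gmap \<phi> G)"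
  using assms incident_gmap(2)[OF assms(1), of "edges G"] edges_subset[OF assms(2)]
    locally_finite_gmap[OF assms(1,2)]
  by (auto simp: max_degree_le_def)

lemma delete_gmap:
  assumes "inj_on \<phi> (verts G)" "is_graph G" "S \<subseteq> edges G"
  shows "delete_edges (gmap \<phi> G) ((\<lambda>e. \<phi> ` e) ` S) = gmap \<phi> (delete_edges G S)"
proof -
  have "inj_on (\<lambda>e. \<phi> ` e) (edges G)"
    using edges_subset[OF assms(2)] by (auto intro!: inj_on_subset[OF inj_on_image_Pow[OF assms(1)]])
  then show ?thesis using assms(3) by (auto intro!: ugraph_eqI simp: inj_on_image_set_diff)
qed

lemma induced_gmap:
  assumes "inj_on \<phi> (verts G)" "is_graph G" "W \<subseteq> verts G"
  shows "induced (gmap \<phi> G) (\<phi> ` W) = gmap \<phi> (induced G W)"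
  using inj_on_image_subset_iff[OF assms(1) _ assms(3)] edges_subset[OF assms(2)]
  by (intro ugraph_eqI) auto

lemma mgraphs_map:
  assumes "g \<in> mgraphs" "inj_on \<phi> (verts (fst g))"
  shows "mg_map \<phi> g \<in> mgraphs"
proof -
  obtain G S x D where g: "g = (G, S, x, D)" by (metis prod_cases4)
  have a: "is_graph G" "connected_graph G" "locally_finite G" "S \<subseteq> edges G" "x \<in> verts G" "D \<subseteq> verts G"
    using assms g by (auto simp: mgraphs_def)
  have i: "inj_on \<phi> (verts G)" using assms g by simp
  have "connected_graph (gmap \<phi> G)"
    using a(2) comp_gmap[OF i a(1)] by (auto simp: connected_graph_def)
  then show ?thesis using a i
    by (auto simp: g mg_map_def mgraphs_def is_graph_gmap locally_finite_gmap)
qed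

section \<open>Isomorphism classes and their representatives\<close>

lemma countable_verts:
  assumes "(G, S, x, D) \<in> mgraphs" shows "countable (verts G)"
proof -
  have "verts G = (\<Union>r. ball_verts G x r)"
    using assms by (auto simp: mgraphs_def connected_graph_def comp_verts_ball)
  moreover have "finite (ball_verts G x r)" for r
    using assms by (intro finite_ball) (auto simp: mgraphs_def)
  ultimately show ?thesis by (simp add: countable_finite)
qed

lemma iso_class_nonempty:
  assumes "g \<in> mgraphs" shows "iso_class g \<noteq> {}"
proof -
  have "countable (verts (fst g))" using assms countable_verts by (metis prod.exhaust fst_conv)
  then obtain \<phi> :: "_ \<Rightarrow> nat" where "inj_on \<phi> (verts (fst g))" by (auto simp: countable_def)
  then have "mg_map \<phi> g \<in> iso_class g"
    unfolding iso_class_def mem_Collect_eq mg_iso_iff using mgraphs_map[OF assms] by blast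
  then show ?thesis by blast
qed

lemma rep_iso_class:
  assumes "g \<in> mgraphs"
  shows "rep (iso_class g) \<in> mgraphs" "mg_iso g (rep (iso_class g))"
proof -
  have "rep (iso_class g) \<in> iso_class g"
    unfolding rep_def using iso_class_nonempty[OF assms] by (simp add: some_in_eq)
  then show "rep (iso_class g) \<in> mgraphs" "mg_iso g (rep (iso_class g))" by (auto simp: iso_class_def)
qed

lemma iso_class_cong:
  assumes "g \<in> mgraphs" "mg_iso g h" shows "iso_class g = iso_class h"
proof -
  have hg: "mg_iso h g" by (rule mg_iso_sym[OF mgraphs_wf[OF assms(1)] assms(2)])
  show ?thesis unfolding iso_class_def using mg_iso_trans[OF assms(2)] mg_iso_trans[OF hg]
    by (intro Collect_cong) blast
qed

lemma iso_class_eq_iff: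
  assumes "g \<in> mgraphs" "h \<in> mgraphs" shows "iso_class g = iso_class h \<longleftrightarrow> mg_iso g h"
proof
  assume "iso_class g = iso_class h"
  then show "mg_iso g h"
    using rep_iso_class[OF assms(1)] rep_iso_class[OF assms(2)] mg_iso_sym[OF mgraphs_wf[OF assms(2)]]
    by (metis mg_iso_trans)
qed (rule iso_class_cong[OF assms(1)])

lemma rep_obtain:
  assumes "g \<in> mgraphs"
  obtains \<phi> where "inj_on \<phi> (verts (fst g))" "rep (iso_class g) = mg_map \<phi> g" "rep (iso_class g) \<in> mgraphs"
  using rep_iso_class[OF assms] by (auto simp: mg_iso_iff)

text \<open>A common home for the rooted, birooted and marked spaces, so that the metric, local
  functions and cylinders are treated once for any subset \<open>X\<close>.\<close>

definition mclasses :: "mclass set" where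
  "mclasses = iso_class ` (mgraphs :: nat mgraph set)"

lemma iso_class_mclasses: "g \<in> mgraphs \<Longrightarrow> iso_class g \<in> mclasses"
  unfolding mclasses_def by (metis image_eqI iso_class_cong rep_iso_class)

lemma rep_mclass:
  assumes "c \<in> mclasses" shows "rep c \<in> mgraphs" "iso_class (rep c) = c"
proof -
  obtain g :: "nat mgraph" where g: "g \<in> mgraphs" "c = iso_class g"
    using assms by (auto simp only: mclasses_def)
  show "rep c \<in> mgraphs" "iso_class (rep c) = c"
    unfolding g(2) using rep_iso_class(1)[OF g(1)] iso_class_cong[OF g(1) rep_iso_class(2)[OF g(1)]] by simp_all
qed

lemma mclass_mem_iff:
  assumes "c \<in> mclasses" shows "g \<in> c \<longleftrightarrow> g \<in> mgraphs \<and> iso_class g = c"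
proof -
  have "g \<in> c \<longleftrightarrow> g \<in> mgraphs \<and> mg_iso (rep c) g"
    using rep_mclass(2)[OF assms] by (metis (mono_tags, lifting) iso_class_def mem_Collect_eq)
  then show ?thesis using rep_mclass[OF assms] iso_class_eq_iff[of "rep c" g] by auto
qed

section \<open>Ball types and partial isomorphisms\<close>

section \<open>Ball types\<close>

lemma mg_ball_eq:
  "mg_ball r (G, S, x, D) =
    (induced G (ball_verts G x r), {e \<in> S. e \<subseteq> ball_verts G x r}, x, D \<inter> ball_verts G x r)"
  by (simp add: mg_ball_def Let_def)

lemma mg_ball_mgraphs:
  assumes "g \<in> mgraphs" shows "mg_ball r g \<in> mgraphs"
proof -
  obtain G S x D where g: "g = (G, S, x, D)" by (metis prod_cases4)
  let ?B = "ball_verts G x r"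
  have a: "is_graph G" "connected_graph G" "locally_finite G" "S \<subseteq> edges G" "x \<in> verts G" "D \<subseteq> verts G"
    using assms g by (auto simp: mgraphs_def)
  have ig: "is_graph (induced G ?B)" using a by (rule_tac is_graph_induced)
  have "?B \<subseteq> comp_verts (induced G ?B) x"
    using ball_subset_comp[of "induced G ?B" x r] ball_induced[of G x r ?B] by simp
  then have cx: "comp_verts (induced G ?B) x = ?B"
    using comp_subset_verts[OF ig, of x] by auto
  have "comp_verts (induced G ?B) v = ?B" if "v \<in> ?B" for v
    using comp_verts_eq[of v "induced G ?B" x] that cx by simp
  then have "connected_graph (induced G ?B)"
    using center_in_ball[of x G r] by (simp only: connected_graph_def verts_induced) blast
  moreover have "finite (incident_edges (edges (induced G ?B)) v)" if "v \<in> ?B" for v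
  proof (rule finite_subset)
    show "finite (incident_edges (edges G) v)"
      using that a(3) ball_subset_verts[OF a(1,5), of r] by (auto simp: locally_finite_def)
  qed (auto simp: incident_edges_def)
  then have "locally_finite (induced G ?B)" by (simp add: locally_finite_def)
  ultimately show ?thesis using ig a by (auto simp: g mg_ball_eq mgraphs_def)
qed

lemma finite_mg_ball:
  assumes "g \<in> mgraphs" shows "finite (verts (fst (mg_ball r g)))"
  using assms by (cases g) (auto simp: mg_ball_eq mgraphs_def intro: finite_ball)

lemma image_filter_subset:
  assumes "inj_on \<phi> A" "W \<subseteq> A" "\<forall>e\<in>S. e \<subseteq> A"
  shows "{e \<in> (\<lambda>e. \<phi> ` e) ` S. e \<subseteq> \<phi> ` W} = (\<lambda>e. \<phi> ` e) ` {e \<in> S. e \<subseteq> W}"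
proof -
  have "\<phi> ` e \<subseteq> \<phi> ` W \<longleftrightarrow> e \<subseteq> W" if "e \<in> S" for e
    using inj_on_image_subset_iff[OF assms(1), of e W] that assms by auto
  then show ?thesis by auto
qed

lemma mg_ball_map:
  assumes "wf_mg g" "inj_on \<phi> (verts (fst g))"
  shows "mg_ball r (mg_map \<phi> g) = mg_map \<phi> (mg_ball r g)"
proof -
  obtain G S x D where g: "g = (G, S, x, D)" by (metis prod_cases4)
  let ?B = "ball_verts G x r"
  have a: "is_graph G" "S \<subseteq> edges G" "x \<in> verts G" "D \<subseteq> verts G" "inj_on \<phi> (verts G)"
    using assms g by (auto simp: wf_mg_def)
  have B: "?B \<subseteq> verts G" by (rule ball_subset_verts[OF a(1,3)])
  have 1: "ball_verts (gmap \<phi> G) (\<phi> x) r = \<phi> ` ?B" by (rule ball_gmap[OF a(5,1,3)])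
  have 2: "{e \<in> (\<lambda>e. \<phi> ` e) ` S. e \<subseteq> \<phi> ` ?B} = (\<lambda>e. \<phi> ` e) ` {e \<in> S. e \<subseteq> ?B}"
    using a edges_subset[OF a(1)] by (intro image_filter_subset[OF a(5) B]) auto
  have 3: "\<phi> ` D \<inter> \<phi> ` ?B = \<phi> ` (D \<inter> ?B)"
    using inj_on_image_Int[OF a(5,4) B] by simp
  show ?thesis
    by (simp add: g mg_map_def mg_ball_eq 1 2 3 induced_gmap[OF a(5,1) B])
qed

lemma mg_ball_mg_ball:
  assumes "r \<le> s" shows "mg_ball r (mg_ball s g) = mg_ball r g"
proof -
  obtain G S x D where g: "g = (G, S, x, D)" by (metis prod_cases4)
  have B: "ball_verts G x r \<subseteq> ball_verts G x s" by (rule ball_verts_mono[OF assms])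
  have "ball_verts (induced G (ball_verts G x s)) x r = ball_verts G x r" by (rule ball_induced[OF B])
  moreover have "e \<subseteq> ball_verts G x r \<Longrightarrow> e \<subseteq> ball_verts G x s" for e using B by blast
  ultimately show ?thesis using B by (auto simp: g mg_ball_eq intro!: ugraph_eqI)
qed

text \<open>The type of a ball is again an isomorphism class, so types of different radii can be
  compared by applying \<open>ball_type\<close> to a type; coherent sequences of types are formed
  this way.\<close>

definition ball_type :: "nat \<Rightarrow> mclass \<Rightarrow> mclass" where
  "ball_type r c = iso_class (mg_ball r (rep c))"

text \<open>Only the values of \<open>\<phi>\<close> on the ball of radius \<open>r\<close> matter;
  it is an isomorphism of rooted marked balls, and its values elsewhere are arbitrary.\<close>

definition piso :: "nat \<Rightarrow> ('v \<Rightarrow> 'w) \<Rightarrow> 'v mgraph \<Rightarrow> 'w mgraph \<Rightarrow> bool" where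
  "piso r \<phi> g h \<longleftrightarrow> inj_on \<phi> (verts (fst (mg_ball r g))) \<and> mg_ball r h = mg_map \<phi> (mg_ball r g)"

lemma ball_type_iso_class:
  assumes "g \<in> mgraphs" shows "ball_type r (iso_class g) = iso_class (mg_ball r g)"
proof -
  obtain \<phi> where \<phi>: "inj_on \<phi> (verts (fst g))" "rep (iso_class g) = mg_map \<phi> g"
    using rep_obtain[OF assms] by blast
  have "verts (fst (mg_ball r g)) \<subseteq> verts (fst g)"
    using assms by (cases g) (simp add: mg_ball_eq mgraphs_def ball_subset_verts)
  then have "mg_iso (mg_ball r g) (mg_map \<phi> (mg_ball r g))"
    unfolding mg_iso_iff using inj_on_subset[OF \<phi>(1)] by blast
  then show ?thesis unfolding ball_type_def \<phi>(2) mg_ball_map[OF mgraphs_wf[OF assms] \<phi>(1)]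
    by (rule iso_class_cong[OF mg_ball_mgraphs[OF assms], symmetric])
qed

lemma ball_type_eq_iff:
  assumes "g \<in> mgraphs" "h \<in> mgraphs"
  shows "ball_type r (iso_class g) = ball_type r (iso_class h) \<longleftrightarrow> (\<exists>\<phi>. piso r \<phi> g h)"
  using assms by (simp add: ball_type_iso_class iso_class_eq_iff mg_ball_mgraphs piso_def mg_iso_iff)

lemma balls_agree_iff:
  assumes "c \<in> mclasses" "d \<in> mclasses"
  shows "balls_agree r c d \<longleftrightarrow> ball_type r c = ball_type r d"
proof
  assume "balls_agree r c d"
  then obtain g h where gh: "g \<in> c" "h \<in> d" "mg_iso (mg_ball r g) (mg_ball r h)"
    by (auto simp: balls_agree_def)
  have g: "g \<in> mgraphs" "c = iso_class g" and h: "h \<in> mgraphs" "d = iso_class h"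
    using gh assms mclass_mem_iff by blast+
  show "ball_type r c = ball_type r d" unfolding g(2) h(2) ball_type_iso_class[OF g(1)] ball_type_iso_class[OF h(1)]
    by (rule iso_class_cong[OF mg_ball_mgraphs[OF g(1)] gh(3)])
next
  assume e: "ball_type r c = ball_type r d"
  have "mg_iso (mg_ball r (rep c)) (mg_ball r (rep d))"
    using e assms rep_mclass(1) mg_ball_mgraphs iso_class_eq_iff unfolding ball_type_def by blast
  moreover have "rep c \<in> c" "rep d \<in> d" using assms mclass_mem_iff rep_mclass by blast+
  ultimately show "balls_agree r c d" unfolding balls_agree_def by blast
qed

lemma ball_type_mclasses: "c \<in> mclasses \<Longrightarrow> ball_type r c \<in> mclasses"
  unfolding ball_type_def by (intro iso_class_mclasses mg_ball_mgraphs rep_mclass)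

lemma ball_type_ball_type:
  assumes "c \<in> mclasses" "r \<le> s" shows "ball_type r (ball_type s c) = ball_type r c"
  unfolding ball_type_def[of s] using ball_type_iso_class[OF mg_ball_mgraphs[OF rep_mclass(1)[OF assms(1)]]]
  by (simp add: mg_ball_mg_ball[OF assms(2)] ball_type_def)

lemma ball_type_mono:
  assumes "c \<in> mclasses" "d \<in> mclasses" "ball_type s c = ball_type s d" "r \<le> s" shows "ball_type r c = ball_type r d"
  using assms ball_type_ball_type by metis

lemma piso_facts:
  assumes p: "piso R \<phi> (G, S, x, D) (G', S', x', D')"
  shows "inj_on \<phi> (ball_verts G x R)" "ball_verts G' x' R = \<phi> ` ball_verts G x R" "\<phi> x = x'"
    "\<And>e. e \<subseteq> ball_verts G x R \<Longrightarrow> \<phi> ` e \<in> edges G' \<longleftrightarrow> e \<in> edges G"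
    "\<And>e. e \<subseteq> ball_verts G x R \<Longrightarrow> \<phi> ` e \<in> S' \<longleftrightarrow> e \<in> S"
    "D' \<inter> \<phi> ` ball_verts G x R = \<phi> ` (D \<inter> ball_verts G x R)"
proof -
  let ?W = "ball_verts G x R"
  show i: "inj_on \<phi> ?W" using p by (simp add: piso_def mg_ball_eq)
  have eq: "(induced G' (ball_verts G' x' R), {e \<in> S'. e \<subseteq> ball_verts G' x' R}, x', D' \<inter> ball_verts G' x' R)
    = (gmap \<phi> (induced G ?W), (\<lambda>e. \<phi> ` e) ` {e \<in> S. e \<subseteq> ?W}, \<phi> x, \<phi> ` (D \<inter> ?W))"
    using conjunct2[OF p[unfolded piso_def]] unfolding mg_ball_eq mg_map_def prod.case .
  note eqs = eq[unfolded prod.inject]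
  note eq1 = conjunct1[OF eqs] and eq2 = conjunct1[OF conjunct2[OF eqs]]
    and eq3 = conjunct1[OF conjunct2[OF conjunct2[OF eqs]]] and eq4 = conjunct2[OF conjunct2[OF conjunct2[OF eqs]]]
  show W: "ball_verts G' x' R = \<phi> ` ?W" using arg_cong[OF eq1, of verts] by simp
  show "\<phi> x = x'" by (rule eq3[symmetric])
  show "D' \<inter> \<phi> ` ?W = \<phi> ` (D \<inter> ?W)" using eq4 unfolding W .
  have E: "{e \<in> edges G'. e \<subseteq> \<phi> ` ?W} = (\<lambda>e. \<phi> ` e) ` {e \<in> edges G. e \<subseteq> ?W}"
    using arg_cong[OF eq1, of edges] unfolding W by simp
  have S: "{e \<in> S'. e \<subseteq> \<phi> ` ?W} = (\<lambda>e. \<phi> ` e) ` {e \<in> S. e \<subseteq> ?W}" using eq2 unfolding W .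
  have *: "\<phi> ` e \<in> T' \<longleftrightarrow> e \<in> T"
    if "{e \<in> T'. e \<subseteq> \<phi> ` ?W} = (\<lambda>e. \<phi> ` e) ` {e \<in> T. e \<subseteq> ?W}" "e \<subseteq> ?W" for e T T'
  proof -
    have "\<phi> ` e \<in> T' \<longleftrightarrow> \<phi> ` e \<in> {e \<in> T'. e \<subseteq> \<phi> ` ?W}" using that(2) by auto
    also have "\<dots> \<longleftrightarrow> e \<in> {e \<in> T. e \<subseteq> ?W}"
      unfolding that(1) using that(2) by (intro image_mem_edges_iff[OF i]) auto
    finally show ?thesis using that(2) by simp
  qed
  show "\<phi> ` e \<in> edges G' \<longleftrightarrow> e \<in> edges G" if "e \<subseteq> ?W" for e by (rule *[OF E that])
  show "\<phi> ` e \<in> S' \<longleftrightarrow> e \<in> S" if "e \<subseteq> ?W" for e by (rule *[OF S that])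
qed

lemma piso_adj:
  assumes p: "piso R \<phi> (G, S, x, D) (G', S', x', D')"
    and "u \<in> ball_verts G x R" "v \<in> ball_verts G x R"
  shows "adj G u v \<longleftrightarrow> adj G' (\<phi> u) (\<phi> v)"
    "adj (delete_edges G S) u v \<longleftrightarrow> adj (delete_edges G' S') (\<phi> u) (\<phi> v)"
  using piso_facts(4,5)[OF p, of "{u, v}"] assms by (auto simp: adj_def)

lemma piso_ball:
  assumes p: "piso R \<phi> (G, S, x, D) (G', S', x', D')" and y: "y \<in> ball_verts G x s" and st: "s + t \<le> R"
  shows "\<phi> y \<in> ball_verts G' x' s"
    "ball_verts G' (\<phi> y) t = \<phi> ` ball_verts G y t"
    "ball_verts (delete_edges G' S') (\<phi> y) t = \<phi> ` ball_verts (delete_edges G S) y t"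
    "ball_verts G y t \<subseteq> ball_verts G x R" "ball_verts G' (\<phi> y) t \<subseteq> ball_verts G' x' R"
proof -
  let ?W = "ball_verts G x R"
  note f = piso_facts[OF p]
  have "ball_verts G' (\<phi> x) s = \<phi> ` ball_verts G x s"
    using st ball_verts_mono[of s R G x] ball_verts_mono[of s R G' x'] f(2,3)
    by (intro ball_transport[OF f(1) piso_adj(1)[OF p]]) auto
  then show y': "\<phi> y \<in> ball_verts G' x' s" using y f(3) by auto
  show W: "ball_verts G y t \<subseteq> ?W"
    using ball_verts_trans[OF y, of t] ball_verts_mono[OF st, of G x] by simp
  show W': "ball_verts G' (\<phi> y) t \<subseteq> ball_verts G' x' R"
    using ball_verts_trans[OF y', of t] ball_verts_mono[OF st, of G' x'] by simp
  then have W': "ball_verts G' (\<phi> y) t \<subseteq> \<phi> ` ?W" by (simp add: f(2))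
  show "ball_verts G' (\<phi> y) t = \<phi> ` ball_verts G y t"
    by (rule ball_transport[OF f(1) piso_adj(1)[OF p] W W'])
  show "ball_verts (delete_edges G' S') (\<phi> y) t = \<phi> ` ball_verts (delete_edges G S) y t"
    by (rule ball_transport[OF f(1) piso_adj(2)[OF p]
          order_trans[OF ball_delete_subset W] order_trans[OF ball_delete_subset W']])
qed

text \<open>The basic tool for locality: the same map serves for a new root \<open>y\<close>, at the
  price of its distance from the old one. The new marked vertex sets need to correspond, through
  \<open>F\<close>, only inside the new balls. The second conclusion drops the edge marks.\<close>

lemma piso_shift:
  assumes p: "piso R \<phi> (G, S, x, D) (G', S', x', D')" and y: "y \<in> ball_verts G x s" and st: "s + t \<le> R"
    and E: "E \<inter> ball_verts G y t = F \<inter> ball_verts G y t" "E' \<inter> ball_verts G' (\<phi> y) t = \<phi> ` F \<inter> ball_verts G' (\<phi> y) t"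
    and F: "F \<subseteq> ball_verts G x R"
  shows "piso t \<phi> (G, S, y, E) (G', S', \<phi> y, E')" "piso t \<phi> (G, {}, y, E) (G', {}, \<phi> y, E')"
proof -
  let ?W = "ball_verts G x R" and ?B = "ball_verts G y t"
  note f = piso_facts[OF p] and b = piso_ball[OF p y st]
  have i: "inj_on \<phi> ?B" by (rule inj_on_subset[OF f(1) b(4)])
  have *: "{e \<in> T'. e \<subseteq> \<phi> ` ?B} = (\<lambda>e. \<phi> ` e) ` {e \<in> T. e \<subseteq> ?B}"
    if "\<And>e. e \<subseteq> ?W \<Longrightarrow> \<phi> ` e \<in> T' \<longleftrightarrow> e \<in> T" for T T'
  proof (intro equalityI subsetI)
    fix e' assume e': "e' \<in> {e \<in> T'. e \<subseteq> \<phi> ` ?B}"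
    then obtain e where e: "e \<subseteq> ?B" "e' = \<phi> ` e" by (auto elim!: subset_imageE)
    then have "e \<in> T" using that[of e] e' b(4) by auto
    then show "e' \<in> (\<lambda>e. \<phi> ` e) ` {e \<in> T. e \<subseteq> ?B}" using e by blast
  next
    fix e' assume "e' \<in> (\<lambda>e. \<phi> ` e) ` {e \<in> T. e \<subseteq> ?B}"
    then obtain e where e: "e \<in> T" "e \<subseteq> ?B" "e' = \<phi> ` e" by blast
    then show "e' \<in> {e \<in> T'. e \<subseteq> \<phi> ` ?B}" using that[of e] b(4) by auto
  qed
  have g: "induced G' (\<phi> ` ?B) = gmap \<phi> (induced G ?B)"
    using *[OF f(4)] by (intro ugraph_eqI) auto
  have d: "E' \<inter> \<phi> ` ?B = \<phi> ` (E \<inter> ?B)"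
    using E b(2) inj_on_image_Int[OF f(1) F b(4)] by simp
  show "piso t \<phi> (G, S, y, E) (G', S', \<phi> y, E')"
    using i g d *[OF f(5)] by (simp add: piso_def mg_ball_eq mg_map_def b(2))
  show "piso t \<phi> (G, {}, y, E) (G', {}, \<phi> y, E')"
    using i g d by (simp add: piso_def mg_ball_eq mg_map_def b(2))
qed

lemma piso_mono:
  assumes "piso R \<phi> (G, S, x, D) (G', S', x', D')" "r \<le> R"
  shows "piso r \<phi> (G, S, x, D) (G', S', x', D')"
proof -
  note f = piso_facts[OF assms(1)]
  have "ball_verts G' x' r \<subseteq> \<phi> ` ball_verts G x R"
    using ball_verts_mono[OF assms(2), of G' x'] f(2) by simp
  moreover have "ball_verts G x r \<subseteq> ball_verts G x R" by (rule ball_verts_mono[OF assms(2)])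
  ultimately have "piso r \<phi> (G, S, x, D) (G', S', \<phi> x, D')"
    using f assms(2)
    by (intro piso_shift(1)[OF assms(1), of x 0 r D "D \<inter> ball_verts G x R" D']) auto
  then show ?thesis using f(3) by simp
qed

lemma pisoE:
  assumes "c \<in> mclasses" "d \<in> mclasses" "ball_type r c = ball_type r d"
  obtains \<phi> where "piso r \<phi> (rep c) (rep d)"
proof -
  have "iso_class (mg_ball r (rep c)) = iso_class (mg_ball r (rep d))" using assms(3) by (simp add: ball_type_def)
  then show ?thesis using that
    iso_class_eq_iff[OF mg_ball_mgraphs[OF rep_mclass(1)[OF assms(1)]] mg_ball_mgraphs[OF rep_mclass(1)[OF assms(2)]], of r r]
    unfolding mg_iso_iff piso_def by blast
qed

section \<open>Koenig's lemma, and classes as limits of coherent ball types\<close>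

section \<open>Compactness\<close>

text \<open>If each member of \<open>B\<close> failed at some threshold, all would fail from a
  common threshold on.\<close>

lemma pigeonhole_antimono:
  assumes "finite B" "\<And>m m' b. P m' b \<Longrightarrow> m \<le> m' \<Longrightarrow> P m b" "\<And>m::nat. \<exists>b\<in>B. P m b"
  shows "\<exists>b\<in>B. \<forall>m. P m b"
proof (rule ccontr)
  assume "\<not> ?thesis"
  then obtain k where k: "\<And>b. b \<in> B \<Longrightarrow> \<not> P (k b) b" by metis
  \<comment> \<open>The sum merely serves as an upper bound for all the thresholds
    \<open>k b\<close>.\<close>
  obtain b where b: "b \<in> B" "P (\<Sum>b\<in>B. k b) b" using assms(3) by blast
  then have "P (k b) b" using assms(2) member_le_sum[of b B k] assms(1) by auto
  then show False using k b by auto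
qed

text \<open>The maps \<open>f n\<close> need not be onto, so a greedy choice could get stuck. The
  branch is therefore kept among elements that are reached from arbitrarily high levels; by
  finiteness such an element always has a preimage of the same kind.\<close>

lemma inverse_limit_nonempty:
  fixes A :: "nat \<Rightarrow> 'a set" and f :: "nat \<Rightarrow> 'a \<Rightarrow> 'a"
  assumes fin: "\<And>n. finite (A n)" and ne: "\<And>n. A n \<noteq> {}"
    and f: "\<And>n a. a \<in> A (Suc n) \<Longrightarrow> f n a \<in> A n"
  shows "\<exists>s. \<forall>n. s n \<in> A n \<and> f n (s (Suc n)) = s n"
proof -
  define pth where "pth m n t \<longleftrightarrow>
    (\<forall>i\<ge>n. i \<le> n + m \<longrightarrow> t i \<in> A i) \<and> (\<forall>i\<ge>n. i < n + m \<longrightarrow> f i (t (Suc i)) = t i)" for m n t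
  \<comment> \<open>\<open>ext m n a\<close>: the element \<open>a\<close> of level \<open>n\<close>
    starts a coherent path that climbs \<open>m\<close> further levels.\<close>
  define ext where "ext m n a \<longleftrightarrow> (\<exists>t. t n = a \<and> pth m n t)" for m n a
  have pth_Suc: "pth (Suc m) n t \<Longrightarrow> pth m (Suc n) t" for m n t
    unfolding pth_def by auto
  have anti: "ext m n a" if e: "ext m' n a" and le: "m \<le> m'" for m m' n a
  proof -
    obtain t where t: "t n = a" "pth m' n t" using e by (auto simp: ext_def)
    have "pth m n t" using t(2) le unfolding pth_def by auto
    then show ?thesis using t(1) by (auto simp: ext_def)
  qed
  have ex: "\<exists>a\<in>A n. ext m n a" for m n
  proof (induction m arbitrary: n)
    case 0
    obtain a where a: "a \<in> A n" using ne by blast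
    then have "pth 0 n (\<lambda>_. a)" by (auto simp: pth_def)
    then show ?case using a by (auto simp: ext_def)
  next
    case (Suc m)
    then obtain a where a: "a \<in> A (Suc n)" "ext m (Suc n) a" by blast
    then obtain t where t: "t (Suc n) = a" "pth m (Suc n) t" by (auto simp: ext_def)
    have fa: "f n a \<in> A n" by (rule f[OF a(1)])
    have "pth (Suc m) n (t(n := f n a))"
      unfolding pth_def
    proof (intro conjI allI impI)
      fix i assume "n \<le> i" "i \<le> n + Suc m"
      then show "(t(n := f n a)) i \<in> A i" using fa t(2) unfolding pth_def by (cases "i = n") auto
    next
      fix i assume "n \<le> i" "i < n + Suc m"
      then show "f i ((t(n := f n a)) (Suc i)) = (t(n := f n a)) i"
        using t unfolding pth_def by (cases "i = n") auto
    qed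
    then have "ext (Suc m) n (f n a)" unfolding ext_def by (intro exI[of _ "t(n := f n a)"]) simp
    then show ?case using fa by blast
  qed
  have step: "\<exists>b. b \<in> A (Suc n) \<and> (\<forall>m. ext m (Suc n) b) \<and> f n b = a" if "\<forall>m. ext m n a" for n a
  proof -
    have "\<exists>b\<in>A (Suc n). \<forall>m. ext m (Suc n) b \<and> f n b = a"
    proof (rule pigeonhole_antimono[where P = "\<lambda>m b. ext m (Suc n) b \<and> f n b = a", OF fin])
      fix m
      have "ext (Suc m) n a" using that by blast
      then obtain t where t: "t n = a" "pth (Suc m) n t" by (auto simp: ext_def)
      have "t (Suc n) \<in> A (Suc n)" "f n (t (Suc n)) = a" using t by (auto simp: pth_def)
      moreover have "ext m (Suc n) (t (Suc n))" using pth_Suc[OF t(2)] by (auto simp: ext_def)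
      ultimately show "\<exists>b\<in>A (Suc n). ext m (Suc n) b \<and> f n b = a" by blast
    qed (use anti in blast)
    then show ?thesis by blast
  qed
  have "\<exists>a\<in>A 0. \<forall>m. ext m 0 a"
    by (rule pigeonhole_antimono[where P = "\<lambda>m b. ext m 0 b", OF fin]) (use anti ex in blast)+
  then have "\<exists>a. a \<in> A 0 \<and> (\<forall>m. ext m 0 a)" by blast
  then have "\<exists>s. \<forall>n. (s n \<in> A n \<and> (\<forall>m. ext m n (s n))) \<and> f n (s (Suc n)) = s n"
    by (rule dependent_nat_choice) (use step in blast)
  then show ?thesis by blast
qed

text \<open>The partial isomorphisms between the balls of radius \<open>n\<close> form an inverse system of finite sets.\<close>

lemma mclass_eqI:
  assumes c: "c \<in> mclasses" "d \<in> mclasses" and eq: "\<And>r. ball_type r c = ball_type r d"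
  shows "c = d"
proof -
  obtain G S x D where g: "rep c = (G, S, x, D)" by (metis prod_cases4)
  obtain G' S' x' D' where h: "rep d = (G', S', x', D')" by (metis prod_cases4)
  note gh = g h
  have m: "(G, S, x, D) \<in> mgraphs" "(G', S', x', D') \<in> mgraphs" using rep_mclass(1) c gh by metis+
  let ?B = "ball_verts G x" and ?B' = "ball_verts G' x'"
  have fin: "finite (?B n)" "finite (?B' n)" for n
    using m by (auto simp: mgraphs_def intro: finite_ball)
  define A where "A n = {\<phi> \<in> PiE (?B n) (\<lambda>_. ?B' n). piso n \<phi> (G, S, x, D) (G', S', x', D')}" for n
  have restr: "restrict \<phi> (?B n) \<in> A n" if \<phi>: "piso n \<phi> (G, S, x, D) (G', S', x', D')" for \<phi> n
  proof -
    have wf: "wf_mg (mg_ball n (G, S, x, D))" using m mg_ball_mgraphs mgraphs_wf by blast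
    have "mg_map (restrict \<phi> (?B n)) (mg_ball n (G, S, x, D)) = mg_map \<phi> (mg_ball n (G, S, x, D))"
      by (rule mg_map_cong[OF wf]) (simp add: mg_ball_eq)
    then have "piso n (restrict \<phi> (?B n)) (G, S, x, D) (G', S', x', D')"
      using \<phi> by (simp add: piso_def mg_ball_eq inj_on_restrict_eq)
    then show ?thesis using piso_facts(2)[OF \<phi>] by (auto simp: A_def)
  qed
  have "\<exists>s. \<forall>n. s n \<in> A n \<and> restrict (s (Suc n)) (?B n) = s n"
  proof (rule inverse_limit_nonempty)
    show "finite (A n)" for n
    proof -
      have "finite (PiE (?B n) (\<lambda>_. ?B' n))" by (intro finite_PiE fin)
      then show ?thesis by (simp add: A_def)
    qed
    show "A n \<noteq> {}" for n
    proof -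
      obtain \<phi> where "piso n \<phi> (rep c) (rep d)" using pisoE[OF c eq] by blast
      then show ?thesis using restr unfolding gh by blast
    qed
    show "restrict \<phi> (?B n) \<in> A n" if "\<phi> \<in> A (Suc n)" for n \<phi>
    proof -
      have "piso (Suc n) \<phi> (G, S, x, D) (G', S', x', D')" using that by (simp add: A_def)
      then show ?thesis by (intro restr) (rule piso_mono, auto)
    qed
  qed
  then obtain s where s: "\<And>n. s n \<in> A n" "\<And>n. restrict (s (Suc n)) (?B n) = s n" by blast
  have coh: "s m v = s n v" if "v \<in> ?B n" "n \<le> m" for m n v
    using that(2)
  proof (induction m rule: dec_induct)
    case (step m)
    have "v \<in> ?B m" using that(1) ball_verts_mono[OF step(1), of G x] by auto
    then have "s (Suc m) v = s m v" using s(2)[of m] by (metis restrict_apply')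
    then show ?case using step by simp
  qed simp
  \<comment> \<open>The coherent maps glue: each vertex is sent where the first map defined at it
    sends it, and all later maps agree.\<close>
  define \<phi> where "\<phi> v = s (LEAST n. v \<in> ?B n) v" for v
  have \<phi>: "\<phi> v = s n v" if "v \<in> ?B n" for v n
    unfolding \<phi>_def using coh[of v "LEAST n. v \<in> ?B n" n] that by (metis LeastI Least_le)
  have p: "piso n \<phi> (G, S, x, D) (G', S', x', D')" for n
  proof -
    have wf: "wf_mg (mg_ball n (G, S, x, D))" using m mg_ball_mgraphs mgraphs_wf by blast
    have "mg_map \<phi> (mg_ball n (G, S, x, D)) = mg_map (s n) (mg_ball n (G, S, x, D))"
      by (rule mg_map_cong[OF wf]) (simp add: mg_ball_eq \<phi>)
    moreover have "inj_on \<phi> (?B n)" using s(1)[of n] inj_on_cong[of "?B n" \<phi> "s n"] \<phi>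
      by (auto simp: A_def piso_def mg_ball_eq)
    ultimately show ?thesis using s(1)[of n] by (simp add: A_def piso_def mg_ball_eq)
  qed
  note f = piso_facts[OF p]
  have V: "verts G = (\<Union>n. ?B n)" "verts G' = (\<Union>n. ?B' n)"
    using m by (auto simp: mgraphs_def connected_graph_def comp_verts_ball)
  have chain: "\<exists>n. e \<subseteq> ?B n" if e: "e \<in> edges G" for e
  proof -
    obtain u v where uv: "u \<in> verts G" "v \<in> verts G" "e = {u, v}" "adj G u v"
      using e m(1) by (auto simp: mgraphs_def elim: edgeE)
    then obtain n where "u \<in> ?B n" using V by blast
    then have "e \<subseteq> ?B (Suc n)" using uv by (auto simp: ball_verts_Suc)
    then show ?thesis ..
  qed
  have chain': "\<exists>n. e \<subseteq> ?B' n" if e: "e \<in> edges G'" for e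
  proof -
    obtain u v where uv: "u \<in> verts G'" "v \<in> verts G'" "e = {u, v}" "adj G' u v"
      using e m(2) by (auto simp: mgraphs_def elim: edgeE)
    then obtain n where "u \<in> ?B' n" using V by blast
    then have "e \<subseteq> ?B' (Suc n)" using uv by (auto simp: ball_verts_Suc)
    then show ?thesis ..
  qed
  have T: "T' = (\<lambda>e. \<phi> ` e) ` T"
    if iff: "\<And>n e. e \<subseteq> ?B n \<Longrightarrow> \<phi> ` e \<in> T' \<longleftrightarrow> e \<in> T"
      and sub: "T \<subseteq> edges G" "T' \<subseteq> edges G'" for T T'
  proof (intro equalityI subsetI)
    fix e' assume e': "e' \<in> T'"
    then obtain n where "e' \<subseteq> ?B' n" using chain'[of e'] sub(2) by auto
    then obtain e where "e \<subseteq> ?B n" "e' = \<phi> ` e" using f(2)[of n] by (auto elim!: subset_imageE)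
    then show "e' \<in> (\<lambda>e. \<phi> ` e) ` T" using iff[of e n] e' by auto
  next
    fix e' assume "e' \<in> (\<lambda>e. \<phi> ` e) ` T"
    then obtain e where e: "e \<in> T" "e' = \<phi> ` e" by blast
    then obtain n where "e \<subseteq> ?B n" using chain[of e] sub(1) by auto
    then show "e' \<in> T'" using iff[of e n] e by auto
  qed
  have sub: "S \<subseteq> edges G" "S' \<subseteq> edges G'" "D \<subseteq> verts G" "D' \<subseteq> verts G'" using m by (auto simp: mgraphs_def)
  have inj: "inj_on \<phi> (verts G)"
  proof (rule inj_onI)
    fix u v assume uv: "u \<in> verts G" "v \<in> verts G" "\<phi> u = \<phi> v"
    obtain n where "u \<in> ?B n" using uv(1) V(1) by blast
    moreover obtain k where "v \<in> ?B k" using uv(2) V(1) by blast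
    ultimately have "u \<in> ?B (max n k)" "v \<in> ?B (max n k)"
      using ball_verts_mono[of n "max n k" G x] ball_verts_mono[of k "max n k" G x] by auto
    then show "u = v" using f(1)[of "max n k"] uv(3) by (auto dest: inj_onD)
  qed
  have "verts G' = \<phi> ` verts G" unfolding V f(2) by (rule image_UN[symmetric])
  moreover have "D' = \<phi> ` D"
  proof -
    have "D' = (\<Union>n. D' \<inter> \<phi> ` ?B n)" using sub(4) unfolding V f(2) by blast
    also have "\<dots> = (\<Union>n. \<phi> ` (D \<inter> ?B n))" by (simp only: f(6))
    also have "\<dots> = \<phi> ` D" using sub(3) unfolding V by blast
    finally show ?thesis .
  qed
  ultimately have "rep d = mg_map \<phi> (rep c)"
    using T[OF f(4) order_refl order_refl] T[OF f(5) sub(1,2)] f(3)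
    unfolding gh mg_map_def prod.case prod.inject by (intro conjI ugraph_eqI) simp_all
  then have "mg_iso (rep c) (rep d)" unfolding mg_iso_iff using inj gh by auto
  then show ?thesis using rep_mclass[OF c(1)] rep_mclass[OF c(2)] iso_class_cong by metis
qed

lemma mclass_rep_mem: "c \<in> mclasses \<Longrightarrow> rep c \<in> c"
  using mclass_mem_iff rep_mclass by blast

text \<open>Concrete representatives are chosen so that each one is literally a ball of the next;
  the limit is their union.\<close>

lemma mclass_limit:
  assumes t: "\<And>n. t n \<in> mclasses" and coh: "\<And>n. ball_type n (t (Suc n)) = t n"
  shows "\<exists>c\<in>mclasses. \<forall>n. ball_type n c = t n"
proof -
  have fin: "finite (verts (fst h))" if h: "h \<in> t n" for h n
  proof -
    have hm: "h \<in> mgraphs" "iso_class h = t n" using h mclass_mem_iff[OF t] by auto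
    have "iso_class (mg_ball n (rep (t (Suc n)))) = iso_class h"
      using coh[of n] hm by (simp add: ball_type_def)
    then have "mg_iso (mg_ball n (rep (t (Suc n)))) h"
      using iso_class_eq_iff[OF mg_ball_mgraphs[OF rep_mclass(1)[OF t]] hm(1)] by blast
    then show ?thesis using finite_mg_ball[OF rep_mclass(1)[OF t]] by (auto simp: mg_iso_iff)
  qed
  have step: "\<exists>h'. h' \<in> t (Suc n) \<and> mg_ball n h' = h" if hin: "h \<in> t n" for h n
  proof -
    have hm: "h \<in> mgraphs" "iso_class h = t n" using hin mclass_mem_iff[OF t] by auto
    define g where "g = rep (t (Suc n))"
    have g: "g \<in> mgraphs" "iso_class g = t (Suc n)" using rep_mclass[OF t] by (auto simp: g_def)
    have "iso_class (mg_ball n g) = iso_class h" using coh[of n] hm(2) by (simp add: ball_type_def g_def)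
    then have "mg_iso (mg_ball n g) h"
      using iso_class_eq_iff[OF mg_ball_mgraphs[OF g(1)] hm(1)] by blast
    then obtain \<phi> where \<phi>: "inj_on \<phi> (verts (fst (mg_ball n g)))" "h = mg_map \<phi> (mg_ball n g)"
      by (auto simp: mg_iso_iff)
    let ?B = "verts (fst (mg_ball n g))"
    define K where "K = Suc (Max (insert 0 (verts (fst h))))"
    \<comment> \<open>The ball must receive exactly the labels of \<open>h\<close>, and all other
      vertices fresh ones. Since \<open>K\<close> exceeds every label of \<open>h\<close>, adding
      \<open>K\<close> keeps the map injective and within the natural numbers.\<close>
    define \<psi> where "\<psi> v = (if v \<in> ?B then \<phi> v else v + K)" for v
    have lt: "\<phi> v < K" if "v \<in> ?B" for v
    proof -
      have "\<phi> v \<in> verts (fst h)" using that \<phi>(2) by simp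
      then show ?thesis using fin[OF hin] by (simp add: K_def less_Suc_eq_le)
    qed
    have inj: "inj_on \<psi> (verts (fst g))"
    proof (rule inj_onI)
      fix u v assume "\<psi> u = \<psi> v"
      then show "u = v" using lt[of u] lt[of v] \<phi>(1)
        by (auto simp: \<psi>_def dest: inj_onD split: if_splits)
    qed
    have "mg_ball n (mg_map \<psi> g) = mg_map \<psi> (mg_ball n g)" by (rule mg_ball_map[OF mgraphs_wf[OF g(1)] inj])
    also have "\<dots> = h"
      unfolding \<phi>(2) by (rule mg_map_cong[OF mgraphs_wf[OF mg_ball_mgraphs[OF g(1)]]]) (simp add: \<psi>_def)
    finally have b: "mg_ball n (mg_map \<psi> g) = h" .
    have "mg_iso g (mg_map \<psi> g)" unfolding mg_iso_iff using inj by blast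
    then have "iso_class (mg_map \<psi> g) = t (Suc n)" using iso_class_cong[OF g(1)] g(2) by metis
    then have "mg_map \<psi> g \<in> t (Suc n)" using mgraphs_map[OF g(1) inj] mclass_mem_iff[OF t] by blast
    then show ?thesis using b by blast
  qed
  have "\<exists>h. h \<in> t 0" using mclass_rep_mem[OF t] by blast
  then have "\<exists>h. \<forall>n. h n \<in> t n \<and> mg_ball n (h (Suc n)) = h n"
    by (rule dependent_nat_choice) (use step in blast)
  then obtain h where h: "\<And>n. h n \<in> t n" "\<And>n. mg_ball n (h (Suc n)) = h n" by blast
  have hm: "h n \<in> mgraphs" "iso_class (h n) = t n" for n using h(1) mclass_mem_iff[OF t] by auto
  have hb: "mg_ball n (h m) = h n" if "n < m" for n m
    using that
  proof (induction m)
    case (Suc m)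
    show ?case
    proof (cases "n = m")
      case False
      then have "mg_ball n (h m) = h n" using Suc by simp
      then show ?thesis using mg_ball_mg_ball[of n m "h (Suc m)"] h(2)[of m] Suc.prems False by simp
    qed (simp add: h(2))
  qed simp
  define GG where "GG n = fst (h n)" for n
  define SS where "SS n = fst (snd (h n))" for n
  define XX where "XX n = fst (snd (snd (h n)))" for n
  define DD where "DD n = snd (snd (snd (h n)))" for n
  have hh: "h n = (GG n, SS n, XX n, DD n)" for n by (simp add: GG_def SS_def XX_def DD_def)
  define o' where "o' = XX 0"
  have ball: "GG n = induced (GG m) (ball_verts (GG m) (XX m) n)"
    "SS n = {e \<in> SS m. e \<subseteq> ball_verts (GG m) (XX m) n}" "XX n = XX m"
    "DD n = DD m \<inter> ball_verts (GG m) (XX m) n" if "n < m" for n m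
  proof -
    note q = hb[OF that, unfolded hh mg_ball_eq prod.inject]
    show "GG n = induced (GG m) (ball_verts (GG m) (XX m) n)" by (rule conjunct1[OF q, symmetric])
    show "SS n = {e \<in> SS m. e \<subseteq> ball_verts (GG m) (XX m) n}"
      by (rule conjunct1[OF conjunct2[OF q], symmetric])
    show "XX n = XX m" by (rule conjunct1[OF conjunct2[OF conjunct2[OF q]], symmetric])
    show "DD n = DD m \<inter> ball_verts (GG m) (XX m) n"
      by (rule conjunct2[OF conjunct2[OF conjunct2[OF q]], symmetric])
  qed
  have X: "XX n = o'" for n unfolding o'_def using ball(3)[of 0 n] by (cases "n = 0") auto
  define V where "V n = verts (GG n)" for n
  have Vball: "V n = ball_verts (GG m) o' n" if "n < m" for n m
    using arg_cong[OF ball(1)[OF that], of verts] X by (simp add: V_def)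
  have E: "edges (GG n) = {e \<in> edges (GG m). e \<subseteq> V n}" if "n < m" for n m
    using arg_cong[OF ball(1)[OF that], of edges] Vball[OF that] X by simp
  have S: "SS n = {e \<in> SS m. e \<subseteq> V n}" if "n < m" for n m
    using ball(2)[OF that] Vball[OF that] X by simp
  have D: "DD n = DD m \<inter> V n" if "n < m" for n m
    using ball(4)[OF that] Vball[OF that] X by simp
  have gm: "is_graph (GG n)" "connected_graph (GG n)" "locally_finite (GG n)" "SS n \<subseteq> edges (GG n)"
    "o' \<in> V n" "DD n \<subseteq> V n" for n
    using hm(1)[of n] X[of n] unfolding hh by (auto simp: mgraphs_def V_def)
  have Vmono: "V n \<subseteq> V m" if "n \<le> m" for n m
    using that Vball[of n m] ball_subset_verts[OF gm(1), of o' m n] gm(5)[of m]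
    by (cases "n = m") (auto simp: V_def)
  have esub: "e \<subseteq> V n" if "e \<in> edges (GG n)" for e n
    using edges_subset[OF gm(1) that] by (simp add: V_def)
  define G where "G = \<lparr>verts = (\<Union>n. V n), edges = (\<Union>n. edges (GG n))\<rparr>"
  have vG: "verts G = (\<Union>n. V n)" and eG: "edges G = (\<Union>n. edges (GG n))" by (simp_all add: G_def)
  have EG: "{e \<in> edges G. e \<subseteq> V n} = edges (GG n)" for n
  proof (intro equalityI subsetI)
    fix e assume "e \<in> {e \<in> edges G. e \<subseteq> V n}"
    then obtain m where m: "e \<in> edges (GG m)" "e \<subseteq> V n" unfolding eG by auto
    show "e \<in> edges (GG n)"
    proof (cases n m rule: linorder_cases)
      case less then show ?thesis using m E by auto
    next
      case greater then show ?thesis using m E[OF greater] by auto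
    qed (use m in auto)
  next
    fix e assume "e \<in> edges (GG n)"
    then show "e \<in> {e \<in> edges G. e \<subseteq> V n}" using esub unfolding eG by auto
  qed
  have SG: "{e \<in> (\<Union>m. SS m). e \<subseteq> V n} = SS n" for n
  proof (intro equalityI subsetI)
    fix e assume "e \<in> {e \<in> (\<Union>m. SS m). e \<subseteq> V n}"
    then obtain m where m: "e \<in> SS m" "e \<subseteq> V n" by auto
    show "e \<in> SS n"
    proof (cases n m rule: linorder_cases)
      case less then show ?thesis using m S by auto
    next
      case greater then show ?thesis using m S[OF greater] by auto
    qed (use m in auto)
  next
    fix e assume "e \<in> SS n"
    then show "e \<in> {e \<in> (\<Union>m. SS m). e \<subseteq> V n}" using esub[of e n] gm(4) by auto
  qed
  have DG: "(\<Union>m. DD m) \<inter> V n = DD n" for n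
  proof (intro equalityI subsetI)
    fix v assume "v \<in> (\<Union>m. DD m) \<inter> V n"
    then obtain m where m: "v \<in> DD m" "v \<in> V n" by auto
    show "v \<in> DD n"
    proof (cases n m rule: linorder_cases)
      case less then show ?thesis using m D by auto
    next
      case greater then show ?thesis using m D[OF greater] by auto
    qed (use m in auto)
  next
    fix v assume "v \<in> DD n"
    then show "v \<in> (\<Union>m. DD m) \<inter> V n" using gm(6)[of n] by auto
  qed
  have iG: "is_graph G"
    unfolding is_graph_def
  proof
    fix e assume "e \<in> edges G"
    then obtain n where "e \<in> edges (GG n)" unfolding eG by auto
    then obtain u v where "u \<in> V n" "v \<in> V n" "u \<noteq> v" "e = {u, v}"
      using gm(1)[of n] by (auto simp: V_def elim: edgeE)
    then show "\<exists>u\<in>verts G. \<exists>v\<in>verts G. u \<noteq> v \<and> e = {u, v}" unfolding vG by blast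
  qed
  have adjG: "adj G u v \<longleftrightarrow> (\<exists>n. adj (GG n) u v)" for u v unfolding adj_def eG by auto
  have Bn: "ball_verts G o' k = V k" for k
  proof (induction k)
    case 0
    have "V 0 = {o'}" using Vball[of 0 1] by simp
    then show ?case by simp
  next
    case (Suc k)
    have "ball_verts G o' (Suc k) = V k \<union> {v. \<exists>u\<in>V k. adj G u v}" by (simp add: ball_verts_Suc Suc)
    also have "\<dots> = V (Suc k)"
    proof (intro equalityI subsetI)
      fix v assume "v \<in> V k \<union> {v. \<exists>u\<in>V k. adj G u v}"
      then consider "v \<in> V k" | u n where "u \<in> V k" "adj (GG n) u v" using adjG by auto
      then show "v \<in> V (Suc k)"
      proof cases
        case 1 then show ?thesis using Vmono[of k "Suc k"] by auto
      next
        case 2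
        \<comment> \<open>A level that contains the edge found at level \<open>n\<close> and lies
          strictly above \<open>Suc k\<close>, as \<open>Vball\<close> requires.\<close>
        define m where "m = Suc (Suc (max n k))"
        have "{u, v} \<in> edges (GG m)" using 2(2) E[of n m] by (auto simp: adj_def m_def)
        then have "adj (GG m) u v" by (simp add: adj_def)
        moreover have "u \<in> ball_verts (GG m) o' k" using 2(1) Vball[of k m] by (simp add: m_def)
        ultimately have "v \<in> ball_verts (GG m) o' (Suc k)" by (auto simp: ball_verts_Suc)
        then show ?thesis using Vball[of "Suc k" m] by (simp add: m_def)
      qed
    next
      fix v assume "v \<in> V (Suc k)"
      then have "v \<in> ball_verts (GG (Suc (Suc k))) o' (Suc k)" using Vball[of "Suc k" "Suc (Suc k)"] by simp
      then consider "v \<in> ball_verts (GG (Suc (Suc k))) o' k" | u where "u \<in> ball_verts (GG (Suc (Suc k))) o' k" "adj (GG (Suc (Suc k))) u v"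
        by (auto simp: ball_verts_Suc)
      then show "v \<in> V k \<union> {v. \<exists>u\<in>V k. adj G u v}"
        using Vball[of k "Suc (Suc k)"] adjG by cases auto
    qed
    finally show ?case .
  qed
  have oG: "o' \<in> verts G" unfolding vG using gm(5) by auto
  have c0: "comp_verts G o' = verts G" unfolding comp_verts_ball Bn vG ..
  have "comp_verts G v = verts G" if "v \<in> verts G" for v
    using comp_verts_eq[of v G o'] that unfolding c0 by simp
  then have cG: "connected_graph G" unfolding connected_graph_def using oG by blast
  have lG: "locally_finite G"
    unfolding locally_finite_def
  proof
    fix v assume "v \<in> verts G"
    then obtain n where n: "v \<in> V n" unfolding vG by auto
    have "incident_edges (edges G) v \<subseteq> Pow (V (Suc n))"
    proof
      fix e assume e: "e \<in> incident_edges (edges G) v"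
      then obtain a b where ab: "e = {a, b}" "adj G a b" "v \<in> {a, b}"
        using iG by (auto simp: incident_edges_def elim: edgeE)
      then have "e \<subseteq> ball_verts G o' (Suc n)" using n adj_sym[of G a b] unfolding ball_verts_Suc Bn by auto
      then show "e \<in> Pow (V (Suc n))" unfolding Bn by simp
    qed
    moreover have "finite (V (Suc n))" using fin[OF h(1)[of "Suc n"]] by (simp add: V_def GG_def)
    ultimately show "finite (incident_edges (edges G) v)" by (meson finite_Pow_iff finite_subset)
  qed
  define g where "g = (G, \<Union>n. SS n, o', \<Union>n. DD n)"
  have "(\<Union>n. SS n) \<subseteq> edges G" unfolding eG using gm(4) by blast
  moreover have "(\<Union>n. DD n) \<subseteq> verts G" unfolding vG using gm(6) by blast
  ultimately have gg: "g \<in> mgraphs" unfolding g_def mgraphs_def using iG cG lG oG by auto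
  have "induced G (V n) = GG n" for n using EG[of n] by (intro ugraph_eqI) (auto simp: V_def)
  then have "mg_ball n g = h n" for n
    unfolding g_def mg_ball_eq Bn SG DG hh X by simp
  then have "ball_type n (iso_class g) = t n" for n using ball_type_iso_class[OF gg, of n] hm(2) by simp
  then show ?thesis using iso_class_mclasses[OF gg] by blast
qed

section \<open>The ultrametric topology, local functions and generators of the Borel sets\<close>

section \<open>The local topology and its Borel sets\<close>

text \<open>The greatest radius of agreement exists because distinct classes have different balls of
  some radius, and then of every larger one. The list of possible values in the last claim is what
  makes the ultrametric inequality a matter of comparing ball types.\<close>

lemma local_dist_le_iff:
  assumes "c \<in> mclasses" "d \<in> mclasses"
  shows "local_dist c d \<le> 1 / (real n + 1) \<longleftrightarrow> ball_type n c = ball_type n d"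
    "local_dist c d = 0 \<longleftrightarrow> c = d" "0 \<le> local_dist c d" "local_dist c d \<le> 2"
    "local_dist c d = 0 \<or> local_dist c d = 2 \<or> (\<exists>m. local_dist c d = 1 / (real m + 1))"
proof -
  let ?g = "GREATEST r. balls_agree r c d"
  have "(local_dist c d \<le> 1 / (real n + 1) \<longleftrightarrow> ball_type n c = ball_type n d) \<and> (local_dist c d = 0 \<longleftrightarrow> c = d)"
  proof (cases "c = d")
    case False
    then obtain R where R: "ball_type R c \<noteq> ball_type R d" using mclass_eqI[OF assms] by blast
    have bound: "r \<le> R" if "balls_agree r c d" for r
    proof (rule ccontr)
      assume "\<not> r \<le> R"
      moreover have "ball_type r c = ball_type r d" using that balls_agree_iff[OF assms] by blast
      ultimately show False using ball_type_mono[OF assms, of r R] R by simp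
    qed
    show ?thesis
    proof (cases "\<exists>r. balls_agree r c d")
      case True
      then obtain r where r: "balls_agree r c d" by blast
      have g: "balls_agree ?g c d" using GreatestI_nat[of "\<lambda>r. balls_agree r c d", OF r] bound by blast
      have "ball_type n c = ball_type n d \<longleftrightarrow> n \<le> ?g"
      proof
        assume "ball_type n c = ball_type n d"
        then show "n \<le> ?g" using Greatest_le_nat[of "\<lambda>r. balls_agree r c d" n R] bound balls_agree_iff[OF assms] by blast
      next
        assume "n \<le> ?g" then show "ball_type n c = ball_type n d" using g ball_type_mono[OF assms] balls_agree_iff[OF assms] by blast
      qed
      moreover have "1 / (real ?g + 1) \<le> 1 / (real n + 1) \<longleftrightarrow> n \<le> ?g"
        by (simp add: field_simps)
      ultimately show ?thesis using False True by (simp add: local_dist_def)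
    next
      case nTrue: False
      have "1 / (real n + 1) < 2" by (simp add: field_simps)
      then show ?thesis using False nTrue balls_agree_iff[OF assms] by (auto simp: local_dist_def)
    qed
  qed (simp add: local_dist_def)
  then show "local_dist c d \<le> 1 / (real n + 1) \<longleftrightarrow> ball_type n c = ball_type n d" "local_dist c d = 0 \<longleftrightarrow> c = d" by auto
  show "0 \<le> local_dist c d" "local_dist c d \<le> 2" by (auto simp: local_dist_def field_simps)
  show "local_dist c d = 0 \<or> local_dist c d = 2 \<or> (\<exists>m. local_dist c d = 1 / (real m + 1))"
    by (auto simp: local_dist_def)
qed

lemma carried_mg_ball: "carried (mg_ball r g)"
  by (cases g) (auto simp: mg_ball_eq carried_def)

lemma local_dist_sym: "local_dist c d = local_dist d c"
proof -
  have "balls_agree r c d \<longleftrightarrow> balls_agree r d c" for r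
    unfolding balls_agree_def using carried_iso_sym[OF carried_mg_ball] by blast
  then show ?thesis unfolding local_dist_def by simp
qed

text \<open>The maximum on the right is 0, 2 or 1/(n + 1). The first two cases are trivial, and in
  the third the claim is transitivity of having the same ball of radius n.\<close>

lemma local_dist_ultra:
  assumes "c \<in> mclasses" "d \<in> mclasses" "e \<in> mclasses"
  shows "local_dist c e \<le> max (local_dist c d) (local_dist d e)"
proof -
  let ?m = "max (local_dist c d) (local_dist d e)"
  have "?m = 0 \<or> ?m = 2 \<or> (\<exists>n. ?m = 1 / (real n + 1))"
    using local_dist_le_iff(5)[OF assms(1,2)] local_dist_le_iff(5)[OF assms(2,3)] by (auto simp: max_def)
  then consider "?m = 0" | "?m = 2" | n where "?m = 1 / (real n + 1)" by blast
  then show ?thesis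
  proof cases
    case 1
    then have "local_dist c d = 0" "local_dist d e = 0"
      using local_dist_le_iff(3)[OF assms(1,2)] local_dist_le_iff(3)[OF assms(2,3)] by (auto simp: max_def split: if_splits)
    then show ?thesis using local_dist_le_iff(2)[OF assms(1,2)] local_dist_le_iff(2)[OF assms(2,3)] by auto
  next
    case 2 then show ?thesis using local_dist_le_iff(4)[OF assms(1,3)] by simp
  next
    case 3
    then have "local_dist c d \<le> 1 / (real n + 1)" "local_dist d e \<le> 1 / (real n + 1)" by linarith+
    then have "ball_type n c = ball_type n e"
      using local_dist_le_iff(1)[OF assms(1,2)] local_dist_le_iff(1)[OF assms(2,3)] by simp
    then show ?thesis using 3 local_dist_le_iff(1)[OF assms(1,3)] by simp
  qed
qed

lemma Metric_space_local:
  assumes X: "X \<subseteq> mclasses" shows "Metric_space X local_dist"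
proof
  show "0 \<le> local_dist c d" for c d by (auto simp: local_dist_def)
  show "local_dist c d = local_dist d c" for c d by (rule local_dist_sym)
  show "local_dist c d = 0 \<longleftrightarrow> c = d" if "c \<in> X" "d \<in> X" for c d
    using that X by (intro local_dist_le_iff(2)) auto
  show "local_dist c e \<le> local_dist c d + local_dist d e" if "c \<in> X" "d \<in> X" "e \<in> X" for c d e
    using local_dist_ultra[of c d e] local_dist_le_iff(3)[of c d] local_dist_le_iff(3)[of d e] that X
    by (auto simp: max_def subset_iff split: if_splits)
qed

text \<open>The form in which the topology is used from here on: openness is tested by agreement of
  balls instead of distances.\<close>

lemma openin_local:
  assumes X: "X \<subseteq> mclasses"
  shows "openin (local_topology X) U \<longleftrightarrow> U \<subseteq> X \<and> (\<forall>c\<in>U. \<exists>r. \<forall>d\<in>X. ball_type r d = ball_type r c \<longrightarrow> d \<in> U)"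
proof -
  interpret Metric_space X local_dist by (rule Metric_space_local[OF X])
  have "(\<exists>\<epsilon>>0. mball c \<epsilon> \<subseteq> U) \<longleftrightarrow> (\<exists>r. \<forall>d\<in>X. ball_type r d = ball_type r c \<longrightarrow> d \<in> U)" if c: "c \<in> X" for c
  proof
    assume "\<exists>\<epsilon>>0. mball c \<epsilon> \<subseteq> U"
    then obtain \<epsilon> where e: "\<epsilon> > 0" "mball c \<epsilon> \<subseteq> U" by blast
    obtain r where r: "1 / (real r + 1) < \<epsilon>" using nat_approx_posE[OF e(1)] by (metis Suc_eq_plus1 of_nat_Suc add.commute)
    have "d \<in> U" if "d \<in> X" "ball_type r d = ball_type r c" for d
    proof -
      have "local_dist c d \<le> 1 / (real r + 1)" using local_dist_le_iff(1)[of c d r] that c X by auto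
      then show ?thesis using e(2) r that(1) c by (auto simp: subset_iff)
    qed
    then show "\<exists>r. \<forall>d\<in>X. ball_type r d = ball_type r c \<longrightarrow> d \<in> U" by blast
  next
    assume "\<exists>r. \<forall>d\<in>X. ball_type r d = ball_type r c \<longrightarrow> d \<in> U"
    then obtain r where r: "\<forall>d\<in>X. ball_type r d = ball_type r c \<longrightarrow> d \<in> U" by blast
    have "mball c (1 / (real r + 1)) \<subseteq> U"
    proof
      fix d assume "d \<in> mball c (1 / (real r + 1))"
      then have d: "d \<in> X" "local_dist c d \<le> 1 / (real r + 1)" by auto
      then have "ball_type r d = ball_type r c" using local_dist_le_iff(1)[of c d r] c X by auto
      then show "d \<in> U" using r d by blast
    qed
    then show "\<exists>\<epsilon>>0. mball c \<epsilon> \<subseteq> U" by (intro exI[of _ "1 / (real r + 1)"]) auto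
  qed
  then show ?thesis unfolding local_topology_def openin_mtopology by (meson subsetD)
qed

lemma topspace_local: "X \<subseteq> mclasses \<Longrightarrow> topspace (local_topology X) = X"
  unfolding local_topology_def using Metric_space.topspace_mtopology[OF Metric_space_local] by blast

lemma open_subset_Pow: "X \<subseteq> mclasses \<Longrightarrow> {U. openin (local_topology X) U} \<subseteq> Pow X"
  using openin_local by blast

lemma space_local_borel [simp]: "X \<subseteq> mclasses \<Longrightarrow> space (local_borel X) = X"
  unfolding local_borel_def using open_subset_Pow by (simp add: space_measure_of)

lemma sets_local_borel: "X \<subseteq> mclasses \<Longrightarrow> sets (local_borel X) = sigma_sets X {U. openin (local_topology X) U}"
  unfolding local_borel_def using open_subset_Pow by (simp add: sets_measure_of)

text \<open>Functions of the ball of radius \<open>r\<close>. The condition is imposed on all of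
  \<open>mclasses\<close>, so one function can be used on every space, and the values may be
  numbers, truth values or ball types.\<close>

definition local_at :: "nat \<Rightarrow> (mclass \<Rightarrow> 'a) \<Rightarrow> bool" where
  "local_at r F \<longleftrightarrow> (\<forall>c\<in>mclasses. \<forall>d\<in>mclasses. ball_type r c = ball_type r d \<longrightarrow> F c = F d)"

lemma local_atD: "local_at r F \<Longrightarrow> c \<in> mclasses \<Longrightarrow> d \<in> mclasses \<Longrightarrow> ball_type r c = ball_type r d \<Longrightarrow> F c = F d"
  unfolding local_at_def by blast

lemma local_atI0:
  "(\<And>c d. c \<in> mclasses \<Longrightarrow> d \<in> mclasses \<Longrightarrow> ball_type r c = ball_type r d \<Longrightarrow> F c = F d) \<Longrightarrow> local_at r F"
  unfolding local_at_def by blast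

lemma local_at_const: "local_at r (\<lambda>c. a)"
  by (rule local_atI0) (rule refl)

lemma local_at_comp: "local_at r F \<Longrightarrow> local_at r (\<lambda>c. h (F c))"
  by (rule local_atI0, rule arg_cong[of _ _ h], rule local_atD, assumption+)

lemma local_at_comp2:
  assumes "local_at r F" "local_at s G" shows "local_at (max r s) (\<lambda>c. h (F c) (G c))"
proof (rule local_atI0)
  fix c d assume cd: "c \<in> mclasses" "d \<in> mclasses" "ball_type (max r s) c = ball_type (max r s) d"
  have "F c = F d" by (rule local_atD[OF assms(1) cd(1,2) ball_type_mono[OF cd]]) simp
  moreover have "G c = G d" by (rule local_atD[OF assms(2) cd(1,2) ball_type_mono[OF cd]]) simp
  ultimately show "h (F c) (G c) = h (F d) (G d)" by simp
qed

lemma local_at_ball_type: "s \<le> r \<Longrightarrow> local_at r (ball_type s)"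
  by (rule local_atI0, rule ball_type_mono, assumption+)

lemma local_atI:
  assumes "\<And>g h \<phi>. g \<in> mgraphs \<Longrightarrow> h \<in> mgraphs \<Longrightarrow> piso r \<phi> g h \<Longrightarrow> F g = F h"
  shows "local_at r (\<lambda>c. F (rep c))"
  unfolding local_at_def
proof (intro ballI impI)
  fix c d assume cd: "c \<in> mclasses" "d \<in> mclasses" "ball_type r c = ball_type r d"
  obtain \<phi> where "piso r \<phi> (rep c) (rep d)" using pisoE[OF cd] by blast
  then show "F (rep c) = F (rep d)" using assms rep_mclass(1) cd by blast
qed

lemma local_open:
  assumes "X \<subseteq> mclasses" "local_at r F" shows "openin (local_topology X) {c \<in> X. P (F c)}"
  unfolding openin_local[OF assms(1)]
proof (intro conjI ballI exI[of _ r] impI)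
  fix c d assume c: "c \<in> {c \<in> X. P (F c)}" and d: "d \<in> X" "ball_type r d = ball_type r c"
  then have "F d = F c" using local_atD[OF assms(2)] assms(1) by blast
  then show "d \<in> {c \<in> X. P (F c)}" using c d by simp
qed auto

lemma local_sets:
  assumes "X \<subseteq> mclasses" "local_at r F" shows "{c \<in> X. P (F c)} \<in> sets (local_borel X)"
  unfolding sets_local_borel[OF assms(1)] using local_open[OF assms] by (intro sigma_sets.Basic) simp

text \<open>Every preimage of any set under a local function is open, so the measurable structure of
  the target puts no condition on it.\<close>

lemma local_measurable:
  assumes "X \<subseteq> mclasses" "local_at r F" "\<And>c. c \<in> X \<Longrightarrow> F c \<in> space N"
  shows "F \<in> measurable (local_borel X) N"
proof (rule measurableI)
  fix A
  have "F -` A \<inter> space (local_borel X) = {c \<in> X. F c \<in> A}" using assms(1) by auto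
  then show "F -` A \<inter> space (local_borel X) \<in> sets (local_borel X)"
    using local_sets[OF assms(1,2), of "\<lambda>a. a \<in> A"] by simp
qed (use assms in simp)

lemma local_continuous:
  assumes "X \<subseteq> mclasses" "local_at r F"
  shows "continuous_map (local_topology X) euclideanreal F"
  unfolding continuous_map_def topspace_local[OF assms(1)]
  using local_open[OF assms] by auto

text \<open>An open set is the union of the members of \<open>E\<close> that it contains, and
  countability of \<open>E\<close> keeps this union inside the generated sigma-algebra.\<close>

lemma local_borel_gen:
  assumes X: "X \<subseteq> mclasses"
    and op: "\<And>A. A \<in> E \<Longrightarrow> openin (local_topology X) A"
    and cyl: "\<And>c r. c \<in> X \<Longrightarrow> \<exists>s\<ge>r. {d \<in> X. ball_type s d = ball_type s c} \<in> E"
    and cnt: "countable E"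
  shows "sets (local_borel X) = sigma_sets X E"
  unfolding sets_local_borel[OF X]
proof (rule sigma_sets_eqI)
  fix U assume "U \<in> {U. openin (local_topology X) U}"
  then have U: "U \<subseteq> X" "\<And>c. c \<in> U \<Longrightarrow> \<exists>r. \<forall>d\<in>X. ball_type r d = ball_type r c \<longrightarrow> d \<in> U"
    using openin_local[OF X] by auto
  have "U = \<Union>{A \<in> E. A \<subseteq> U}"
  proof (intro equalityI subsetI)
    fix c assume c: "c \<in> U"
    then obtain r where r: "\<forall>d\<in>X. ball_type r d = ball_type r c \<longrightarrow> d \<in> U" using U(2) by blast
    have cX: "c \<in> X" using c U(1) by blast
    obtain s where s: "s \<ge> r" "{d \<in> X. ball_type s d = ball_type s c} \<in> E" using cyl[OF cX, of r] by blast
    have "{d \<in> X. ball_type s d = ball_type s c} \<subseteq> U" using r ball_type_mono[OF _ _ _ s(1)] cX X by blast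
    then show "c \<in> \<Union>{A \<in> E. A \<subseteq> U}" using s(2) cX by blast
  qed auto
  moreover have "\<Union>{A \<in> E. A \<subseteq> U} \<in> sigma_sets X E"
    using countable_subset[OF _ cnt, of "{A \<in> E. A \<subseteq> U}"]
    by (intro sigma_sets_UNION) (auto intro: sigma_sets.Basic)
  ultimately show "U \<in> sigma_sets X E" by simp
qed (use op in \<open>auto intro: sigma_sets.Basic\<close>)

section \<open>Countability and finiteness of the ball types\<close>

lemma countable_ball_type: "countable (ball_type r ` mclasses)"
proof -
  let ?F = "Collect finite :: nat set set"
  let ?FF = "{A. A \<subseteq> ?F \<and> finite A}"
  let ?h = "\<lambda>(V, E, S, x, D). (\<lparr>verts = V, edges = E\<rparr>, S, x, D) :: nat mgraph"
  have cF: "countable ?F" by (rule countable_Collect_finite)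
  have cFF: "countable ?FF" using countable_Collect_finite_subset[OF cF] by (simp add: conj_commute)
  have "ball_type r ` mclasses \<subseteq> iso_class ` ?h ` (?F \<times> ?FF \<times> ?FF \<times> UNIV \<times> ?F)"
  proof
    fix t assume "t \<in> ball_type r ` mclasses"
    then obtain c where c: "c \<in> mclasses" "t = ball_type r c" by auto
    obtain G S x D where g: "mg_ball r (rep c) = (G, S, x, D)" by (metis prod_cases4)
    have m: "mg_ball r (rep c) \<in> mgraphs" by (rule mg_ball_mgraphs[OF rep_mclass(1)[OF c(1)]])
    have fV: "finite (verts G)" using finite_mg_ball[OF rep_mclass(1)[OF c(1)], of r] g by simp
    have car: "edges G \<subseteq> Pow (verts G)" "S \<subseteq> Pow (verts G)" "D \<subseteq> verts G"
      using carried_mg_ball[of r "rep c"] g by (auto simp: carried_def)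
    have sub: "finite T \<and> T \<subseteq> ?F" if "T \<subseteq> Pow (verts G)" for T
    proof
      show "finite T" using that fV by (meson finite_Pow_iff finite_subset)
      show "T \<subseteq> ?F"
      proof
        fix A assume "A \<in> T"
        then have "A \<subseteq> verts G" using that by blast
        then show "A \<in> ?F" using fV by (simp add: finite_subset)
      qed
    qed
    have "(verts G, edges G, S, x, D) \<in> ?F \<times> ?FF \<times> ?FF \<times> UNIV \<times> ?F"
      using sub[OF car(1)] sub[OF car(2)] finite_subset[OF car(3) fV] fV by auto
    moreover have "(G, S, x, D) = ?h (verts G, edges G, S, x, D)" by simp
    ultimately have "(G, S, x, D) \<in> ?h ` (?F \<times> ?FF \<times> ?FF \<times> UNIV \<times> ?F)" by (rule rev_image_eqI)
    then show "t \<in> iso_class ` ?h ` (?F \<times> ?FF \<times> ?FF \<times> UNIV \<times> ?F)"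
      unfolding c(2) ball_type_def g by (rule imageI)
  qed
  moreover have "countable (iso_class ` ?h ` (?F \<times> ?FF \<times> ?FF \<times> (UNIV :: nat set) \<times> ?F))"
    using cF cFF by (intro countable_image countable_SIGMA) auto
  ultimately show ?thesis by (rule countable_subset)
qed

text \<open>A ball of radius \<open>r\<close> has at most \<open>(M + 1) ^ r\<close> vertices, so it
  can be relabelled into one fixed finite set, over which there are finitely many
  quadruples.\<close>

lemma finite_ball_type:
  assumes "X \<subseteq> mclasses" and deg: "\<And>c. c \<in> X \<Longrightarrow> max_degree_le M (fst (rep c))"
  shows "finite (ball_type r ` X)"
proof -
  let ?N = "(M + 1) ^ r"
  let ?V = "Pow {..<?N}"
  let ?h = "\<lambda>(V, E, S, x, D). (\<lparr>verts = V, edges = E\<rparr>, S, x, D) :: nat mgraph"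
  have "ball_type r ` X \<subseteq> iso_class ` ?h ` (?V \<times> Pow ?V \<times> Pow ?V \<times> {..<?N} \<times> ?V)"
  proof
    fix t assume "t \<in> ball_type r ` X"
    then obtain c where c: "c \<in> X" "c \<in> mclasses" "t = ball_type r c" using assms(1) by auto
    define g where "g = mg_ball r (rep c)"
    have m: "g \<in> mgraphs" unfolding g_def by (rule mg_ball_mgraphs[OF rep_mclass(1)[OF c(2)]])
    have fV: "finite (verts (fst g))" using finite_mg_ball[OF rep_mclass(1)[OF c(2)], of r] g_def by simp
    have "card (verts (fst g)) \<le> ?N"
    proof -
      obtain G S x D where r: "rep c = (G, S, x, D)" by (metis prod_cases4)
      have "(G, S, x, D) \<in> mgraphs" using rep_mclass(1)[OF c(2)] r by simp
      then show ?thesis using card_ball[of G M x r] deg[OF c(1)] by (simp add: g_def r mg_ball_eq mgraphs_def)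
    qed
    then have "card (verts (fst g)) \<le> card {..<?N}" by simp
    then obtain \<phi> where \<phi>: "\<phi> ` verts (fst g) \<subseteq> {..<?N}" "inj_on \<phi> (verts (fst g))"
      using card_le_inj[OF fV finite_lessThan] by blast
    obtain G S x D where h: "mg_map \<phi> g = (G, S, x, D)" by (metis prod_cases4)
    have "mg_iso g (mg_map \<phi> g)" unfolding mg_iso_iff using \<phi> by blast
    then have t: "t = iso_class (mg_map \<phi> g)"
      unfolding c(3) ball_type_def g_def[symmetric] by (rule iso_class_cong[OF m])
    have VN: "verts G \<subseteq> {..<?N}" using arg_cong[OF h, of "\<lambda>h. verts (fst h)"] \<phi>(1) by simp
    have "wf_mg (G, S, x, D)" using mgraphs_map[OF m \<phi>(2)] h mgraphs_wf by metis
    then have "edges G \<subseteq> Pow (verts G)" "S \<subseteq> Pow (verts G)" "x \<in> verts G" "D \<subseteq> verts G"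
      using wf_carried[of "(G, S, x, D)"] by (auto simp: carried_def)
    then have "(verts G, edges G, S, x, D) \<in> ?V \<times> Pow ?V \<times> Pow ?V \<times> {..<?N} \<times> ?V"
      using VN by (auto simp: subset_iff)
    moreover have "(G, S, x, D) = ?h (verts G, edges G, S, x, D)" by simp
    ultimately have "(G, S, x, D) \<in> ?h ` (?V \<times> Pow ?V \<times> Pow ?V \<times> {..<?N} \<times> ?V)" by (rule rev_image_eqI)
    then show "t \<in> iso_class ` ?h ` (?V \<times> Pow ?V \<times> Pow ?V \<times> {..<?N} \<times> ?V)"
      unfolding t h by (rule imageI)
  qed
  moreover have "finite (iso_class ` ?h ` (?V \<times> Pow ?V \<times> Pow ?V \<times> {..<?N} \<times> ?V))"
    by (intro finite_imageI finite_cartesian_product) auto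
  ultimately show ?thesis by (rule finite_subset)
qed

section \<open>The spaces of rooted graphs\<close>

text \<open>Each space is given by a property invariant under relabelling; such a property may be
  tested on the chosen representative.\<close>

lemma space_iff_aux:
  assumes P: "\<And>(g :: nat mgraph) \<phi>. g \<in> mgraphs \<Longrightarrow> inj_on \<phi> (verts (fst g)) \<Longrightarrow> P g \<Longrightarrow> P (mg_map \<phi> g :: nat mgraph)"
  shows "c \<in> {iso_class g | g :: nat mgraph. g \<in> mgraphs \<and> P g} \<longleftrightarrow> c \<in> mclasses \<and> P (rep c)"
proof
  assume "c \<in> {iso_class g | g :: nat mgraph. g \<in> mgraphs \<and> P g}"
  then obtain g :: "nat mgraph" where g: "c = iso_class g" "g \<in> mgraphs" "P g" by blast
  obtain \<phi> where "inj_on \<phi> (verts (fst g))" "rep (iso_class g) = mg_map \<phi> g" using rep_obtain[OF g(2)] by blast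
  then show "c \<in> mclasses \<and> P (rep c)" using P[OF g(2)] g iso_class_mclasses[OF g(2)] by auto
next
  assume "c \<in> mclasses \<and> P (rep c)"
  then show "c \<in> {iso_class g | g :: nat mgraph. g \<in> mgraphs \<and> P g}"
    using rep_mclass[of c] by blast
qed

lemma rooted_space_iff:
  "c \<in> rooted_space \<longleftrightarrow> c \<in> mclasses \<and> (\<exists>G x. rep c = (G, {}, x, {}))"
proof -
  have *: "rooted_space = {iso_class g | g :: nat mgraph. g \<in> mgraphs \<and> (\<exists>G x. g = (G, {}, x, {}))}"
    unfolding rooted_space_def by blast
  show ?thesis unfolding * by (rule space_iff_aux) (auto simp: mg_map_def)
qed

lemma rooted_space_deg_iff:
  "c \<in> rooted_space_deg M \<longleftrightarrow> c \<in> mclasses \<and> (\<exists>G x. rep c = (G, {}, x, {}) \<and> max_degree_le M G)"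
proof -
  have *: "rooted_space_deg M = {iso_class g | g :: nat mgraph. g \<in> mgraphs \<and> (\<exists>G x. g = (G, {}, x, {}) \<and> max_degree_le M G)}"
    unfolding rooted_space_deg_def by blast
  show ?thesis unfolding * by (rule space_iff_aux) (auto simp: mg_map_def mgraphs_def max_degree_gmap)
qed

lemma birooted_space_iff:
  "c \<in> birooted_space \<longleftrightarrow> c \<in> mclasses \<and> (\<exists>G x y. rep c = (G, {}, x, {y}))"
proof -
  have *: "birooted_space = {iso_class g | g :: nat mgraph. g \<in> mgraphs \<and> (\<exists>G x y. g = (G, {}, x, {y}))}"
    unfolding birooted_space_def by blast
  show ?thesis unfolding * by (rule space_iff_aux) (auto simp: mg_map_def)
qed

lemma marked_rooted_space_iff:
  "c \<in> marked_rooted_space \<longleftrightarrow> c \<in> mclasses \<and> (\<exists>G S x. rep c = (G, S, x, {}))"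
proof -
  have *: "marked_rooted_space = {iso_class g | g :: nat mgraph. g \<in> mgraphs \<and> (\<exists>G S x. g = (G, S, x, {}))}"
    unfolding marked_rooted_space_def by blast
  show ?thesis unfolding * by (rule space_iff_aux) (auto simp: mg_map_def)
qed

lemma marked_birooted_space_iff:
  "c \<in> marked_birooted_space \<longleftrightarrow> c \<in> mclasses \<and> (\<exists>G S x y. rep c = (G, S, x, {y}))"
proof -
  have *: "marked_birooted_space = {iso_class g | g :: nat mgraph. g \<in> mgraphs \<and> (\<exists>G S x y. g = (G, S, x, {y}))}"
    unfolding marked_birooted_space_def by blast
  show ?thesis unfolding * by (rule space_iff_aux) (auto simp: mg_map_def)
qed

lemma spaces_subset [simp]:
  "rooted_space \<subseteq> mclasses" "rooted_space_deg M \<subseteq> mclasses" "birooted_space \<subseteq> mclasses"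
  "marked_rooted_space \<subseteq> mclasses" "marked_birooted_space \<subseteq> mclasses"
  "rooted_space_deg M \<subseteq> rooted_space" "rooted_space \<subseteq> marked_rooted_space"
  by (auto simp: rooted_space_iff rooted_space_deg_iff birooted_space_iff marked_rooted_space_iff marked_birooted_space_iff)

text \<open>A marked vertex would already show up in some ball. This places limits of coherent ball
  types back in the space.\<close>

lemma marked_rooted_ball_type:
  assumes "c \<in> mclasses" "\<And>n. ball_type n c \<in> marked_rooted_space"
  shows "c \<in> marked_rooted_space"
proof -
  obtain G S x D where g: "rep c = (G, S, x, D)" by (metis prod_cases4)
  have m: "(G, S, x, D) \<in> mgraphs" using rep_mclass(1)[OF assms(1)] g by simp
  have "D \<inter> ball_verts G x n = {}" for n
  proof -
    have mb: "mg_ball n (G, S, x, D) \<in> mgraphs" by (rule mg_ball_mgraphs[OF m])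
    obtain \<phi> where "rep (ball_type n c) = mg_map \<phi> (mg_ball n (G, S, x, D))"
      using rep_obtain[OF mb] unfolding ball_type_def g by blast
    then show ?thesis using assms(2)[of n] by (auto simp: marked_rooted_space_iff mg_ball_eq mg_map_def)
  qed
  moreover have "D \<subseteq> (\<Union>n. ball_verts G x n)"
    using m unfolding comp_verts_ball[symmetric] by (auto simp: mgraphs_def connected_graph_def)
  ultimately have "D = {}" by blast
  then show ?thesis using assms(1) g by (simp add: marked_rooted_space_iff)
qed

section \<open>Cylinders\<close>

text \<open>The empty set is added to make the family closed under intersections, and the types are
  taken from \<open>mclasses\<close> to make it countable.\<close>

definition cylinders :: "mclass set \<Rightarrow> mclass set set" where
  "cylinders X = insert {} ((\<lambda>(s, t). {c \<in> X. ball_type s c = t}) ` (SIGMA s:UNIV. ball_type s ` mclasses))"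

lemma countable_cylinders: "countable (cylinders X)"
  unfolding cylinders_def by (intro countable_insert countable_image countable_SIGMA countable_ball_type) auto

lemma cylinders_cases:
  assumes "A \<in> cylinders X" obtains "A = {}" | s t where "A = {c \<in> X. ball_type s c = t}"
proof -
  from assms have "A = {} \<or> A \<in> (\<lambda>(s, t). {c \<in> X. ball_type s c = t}) ` (SIGMA s:UNIV. ball_type s ` mclasses)"
    unfolding cylinders_def insert_iff .
  then show ?thesis
  proof
    assume "A \<in> (\<lambda>(s, t). {c \<in> X. ball_type s c = t}) ` (SIGMA s:UNIV. ball_type s ` mclasses)"
    then obtain p where "A = (\<lambda>(s, t). {c \<in> X. ball_type s c = t}) p" by (rule imageE)
    then have "A = {c \<in> X. ball_type (fst p) c = snd p}" by (simp only: case_prod_unfold)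
    then show ?thesis by (rule that(2))
  qed (rule that(1))
qed

lemma cylinders_I: "X \<subseteq> mclasses \<Longrightarrow> d \<in> X \<Longrightarrow> {c \<in> X. ball_type s c = ball_type s d} \<in> cylinders X"
  unfolding cylinders_def by (rule insertI2, rule image_eqI[of _ _ "(s, ball_type s d)"], simp, blast)

text \<open>As in any ultrametric space, two cylinders are either disjoint or nested.\<close>

lemma Int_stable_cylinders:
  assumes X: "X \<subseteq> mclasses" shows "Int_stable (cylinders X)"
proof (rule Int_stableI)
  have *: "{c \<in> X. ball_type s c = t} \<inter> {c \<in> X. ball_type s' c = t'} \<in> {{}, {c \<in> X. ball_type s' c = t'}}" if "s \<le> s'" for s s' t t'
  proof (cases "{c \<in> X. ball_type s c = t} \<inter> {c \<in> X. ball_type s' c = t'} = {}")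
    case False
    then obtain c0 where c0: "c0 \<in> X" "ball_type s c0 = t" "ball_type s' c0 = t'" by blast
    have "ball_type s c = t" if "c \<in> X" "ball_type s' c = t'" for c
    proof -
      have "ball_type s c = ball_type s c0" by (rule ball_type_mono[of _ _ s']) (use that c0 X \<open>s \<le> s'\<close> in auto)
      then show ?thesis using c0 by simp
    qed
    then have "{c \<in> X. ball_type s c = t} \<inter> {c \<in> X. ball_type s' c = t'} = {c \<in> X. ball_type s' c = t'}" by blast
    then show ?thesis by simp
  qed simp
  fix A B assume A: "A \<in> cylinders X" and B: "B \<in> cylinders X"
  have e: "{} \<in> cylinders X" by (simp add: cylinders_def)
  from A show "A \<inter> B \<in> cylinders X"
  proof (cases rule: cylinders_cases)
    case 1 then show ?thesis using e by simp
  next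
    case (2 s t)
    note A2 = 2
    from B show ?thesis
    proof (cases rule: cylinders_cases)
      case 1 then show ?thesis using e by simp
    next
      case (2 s' t')
      show ?thesis
      proof (cases "s \<le> s'")
        case True
        have "A \<inter> B \<in> {{}, B}" using *[OF True, of t t'] unfolding A2 2 .
        then show ?thesis using e B by auto
      next
        case False
        have "B \<inter> A \<in> {{}, A}" using *[of s' s t' t] False unfolding A2 2 by simp
        then show ?thesis using e A by (auto simp: Int_commute)
      qed
    qed
  qed
qed

lemma cylinders_open:
  assumes "X \<subseteq> mclasses" "A \<in> cylinders X" shows "openin (local_topology X) A"
  using assms(2)
proof (cases rule: cylinders_cases)
  case (2 s t)
  then show ?thesis using local_open[OF assms(1) local_at_ball_type[OF order_refl], of "\<lambda>a. a = t"] by simp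
qed simp

lemma sets_local_borel_cylinders:
  assumes "X \<subseteq> mclasses" shows "sets (local_borel X) = sigma_sets X (cylinders X)"
proof (rule local_borel_gen[OF assms cylinders_open[OF assms] _ countable_cylinders])
  fix c r assume c: "c \<in> X"
  show "\<exists>s\<ge>r. {d \<in> X. ball_type s d = ball_type s c} \<in> cylinders X"
    by (rule exI[of _ r], rule conjI[OF order_refl], rule cylinders_I[OF assms c])
qed

lemma cylinders_Pow: "cylinders X \<subseteq> Pow X"
  by (auto simp: cylinders_def)

section \<open>Truncated mass transport and its reduction to cylinders\<close>

section \<open>Mass sums over balls\<close>

text \<open>The flag selects the direction of the transport: \<^term>\<open>True\<close> for mass sent out of the root
  \<open>z\<close> and \<^term>\<open>False\<close> for mass received by it.\<close>

definition two_pt :: "bool \<Rightarrow> 'v ugraph \<Rightarrow> 'v set set \<Rightarrow> 'v \<Rightarrow> 'v \<Rightarrow> 'v mgraph" where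
  "two_pt b G S z y = (if b then (G, S, z, {y}) else (G, S, y, {z}))"

text \<open>The transport is cut off at distance \<open>n\<close>, which makes the sums finite and,
  for local \<open>f\<close>, local. Values in any commutative monoid let one definition serve for
  natural numbers and \<open>ennreal\<close>.\<close>

definition msum :: "bool \<Rightarrow> nat \<Rightarrow> (mclass \<Rightarrow> 'a::comm_monoid_add) \<Rightarrow> 'v mgraph \<Rightarrow> 'a" where
  "msum b n f = (\<lambda>(G, S, z, D). \<Sum>y\<in>ball_verts G z n. f (iso_class (two_pt b G S z y)))"

definition massn :: "bool \<Rightarrow> nat \<Rightarrow> (mclass \<Rightarrow> 'a::comm_monoid_add) \<Rightarrow> mclass \<Rightarrow> 'a" where
  "massn b n f c = msum b n f (rep c)"

lemma two_pt_mgraphs: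
  "(G, S, z, D) \<in> mgraphs \<Longrightarrow> y \<in> verts G \<Longrightarrow> two_pt b G S z y \<in> mgraphs"
  by (auto simp: two_pt_def mgraphs_def)

lemma two_pt_map: "two_pt b (gmap \<phi> G) ((\<lambda>e. \<phi> ` e) ` S) (\<phi> z) (\<phi> y) = mg_map \<phi> (two_pt b G S z y)"
  by (auto simp: two_pt_def mg_map_def)

lemma iso_class_map:
  assumes "g \<in> mgraphs" "inj_on \<phi> (verts (fst g))" shows "iso_class (mg_map \<phi> g) = iso_class g"
  by (rule iso_class_cong[OF assms(1), symmetric]) (use assms(2) in \<open>auto simp: mg_iso_iff\<close>)

lemma msum_map:
  assumes "g \<in> mgraphs" "inj_on \<phi> (verts (fst g))"
  shows "msum b n f (mg_map \<phi> g) = msum b n f g"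
proof -
  obtain G S z D where g: "g = (G, S, z, D)" by (metis prod_cases4)
  have a: "is_graph G" "z \<in> verts G" using assms(1) by (auto simp: g mgraphs_def)
  have i: "inj_on \<phi> (verts G)" using assms(2) by (simp add: g)
  have B: "ball_verts G z n \<subseteq> verts G" by (rule ball_subset_verts[OF a])
  have eq: "iso_class (two_pt b (gmap \<phi> G) ((\<lambda>e. \<phi> ` e) ` S) (\<phi> z) (\<phi> y)) = iso_class (two_pt b G S z y)"
    if "y \<in> ball_verts G z n" for y
    unfolding two_pt_map using that B assms(1) i
    by (intro iso_class_map two_pt_mgraphs) (auto simp: g two_pt_def)
  have "msum b n f (mg_map \<phi> g) =
      (\<Sum>y\<in>\<phi> ` ball_verts G z n. f (iso_class (two_pt b (gmap \<phi> G) ((\<lambda>e. \<phi> ` e) ` S) (\<phi> z) y)))"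
    by (simp add: g mg_map_def msum_def ball_gmap[OF i a])
  also have "\<dots> = msum b n f g"
    using eq by (simp add: sum.reindex[OF inj_on_subset[OF i B]] g msum_def)
  finally show ?thesis .
qed

lemma massn_iso_class:
  assumes "g \<in> mgraphs" shows "massn b n f (iso_class g) = msum b n f g"
proof -
  obtain \<phi> where "inj_on \<phi> (verts (fst g))" "rep (iso_class g) = mg_map \<phi> g"
    using rep_obtain[OF assms] by blast
  then show ?thesis unfolding massn_def using msum_map[OF assms] by metis
qed

text \<open>Radius \<open>n\<close> reaches the partner vertex, and \<open>s\<close> more is what
  \<open>f\<close> sees around its first root, which for incoming mass is the partner.\<close>

lemma massn_local:
  assumes f: "local_at s f" shows "local_at (n + s) (massn b n f)"
  unfolding massn_def
proof (rule local_atI)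
  fix g h :: "nat mgraph" and \<phi> assume gh: "g \<in> mgraphs" "h \<in> mgraphs" and p: "piso (n + s) \<phi> g h"
  obtain G S z D where g: "g = (G, S, z, D)" by (metis prod_cases4)
  obtain G' S' z' D' where h: "h = (G', S', z', D')" by (metis prod_cases4)
  note p = p[unfolded g h]
  note ff = piso_facts[OF p]
  have b1: "ball_verts G' z' n = \<phi> ` ball_verts G z n"
    using piso_ball(2)[OF p, of z 0 n] ff(3) by simp
  have sub: "ball_verts G z n \<subseteq> ball_verts G z (n + s)" by (rule ball_verts_mono) simp
  have m: "(G, S, z, D) \<in> mgraphs" "(G', S', z', D') \<in> mgraphs" using gh g h by auto
  have eq: "f (iso_class (two_pt b G' S' z' (\<phi> y))) = f (iso_class (two_pt b G S z y))"
    if y: "y \<in> ball_verts G z n" for y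
  proof -
    have p1: "piso s \<phi> (G, S, z, {y}) (G', S', \<phi> z, {\<phi> y})"
      by (rule piso_shift(1)[OF p, of z 0 s "{y}" "{y}"]) (use sub y in auto)
    have p2: "piso s \<phi> (G, S, y, {z}) (G', S', \<phi> y, {\<phi> z})"
      by (rule piso_shift(1)[OF p, of y n s "{z}" "{z}"]) (use sub y in auto)
    have p3: "piso s \<phi> (two_pt b G S z y) (two_pt b G' S' z' (\<phi> y))"
      using p1 p2 ff(3) by (simp add: two_pt_def)
    have "y \<in> verts G" "\<phi> y \<in> verts G'"
      using y b1 m ball_subset_verts[of G z n] ball_subset_verts[of G' z' n] by (auto simp: mgraphs_def)
    then have mm: "two_pt b G S z y \<in> mgraphs" "two_pt b G' S' z' (\<phi> y) \<in> mgraphs"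
      using two_pt_mgraphs[OF m(1)] two_pt_mgraphs[OF m(2)] by blast+
    have "ball_type s (iso_class (two_pt b G S z y)) = ball_type s (iso_class (two_pt b G' S' z' (\<phi> y)))"
      using ball_type_eq_iff[OF mm] p3 by blast
    then show ?thesis using local_atD[OF f iso_class_mclasses[OF mm(2)] iso_class_mclasses[OF mm(1)]] by simp
  qed
  have "msum b n f h = (\<Sum>y\<in>\<phi> ` ball_verts G z n. f (iso_class (two_pt b G' S' z' y)))"
    by (simp add: h msum_def b1)
  also have "\<dots> = msum b n f g"
    using eq by (simp add: sum.reindex[OF inj_on_subset[OF ff(1) sub]] g msum_def)
  finally show "msum b n f g = msum b n f h" ..
qed

lemma nn_integral_exhaust:
  fixes h :: "'v \<Rightarrow> ennreal"
  assumes "incseq A" "\<And>n. finite (A n)" "(\<Union>n. A n) = V"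
  shows "(\<integral>\<^sup>+y. h y \<partial>count_space V) = (SUP n. \<Sum>y\<in>A n. h y)"
proof -
  have "(\<integral>\<^sup>+y. h y \<partial>count_space V) = (\<integral>\<^sup>+y. (SUP n. h y * indicator (A n) y) \<partial>count_space V)"
  proof (rule nn_integral_cong)
    fix y assume "y \<in> space (count_space V)"
    then obtain n where "y \<in> A n" using assms(3) by auto
    then have "h y \<le> (SUP n. h y * indicator (A n) y)" by (intro SUP_upper2[of n]) auto
    moreover have "(SUP n. h y * indicator (A n) y) \<le> h y"
      by (intro SUP_least) (auto simp: indicator_def)
    ultimately show "h y = (SUP n. h y * indicator (A n) y)" by (rule antisym)
  qed
  also have "\<dots> = (SUP n. \<integral>\<^sup>+y. h y * indicator (A n) y \<partial>count_space V)"
  proof (rule nn_integral_monotone_convergence_SUP)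
    show "incseq (\<lambda>n y. h y * indicator (A n) y)"
      using assms(1) by (auto simp: incseq_def le_fun_def indicator_def subset_iff)
  qed auto
  also have "\<dots> = (SUP n. \<Sum>y\<in>A n. h y)"
  proof (rule SUP_cong[OF refl])
    fix n
    have "(\<integral>\<^sup>+y. h y * indicator (A n) y \<partial>count_space V) = (\<Sum>y\<in>A n. h y * indicator (A n) y)"
      using assms(2,3) by (intro nn_integral_count_space') auto
    then show "(\<integral>\<^sup>+y. h y * indicator (A n) y \<partial>count_space V) = (\<Sum>y\<in>A n. h y)" by simp
  qed
  finally show ?thesis .
qed

lemma mass_SUP:
  assumes "c \<in> mclasses"
  shows "mass_out f c = (SUP n. massn True n f c)" "mass_in f c = (SUP n. massn False n f c)"
proof -
  obtain G S z D where g: "rep c = (G, S, z, D)" by (metis prod_cases4)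
  have m: "(G, S, z, D) \<in> mgraphs" using rep_mclass(1)[OF assms] g by simp
  have inc: "incseq (ball_verts G z)" by (intro incseq_SucI ball_verts_mono) simp
  have fin: "finite (ball_verts G z n)" for n using m by (auto simp: mgraphs_def intro: finite_ball)
  have un: "(\<Union>n. ball_verts G z n) = verts G"
    using m by (simp add: comp_verts_ball[symmetric] mgraphs_def connected_graph_def)
  show "mass_out f c = (SUP n. massn True n f c)" "mass_in f c = (SUP n. massn False n f c)"
    using nn_integral_exhaust[OF inc fin un]
    by (simp_all add: mass_out_def mass_in_def massn_def msum_def g two_pt_def)
qed

lemma massn_mono: "m \<le> n \<Longrightarrow> c \<in> mclasses \<Longrightarrow> massn b m f c \<le> massn b n (f :: mclass \<Rightarrow> ennreal) c"
proof -
  assume a: "m \<le> n" "c \<in> mclasses"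
  obtain G S z D where g: "rep c = (G, S, z, D)" by (metis prod_cases4)
  have m: "(G, S, z, D) \<in> mgraphs" using rep_mclass(1)[OF a(2)] g by simp
  have fin: "finite (ball_verts G z n)" using m by (auto simp: mgraphs_def intro: finite_ball)
  show ?thesis unfolding massn_def g msum_def prod.case
    by (rule sum_mono2[OF fin ball_verts_mono[OF a(1)]]) simp
qed

section \<open>The mass transport principle from cylinders\<close>

text \<open>A pi-lambda argument followed by monotone approximation of \<open>f\<close>. It is
  carried out at each fixed range \<open>n\<close>: complements call for subtraction, hence for
  finite integrals, which the bound on ball sizes provides. The hypothesis \<open>cl\<close> ensures
  that only the values of \<open>f\<close> on \<open>X2\<close> enter.\<close>

lemma mass_transport_from_cylinders:
  assumes X: "X \<subseteq> mclasses" "X2 \<subseteq> mclasses"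
    and cl: "\<And>c G S z D y b. c \<in> X \<Longrightarrow> rep c = (G, S, z, D) \<Longrightarrow> y \<in> verts G \<Longrightarrow> iso_class (two_pt b G S z y) \<in> X2"
    and \<nu>: "prob_space \<nu>" "sets \<nu> = sets (local_borel X)"
    and bound: "\<And>n. \<exists>B. AE c in \<nu>. massn True n (\<lambda>_. 1 :: nat) c \<le> B"
    and base: "\<And>n s t. (\<integral>\<^sup>+c. of_nat (massn True n (\<lambda>c. if ball_type s c = t then 1 else 0 :: nat) c) \<partial>\<nu>) =
      (\<integral>\<^sup>+c. of_nat (massn False n (\<lambda>c. if ball_type s c = t then 1 else 0 :: nat) c) \<partial>\<nu>)"
  shows "mass_transport X2 \<nu>"
proof -
  interpret prob_space \<nu> by fact
  have sp: "space \<nu> = X" using sets_eq_imp_space_eq[OF \<nu>(2)] X by simp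
  have meas: "F \<in> borel_measurable \<nu>" if "local_at r F" for F :: "mclass \<Rightarrow> ennreal" and r
    using local_measurable[OF X(1) that, of borel] measurable_cong_sets[OF \<nu>(2) refl] by auto
  \<comment> \<open>Measurability of the truncated sums is carried along with the identity, since it
    is needed in every step of the induction.\<close>
  define R where "R f \<longleftrightarrow> (\<forall>n. (\<forall>b. massn b n f \<in> borel_measurable \<nu>) \<and>
    (\<integral>\<^sup>+c. massn True n f c \<partial>\<nu>) = (\<integral>\<^sup>+c. massn False n f c \<partial>\<nu>))" for f :: "mclass \<Rightarrow> ennreal"
  have cong: "massn b n f c = massn b n g c" if c: "c \<in> X" and fg: "\<And>d. d \<in> X2 \<Longrightarrow> f d = g d"
    for b n c and f g :: "mclass \<Rightarrow> ennreal"
  proof -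
    obtain G S z D where r: "rep c = (G, S, z, D)" by (metis prod_cases4)
    have m: "(G, S, z, D) \<in> mgraphs" using rep_mclass(1)[of c] c X r by auto
    have sub: "ball_verts G z n \<subseteq> verts G" using m by (intro ball_subset_verts) (auto simp: mgraphs_def)
    show ?thesis unfolding massn_def r msum_def prod.case
      using sub cl[OF c r] by (intro sum.cong refl fg) auto
  qed
  have Rcong: "R f" if "R g" and fg: "\<And>d. d \<in> X2 \<Longrightarrow> f d = g d" for f g
  proof -
    have "massn b n f \<in> borel_measurable \<nu> \<longleftrightarrow> massn b n g \<in> borel_measurable \<nu>" for b n
      using cong[OF _ fg] by (intro measurable_cong) (auto simp: sp)
    moreover have "(\<integral>\<^sup>+c. massn b n f c \<partial>\<nu>) = (\<integral>\<^sup>+c. massn b n g c \<partial>\<nu>)" for b n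
      using cong[OF _ fg] by (intro nn_integral_cong) (auto simp: sp)
    ultimately show ?thesis using \<open>R g\<close> unfolding R_def by simp
  qed
  have one: "massn b n (\<lambda>_. 1 :: ennreal) = (\<lambda>c. of_nat (massn True n (\<lambda>_. 1) c))" for b n
    by (rule ext) (simp add: massn_def msum_def split: prod.split)
  have onem: "(\<lambda>c. of_nat (massn True n (\<lambda>_. 1) c) :: ennreal) \<in> borel_measurable \<nu>" for n
    by (rule meas[OF local_at_comp[OF massn_local[OF local_at_const[of 0]]]])
  have onefin: "(\<integral>\<^sup>+c. of_nat (massn True n (\<lambda>_. 1) c) \<partial>\<nu>) < \<infinity>" for n
  proof -
    obtain B where B: "AE c in \<nu>. massn True n (\<lambda>_. 1 :: nat) c \<le> B" using bound by blast
    have "(\<integral>\<^sup>+c. of_nat (massn True n (\<lambda>_. 1) c) \<partial>\<nu>) \<le> (\<integral>\<^sup>+c. of_nat B \<partial>\<nu>)"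
      by (rule nn_integral_mono_AE) (use B in auto)
    also have "\<dots> < \<infinity>" by (simp add: emeasure_space_1 ennreal_of_nat_eq_real_of_nat)
    finally show ?thesis .
  qed
  have RM: "massn b n f \<in> borel_measurable \<nu>" if "R f" for f b n
    using that unfolding R_def by blast
  have RE: "(\<integral>\<^sup>+c. massn True n f c \<partial>\<nu>) = (\<integral>\<^sup>+c. massn False n f c \<partial>\<nu>)" if "R f" for f n
    using that unfolding R_def by blast
  have RI: "R f" if "\<And>b n. massn b n f \<in> borel_measurable \<nu>"
    "\<And>n. (\<integral>\<^sup>+c. massn True n f c \<partial>\<nu>) = (\<integral>\<^sup>+c. massn False n f c \<partial>\<nu>)" for f
    using that unfolding R_def by blast
  let ?I = "\<lambda>A. indicator A :: mclass \<Rightarrow> ennreal"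
  have Rind: "R (indicator A)" if A: "A \<in> sigma_sets X2 (cylinders X2)" for A
    using Int_stable_cylinders[OF X(2)] cylinders_Pow A
  proof (induction rule: sigma_sets_induct_disjoint)
    case empty
    show ?case unfolding R_def massn_def msum_def by (simp add: case_prod_unfold)
  next
    case (basic A)
    then show ?case
    proof (cases rule: cylinders_cases)
      case 1
      show ?thesis unfolding R_def massn_def msum_def 1 by (simp add: case_prod_unfold)
    next
      case (2 s t)
      let ?f = "\<lambda>c. if ball_type s c = t then 1 else 0"
      have loc: "local_at s (?f :: mclass \<Rightarrow> nat)" by (rule local_at_comp[OF local_at_ball_type[OF order_refl]])
      have eq: "massn b n (\<lambda>c. if ball_type s c = t then 1 else 0 :: ennreal) c = of_nat (massn b n ?f c)" for b n c
        by (auto simp: massn_def msum_def of_nat_sum intro!: sum.cong split: prod.split)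
      have "R (\<lambda>c. if ball_type s c = t then 1 else 0)"
        unfolding R_def eq using meas[OF local_at_comp[OF massn_local[OF loc]]] base[of _ s t]
        by (auto simp: eq[abs_def])
      then show ?thesis by (rule Rcong) (simp add: 2)
    qed
  next
    case (compl A)
    \<comment> \<open>The masses for a set and its complement add up to the number of vertices in
      the ball, in both directions.\<close>
    have add: "massn b n (?I (X2 - A)) c + massn b n (?I A) c = (of_nat (massn True n (\<lambda>_. 1) c) :: ennreal)"
      if "c \<in> X" for b n c
    proof -
      have "massn b n (?I (X2 - A)) c + massn b n (?I A) c
          = massn b n (\<lambda>d. indicator (X2 - A) d + indicator A d :: ennreal) c"
        by (simp add: massn_def msum_def sum.distrib split: prod.split)
      also have "\<dots> = massn b n (\<lambda>_. 1) c"
        by (rule cong[OF that]) (auto simp: indicator_def)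
      finally show ?thesis by (simp add: one)
    qed
    have fin: "massn b n (?I A) c < (top :: ennreal)" if "c \<in> X" for b n c
    proof -
      have "massn b n (?I A) c \<le> (of_nat (massn True n (\<lambda>_. 1) c) :: ennreal)"
        unfolding add[OF that, of b n, symmetric] by simp
      also have "\<dots> < top" by (rule of_nat_less_top)
      finally show ?thesis .
    qed
    have dif: "(massn b n (?I (X2 - A)) c :: ennreal) = of_nat (massn True n (\<lambda>_. 1) c) - massn b n (?I A) c"
      if "c \<in> X" for b n c
      using add[OF that, of b n] fin[OF that, of b n] by (metis ennreal_add_diff_cancel_right less_top)
    have IA: "massn b n (?I A) \<in> borel_measurable \<nu>" for b n by (rule RM[OF compl(2)])
    have IB: "massn b n (?I (X2 - A)) \<in> borel_measurable \<nu>" for b n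
    proof -
      have "(\<lambda>c. of_nat (massn True n (\<lambda>_. 1) c) - massn b n (?I A) c) \<in> borel_measurable \<nu>"
        using onem IA by measurable
      then show ?thesis using dif by (subst measurable_cong) (auto simp: sp)
    qed
    have int: "(\<integral>\<^sup>+c. massn b n (?I (X2 - A)) c \<partial>\<nu>) + (\<integral>\<^sup>+c. massn b n (?I A) c \<partial>\<nu>)
        = (\<integral>\<^sup>+c. of_nat (massn True n (\<lambda>_. 1) c) \<partial>\<nu>)" for b n
      unfolding nn_integral_add[OF IB IA, symmetric] using add by (intro nn_integral_cong) (auto simp: sp)
    have finI: "(\<integral>\<^sup>+c. massn True n (?I A) c \<partial>\<nu>) \<noteq> top" for n
    proof
      assume "(\<integral>\<^sup>+c. massn True n (?I A) c \<partial>\<nu>) = top"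
      then show False using int[of True n] onefin[of n] by simp
    qed
    have eqI: "(\<integral>\<^sup>+c. massn True n (?I A) c \<partial>\<nu>) = (\<integral>\<^sup>+c. massn False n (?I A) c \<partial>\<nu>)" for n
      by (rule RE[OF compl(2)])
    have "(\<integral>\<^sup>+c. massn True n (?I (X2 - A)) c \<partial>\<nu>) = (\<integral>\<^sup>+c. massn False n (?I (X2 - A)) c \<partial>\<nu>)" for n
    proof -
      have "(\<integral>\<^sup>+c. massn True n (?I (X2 - A)) c \<partial>\<nu>) = (\<integral>\<^sup>+c. massn True n (?I (X2 - A)) c \<partial>\<nu>)
          + (\<integral>\<^sup>+c. massn True n (?I A) c \<partial>\<nu>) - (\<integral>\<^sup>+c. massn True n (?I A) c \<partial>\<nu>)"
        by (rule ennreal_add_diff_cancel_right[OF finI, symmetric])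
      also have "\<dots> = (\<integral>\<^sup>+c. massn False n (?I (X2 - A)) c \<partial>\<nu>)
          + (\<integral>\<^sup>+c. massn False n (?I A) c \<partial>\<nu>) - (\<integral>\<^sup>+c. massn False n (?I A) c \<partial>\<nu>)"
        unfolding int unfolding eqI ..
      also have "\<dots> = (\<integral>\<^sup>+c. massn False n (?I (X2 - A)) c \<partial>\<nu>)"
        by (rule ennreal_add_diff_cancel_right[OF finI[unfolded eqI]])
      finally show ?thesis .
    qed
    then show ?case by (intro RI IB)
  next
    case (union A)
    have eq: "(massn b n (?I (\<Union>i. A i)) c :: ennreal) = (\<Sum>i. massn b n (?I (A i)) c)" for b n c
    proof -
      have "(indicator (\<Union>i. A i) d :: ennreal) = (\<Sum>i. indicator (A i) d)" for d
        by (rule suminf_indicator[OF union(1), symmetric])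
      then show ?thesis by (auto simp: massn_def msum_def suminf_sum split: prod.split)
    qed
    have IA: "massn b n (?I (A i)) \<in> borel_measurable \<nu>" for b n i by (rule RM[OF union(3)])
    have "massn b n (?I (\<Union>i. A i)) \<in> borel_measurable \<nu>" for b n
      unfolding eq[abs_def] using IA by measurable
    moreover have "(\<integral>\<^sup>+c. massn b n (?I (\<Union>i. A i)) c \<partial>\<nu>) = (\<Sum>i. \<integral>\<^sup>+c. massn b n (?I (A i)) c \<partial>\<nu>)" for b n
      unfolding eq by (rule nn_integral_suminf[OF IA])
    moreover have "(\<integral>\<^sup>+c. massn True n (?I (A i)) c \<partial>\<nu>) = (\<integral>\<^sup>+c. massn False n (?I (A i)) c \<partial>\<nu>)" for n i
      by (rule RE[OF union(3)])
    ultimately show ?case by (intro RI) simp_all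
  qed
  have Rf: "R f" if f: "f \<in> borel_measurable (local_borel X2)" for f
    using f
  proof (induction rule: borel_measurable_induct)
    case (cong f g)
    then show ?case using X by (intro Rcong[of g f]) auto
  next
    case (set A)
    then show ?case using Rind sets_local_borel_cylinders[OF X(2)] by blast
  next
    case (mult u k)
    have eq: "massn b n (\<lambda>x. k * u x) c = k * massn b n u c" for b n c
      by (simp add: massn_def msum_def sum_distrib_left split: prod.split)
    have "massn b n u \<in> borel_measurable \<nu>" for b n by (rule RM[OF mult(4)])
    then show ?case using RE[OF mult(4)] by (intro RI) (simp_all add: eq[abs_def] nn_integral_cmult)
  next
    case (add u v)
    have eq: "massn b n (\<lambda>x. v x + u x) c = massn b n v c + massn b n u c" for b n c
      by (simp add: massn_def msum_def sum.distrib split: prod.split)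
    have "massn b n u \<in> borel_measurable \<nu>" "massn b n v \<in> borel_measurable \<nu>" for b n
      by (rule RM, fact)+
    moreover have "(\<integral>\<^sup>+c. massn True n u c \<partial>\<nu>) = (\<integral>\<^sup>+c. massn False n u c \<partial>\<nu>)"
      "(\<integral>\<^sup>+c. massn True n v c \<partial>\<nu>) = (\<integral>\<^sup>+c. massn False n v c \<partial>\<nu>)" for n
      by (rule RE, fact)+
    ultimately show ?case by (intro RI) (simp_all add: eq[abs_def] nn_integral_add)
  next
    case (seq U)
    have eq: "massn b n (SUP i. U i) c = (SUP i. massn b n (U i) c)" for b n c
    proof -
      have "incseq (\<lambda>i. U i d)" for d using \<open>incseq U\<close> by (auto simp: incseq_def le_fun_def)
      then show ?thesis by (auto simp: massn_def msum_def ennreal_SUP_sum SUP_apply image_comp split: prod.split)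
    qed
    have IA: "massn b n (U i) \<in> borel_measurable \<nu>" for b n i by (rule RM, fact)
    have inc: "incseq (\<lambda>i. massn b n (U i))" for b n
      using \<open>incseq U\<close> unfolding incseq_def le_fun_def massn_def msum_def
      by (auto intro!: sum_mono split: prod.split)
    have m1: "massn b n (SUP i. U i) \<in> borel_measurable \<nu>" for b n
      unfolding eq[abs_def] using IA by measurable
    have i1: "(\<integral>\<^sup>+c. massn b n (SUP i. U i) c \<partial>\<nu>) = (SUP i. \<integral>\<^sup>+c. massn b n (U i) c \<partial>\<nu>)" for b n
      unfolding eq by (rule nn_integral_monotone_convergence_SUP[OF inc IA])
    have e1: "(\<integral>\<^sup>+c. massn True n (U i) c \<partial>\<nu>) = (\<integral>\<^sup>+c. massn False n (U i) c \<partial>\<nu>)" for n i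
      by (rule RE, fact)
    show ?case
    proof (rule RI)
      show "(\<integral>\<^sup>+c. massn True n (SUP i. U i) c \<partial>\<nu>) = (\<integral>\<^sup>+c. massn False n (SUP i. U i) c \<partial>\<nu>)" for n
        unfolding i1 e1 ..
    qed (rule m1)
  qed
  show ?thesis
    unfolding mass_transport_def
  proof
    fix f :: "mclass \<Rightarrow> ennreal" assume f: "f \<in> borel_measurable (local_borel X2)"
    have IA: "massn b n f \<in> borel_measurable \<nu>" for b n by (rule RM[OF Rf[OF f]])
    \<comment> \<open>The cutoff is now removed by monotone convergence in \<open>n\<close>.\<close>
    have *: "(\<integral>\<^sup>+c. (SUP n. massn b n f c) \<partial>\<nu>) = (SUP n. \<integral>\<^sup>+c. massn b n f c \<partial>\<nu>)" for b
      by (rule nn_integral_monotone_convergence_SUP_AE[OF _ IA]) (use X in \<open>auto intro!: AE_I2 massn_mono simp: sp\<close>)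
    have "(\<integral>\<^sup>+c. mass_in f c \<partial>\<nu>) = (\<integral>\<^sup>+c. (SUP n. massn False n f c) \<partial>\<nu>)"
      using X mass_SUP(2) by (intro nn_integral_cong) (auto simp: sp)
    also have "\<dots> = (\<integral>\<^sup>+c. (SUP n. massn True n f c) \<partial>\<nu>)"
      unfolding * by (simp only: RE[OF Rf[OF f]])
    also have "\<dots> = (\<integral>\<^sup>+c. mass_out f c \<partial>\<nu>)"
      using X mass_SUP(1) by (intro nn_integral_cong) (auto simp: sp)
    finally show "(\<integral>\<^sup>+c. mass_in f c \<partial>\<nu>) = (\<integral>\<^sup>+c. mass_out f c \<partial>\<nu>)" .
  qed
qed

section \<open>Finite graphs seen from a uniform root\<close>

section \<open>Finite graphs as random rooted graphs\<close>

text \<open>The graph may be disconnected while classes are connected, so graph and marks are both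
  restricted to the component of \<open>v\<close>.\<close>

definition comp_mg :: "'v ugraph \<Rightarrow> 'v set set \<Rightarrow> 'v \<Rightarrow> 'v set \<Rightarrow> 'v mgraph" where
  "comp_mg G S v D = (component G v, {e \<in> S. e \<subseteq> comp_verts G v}, v, D)"

definition root_class :: "'v ugraph \<Rightarrow> 'v set set \<Rightarrow> 'v \<Rightarrow> mclass" where
  "root_class G S v = iso_class (comp_mg G S v {})"

text \<open>The expectation of \<open>f\<close> at a uniformly random root. For
  \<open>S = {}\<close> and local \<open>f\<close> it is the integral against
  \<open>Psi\<close>.\<close>

definition avg :: "'v ugraph \<Rightarrow> 'v set set \<Rightarrow> (mclass \<Rightarrow> real) \<Rightarrow> real" where
  "avg G S f = (\<Sum>v\<in>verts G. f (root_class G S v)) / card (verts G)"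

lemma verts_component [simp]: "verts (component G v) = comp_verts G v"
  by (simp add: component_def)

lemma component_cong: "u \<in> comp_verts G v \<Longrightarrow> component G u = component G v"
  unfolding component_def by (rule arg_cong[OF comp_verts_eq])

lemma ball_component:
  assumes "u \<in> comp_verts G v" shows "ball_verts (component G v) u t = ball_verts G u t"
  unfolding component_def
  using ball_subset_comp[of G u t] comp_verts_eq[OF assms] by (intro ball_induced) simp

lemma ball_delete_component:
  assumes "u \<in> comp_verts G v"
  shows "ball_verts (delete_edges (component G v) {e \<in> S. e \<subseteq> comp_verts G v}) u t
    = ball_verts (delete_edges G S) u t"
proof -
  have sub: "ball_verts G u t \<subseteq> comp_verts G v"
    using ball_subset_comp[of G u t] comp_verts_eq[OF assms] by simp
  have "ball_verts (delete_edges (component G v) {e \<in> S. e \<subseteq> comp_verts G v}) (id u) t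
    = id ` ball_verts (delete_edges G S) u t"
  proof (rule ball_transport[where W = "comp_verts G v"])
    show "ball_verts (delete_edges G S) u t \<subseteq> comp_verts G v"
      by (rule order_trans[OF ball_delete_subset sub])
    show "ball_verts (delete_edges (component G v) {e \<in> S. e \<subseteq> comp_verts G v}) (id u) t \<subseteq> id ` comp_verts G v"
      using order_trans[OF ball_delete_subset sub[folded ball_component[OF assms]]] by simp
  qed (auto simp: adj_delete component_def)
  then show ?thesis by simp
qed

lemma comp_mg_mgraphs:
  assumes "is_graph G" "locally_finite G" "S \<subseteq> edges G" "v \<in> verts G" "D \<subseteq> comp_verts G v"
  shows "comp_mg G S v D \<in> mgraphs"
proof -
  let ?H = "component G v"
  have g: "is_graph ?H" unfolding component_def by (rule is_graph_induced[OF assms(1)])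
  have "comp_verts ?H u = comp_verts G v" if "u \<in> comp_verts G v" for u
  proof -
    have "comp_verts ?H u = (\<Union>r. ball_verts G u r)"
      unfolding comp_verts_ball ball_component[OF that] ..
    also have "\<dots> = comp_verts G u" by (rule comp_verts_ball[symmetric])
    finally show ?thesis using comp_verts_eq[OF that] by simp
  qed
  moreover have "comp_verts G v \<noteq> {}" using self_in_comp by fast
  ultimately have "connected_graph ?H" by (simp add: connected_graph_def)
  moreover have "locally_finite ?H"
    unfolding locally_finite_def
  proof
    fix u assume "u \<in> verts ?H"
    then have "finite (incident_edges (edges G) u)"
      using comp_subset_verts[OF assms(1,4)] assms(2) by (auto simp: locally_finite_def)
    then show "finite (incident_edges (edges ?H) u)"
      by (rule rev_finite_subset) (auto simp: incident_edges_def component_def)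
  qed
  ultimately show ?thesis using g assms by (auto simp: comp_mg_def mgraphs_def component_def)
qed

lemma max_degree_component:
  assumes "is_graph G" "max_degree_le M G" "v \<in> verts G" shows "max_degree_le M (component G v)"
proof -
  have lf: "locally_finite (component G v)"
    using comp_mg_mgraphs[OF assms(1) _ _ assms(3), of "{}" "{}"] assms(2) by (auto simp: max_degree_le_def comp_mg_def mgraphs_def)
  have "card (incident_edges (edges (component G v)) u) \<le> M" if "u \<in> comp_verts G v" for u
  proof -
    have u: "u \<in> verts G" using comp_subset_verts[OF assms(1,3)] that by auto
    have "card (incident_edges (edges (component G v)) u) \<le> card (incident_edges (edges G) u)"
      using assms(2) u by (intro card_mono) (auto simp: max_degree_le_def locally_finite_def incident_edges_def component_def)
    also have "\<dots> \<le> M" using assms(2) u by (auto simp: max_degree_le_def)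
    finally show ?thesis .
  qed
  then show ?thesis using lf by (simp add: max_degree_le_def)
qed

lemma fin_graphsD:
  assumes "G \<in> fin_graphs M"
  shows "is_graph G" "finite (verts G)" "verts G \<noteq> {}" "max_degree_le M G" "locally_finite G" "card (verts G) > 0"
  using assms by (auto simp: fin_graphs_def max_degree_le_def card_gt_0_iff)

lemma root_class_mem:
  assumes "G \<in> fin_graphs M" "S \<subseteq> edges G" "v \<in> verts G"
  shows "comp_mg G S v {} \<in> mgraphs" "root_class G S v \<in> mclasses" "root_class G S v \<in> marked_rooted_space"
    "max_degree_le M (fst (rep (root_class G S v)))"
proof -
  note f = fin_graphsD[OF assms(1)]
  show m: "comp_mg G S v {} \<in> mgraphs" by (rule comp_mg_mgraphs[OF f(1,5) assms(2,3)]) simp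
  then show c: "root_class G S v \<in> mclasses" unfolding root_class_def by (rule iso_class_mclasses)
  obtain \<phi> where \<phi>: "inj_on \<phi> (verts (fst (comp_mg G S v {})))" "rep (root_class G S v) = mg_map \<phi> (comp_mg G S v {})"
    using rep_obtain[OF m] unfolding root_class_def by blast
  show "root_class G S v \<in> marked_rooted_space" unfolding marked_rooted_space_iff using c \<phi>(2) by (simp add: comp_mg_def mg_map_def)
  show "max_degree_le M (fst (rep (root_class G S v)))"
    using \<phi> max_degree_gmap[of \<phi> "component G v" M] max_degree_component[OF f(1,4) assms(3)] m
    by (simp add: comp_mg_def mg_map_def mgraphs_def)
qed

lemma root_class_rooted:
  assumes "G \<in> fin_graphs M" "v \<in> verts G" shows "root_class G {} v \<in> rooted_space_deg M" "root_class G {} v \<in> rooted_space"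
proof -
  have m: "comp_mg G {} v {} \<in> mgraphs" by (rule root_class_mem(1)[OF assms(1) _ assms(2)]) simp
  obtain \<phi> where \<phi>: "rep (root_class G {} v) = mg_map \<phi> (comp_mg G {} v {})"
    using rep_obtain[OF m] unfolding root_class_def by blast
  then have "\<exists>H x. rep (root_class G {} v) = (H, {}, x, {})" by (simp add: comp_mg_def mg_map_def)
  then show "root_class G {} v \<in> rooted_space_deg M" "root_class G {} v \<in> rooted_space"
    using root_class_mem(2,4)[OF assms(1) _ assms(2), of "{}"] unfolding rooted_space_deg_iff rooted_space_iff by auto
qed

lemma msum_comp_mg:
  "msum b n f (comp_mg G S v D) =
    (\<Sum>y\<in>ball_verts G v n. f (iso_class (two_pt b (component G v) {e \<in> S. e \<subseteq> comp_verts G v} v y)))"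
  by (simp add: msum_def comp_mg_def ball_component)

lemma massn_root_class:
  assumes "G \<in> fin_graphs M" "S \<subseteq> edges G" "v \<in> verts G"
  shows "massn b n f (root_class G S v) = msum b n f (comp_mg G S v {})"
  unfolding root_class_def by (rule massn_iso_class[OF root_class_mem(1)[OF assms]])

text \<open>Being within distance \<open>n\<close> is symmetric, and both vertices of such a pair
  lie in one component. So each summand names the same birooted class from either end, and the two
  sides are one double sum.\<close>

lemma mass_balance:
  fixes f :: "mclass \<Rightarrow> 'a::comm_monoid_add"
  assumes G: "G \<in> fin_graphs M" and S: "S \<subseteq> edges G"
  shows "(\<Sum>v\<in>verts G. massn True n f (root_class G S v)) = (\<Sum>v\<in>verts G. massn False n f (root_class G S v))"
proof -
  let ?V = "verts G"
  let ?g = "\<lambda>v y. f (iso_class (component G v, {e \<in> S. e \<subseteq> comp_verts G v}, v, {y}))"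
  note ff = fin_graphsD[OF G]
  have B: "ball_verts G v n = {y \<in> ?V. y \<in> ball_verts G v n}" if "v \<in> ?V" for v
    using ball_subset_verts[OF ff(1) that] by blast
  have T: "massn True n f (root_class G S v) = (\<Sum>y\<in>{y \<in> ?V. y \<in> ball_verts G v n}. ?g v y)" if "v \<in> ?V" for v
    unfolding massn_root_class[OF G S that] msum_comp_mg B[OF that, symmetric] by (simp add: two_pt_def)
  have F: "massn False n f (root_class G S y) = (\<Sum>v\<in>{v \<in> ?V. y \<in> ball_verts G v n}. ?g v y)" if "y \<in> ?V" for y
  proof -
    have eq: "{v \<in> ?V. y \<in> ball_verts G v n} = ball_verts G y n"
      using ball_subset_verts[OF ff(1) that, of n] by (auto intro: ball_verts_sym)
    have "?g v y = f (iso_class (two_pt False (component G y) {e \<in> S. e \<subseteq> comp_verts G y} y v))"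
      if v: "v \<in> ball_verts G y n" for v
    proof -
      have vc: "v \<in> comp_verts G y" using v ball_subset_comp by fast
      show ?thesis using component_cong[OF vc] comp_verts_eq[OF vc] by (simp add: two_pt_def)
    qed
    then show ?thesis unfolding massn_root_class[OF G S that] msum_comp_mg eq by simp
  qed
  have "(\<Sum>v\<in>?V. massn True n f (root_class G S v)) = (\<Sum>v\<in>?V. \<Sum>y\<in>{y \<in> ?V. y \<in> ball_verts G v n}. ?g v y)"
    by (rule sum.cong[OF refl T])
  also have "\<dots> = (\<Sum>y\<in>?V. \<Sum>v\<in>{v \<in> ?V. y \<in> ball_verts G v n}. ?g v y)"
    by (rule sum.swap_restrict[OF ff(2,2)])
  also have "\<dots> = (\<Sum>y\<in>?V. massn False n f (root_class G S y))"
    by (rule sum.cong[OF refl F[symmetric]])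
  finally show ?thesis .
qed

lemma massn_root_class_le:
  assumes G: "G \<in> fin_graphs M" "S \<subseteq> edges G" "v \<in> verts G" and f: "\<And>c. f c \<le> (1 :: nat)"
  shows "massn b n f (root_class G S v) \<le> (M + 1) ^ n"
proof -
  note ff = fin_graphsD[OF G(1)]
  have "massn b n f (root_class G S v) \<le> (\<Sum>y\<in>ball_verts G v n. 1)"
    unfolding massn_root_class[OF G] msum_comp_mg using f by (intro sum_mono) auto
  also have "\<dots> \<le> (M + 1) ^ n" using card_ball[OF ff(1,4) G(3), of n] by simp
  finally show ?thesis .
qed

lemma avg_const:
  assumes "G \<in> fin_graphs M" "\<And>v. v \<in> verts G \<Longrightarrow> f (root_class G S v) = a" shows "avg G S f = a"
  using assms(2) fin_graphsD(6)[OF assms(1)] by (simp add: avg_def)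

lemma avg_cong:
  assumes "\<And>v. v \<in> verts G \<Longrightarrow> f (root_class G S v) = f' (root_class G S' v)" shows "avg G S f = avg G S' f'"
  using assms by (simp add: avg_def)

lemma avg_mono:
  assumes "\<And>v. v \<in> verts G \<Longrightarrow> f (root_class G S v) \<le> f' (root_class G S v)" shows "avg G S f \<le> avg G S f'"
  using assms unfolding avg_def by (intro divide_right_mono sum_mono) auto

lemma avg_sum: "avg G S (\<lambda>c. \<Sum>t\<in>T. f t c) = (\<Sum>t\<in>T. avg G S (f t))"
  unfolding avg_def by (simp add: sum_divide_distrib[symmetric] sum.swap[of _ T])

lemma avg_add: "avg G S (\<lambda>c. f c + g c) = avg G S f + avg G S g"
  by (simp add: avg_def sum.distrib add_divide_distrib)

section \<open>Passing from finite averages to limit measures\<close>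

section \<open>Measures that are limits of finite graphs\<close>

text \<open>One notion for both limits: the given \<open>\<mu>\<close>, with no marks and the filter
  \<open>sequentially\<close>, and the constructed \<open>\<nu>\<close>, along a filter found by
  compactness. Convergence is required on local events only.\<close>

definition lim_measure :: "nat filter \<Rightarrow> (nat \<Rightarrow> 'v ugraph) \<Rightarrow> (nat \<Rightarrow> 'v set set) \<Rightarrow> mclass set \<Rightarrow> mclass measure \<Rightarrow> bool" where
  "lim_measure F G S X \<nu> \<longleftrightarrow> prob_space \<nu> \<and> sets \<nu> = sets (local_borel X) \<and>
    (\<forall>A r. local_at r A \<longrightarrow> ((\<lambda>j. avg (G j) (S j) (indicator {c. A c})) \<longlongrightarrow> measure \<nu> {c \<in> X. A c}) F)"

lemma sum_less_count: "m \<le> B \<Longrightarrow> (\<Sum>t<B. if t < m then 1 else 0) = (of_nat m :: 'b::semiring_1)"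
proof -
  assume m: "m \<le> B"
  have "(\<Sum>t<B. if t < m then 1 else 0 :: 'b) = (\<Sum>t\<in>{t\<in>{..<B}. t < m}. 1)" by (rule sum.inter_filter[symmetric]) simp
  also have "{t\<in>{..<B}. t < m} = {..<m}" using m by auto
  finally show ?thesis by simp
qed

locale finite_graph_seq =
  fixes M :: nat and G :: "nat \<Rightarrow> 'v ugraph" and S :: "nat \<Rightarrow> 'v set set"
  assumes G: "\<And>j. G j \<in> fin_graphs M" and S: "\<And>j. S j \<subseteq> edges (G j)"
begin

text \<open>All the averages equal 1, hence so does the limit. This is how deterministic facts about
  the finite graphs reach the limit measure.\<close>

lemma lim_measure_AE:
  assumes L: "lim_measure F G S X \<nu>" and X: "X \<subseteq> mclasses" and F: "F \<noteq> bot" and A: "local_at r A"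
    and pts: "\<And>j v. v \<in> verts (G j) \<Longrightarrow> A (root_class (G j) (S j) v)"
  shows "AE c in \<nu>. A c"
proof -
  interpret prob_space \<nu> using L by (simp add: lim_measure_def)
  have "((\<lambda>j. avg (G j) (S j) (indicator {c. A c})) \<longlongrightarrow> measure \<nu> {c \<in> X. A c}) F"
    using L A unfolding lim_measure_def by blast
  moreover have "avg (G j) (S j) (indicator {c. A c}) = 1" for j
    by (rule avg_const[OF G]) (simp add: pts)
  ultimately have "((\<lambda>j. 1) \<longlongrightarrow> measure \<nu> {c \<in> X. A c}) F" by simp
  then have "measure \<nu> {c \<in> X. A c} = 1" by (rule tendsto_unique[OF F _ tendsto_const])
  then have "AE c in \<nu>. c \<in> {c \<in> X. A c}" by (rule AE_prob_1)
  then show ?thesis by auto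
qed

text \<open>Layer cake: a function bounded by \<open>B\<close> is the sum over \<open>t < B\<close>
  of the indicators of the local events \<open>t < h c\<close>, whose averages converge. The bound,
  assumed on finite graphs only, holds almost surely in the limit.\<close>

lemma lim_measure_nat:
  assumes L: "lim_measure F G S X \<nu>" and X: "X \<subseteq> mclasses" and F: "F \<noteq> bot"
    and h: "local_at r (h :: mclass \<Rightarrow> nat)"
    and B: "\<And>j v. v \<in> verts (G j) \<Longrightarrow> h (root_class (G j) (S j) v) \<le> B"
  shows "\<exists>l. (\<integral>\<^sup>+c. of_nat (h c) \<partial>\<nu>) = ennreal l \<and> ((\<lambda>j. avg (G j) (S j) (\<lambda>c. real (h c))) \<longlongrightarrow> l) F"
proof -
  interpret prob_space \<nu> using L by (simp add: lim_measure_def)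
  have sts: "sets \<nu> = sets (local_borel X)" using L by (simp add: lim_measure_def)
  have sp: "space \<nu> = X" using sets_eq_imp_space_eq[OF sts] X by simp
  have ae: "AE c in \<nu>. h c \<le> B" by (rule lim_measure_AE[OF L X F local_at_comp[OF h, of "\<lambda>a. a \<le> B"] B])
  let ?A = "\<lambda>t c. t < h c"
  have mA: "{c \<in> X. t < h c} \<in> sets \<nu>" for t
    using local_sets[OF X h, of "\<lambda>a. t < a"] sts by simp
  define l where "l = (\<Sum>t<B. measure \<nu> {c \<in> X. t < h c})"
  have "(\<integral>\<^sup>+c. of_nat (h c) \<partial>\<nu>) = (\<integral>\<^sup>+c. (\<Sum>t<B. indicator {c \<in> X. t < h c} c) \<partial>\<nu>)"
  proof (rule nn_integral_cong_AE)
    show "AE c in \<nu>. (of_nat (h c) :: ennreal) = (\<Sum>t<B. indicator {c \<in> X. t < h c} c)"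
      using ae AE_space
    proof eventually_elim
      case (elim c)
      then have "(\<Sum>t<B. indicator {c \<in> X. t < h c} c) = (\<Sum>t<B. if t < h c then 1 else 0 :: ennreal)"
        by (intro sum.cong) (auto simp: sp)
      then show ?case using sum_less_count[of "h c" B, where 'b = ennreal] elim by simp
    qed
  qed
  also have "\<dots> = (\<Sum>t<B. emeasure \<nu> {c \<in> X. t < h c})"
    using mA by (simp add: nn_integral_sum)
  also have "\<dots> = ennreal l"
    unfolding l_def by (simp add: emeasure_eq_measure sum_ennreal)
  finally have 1: "(\<integral>\<^sup>+c. of_nat (h c) \<partial>\<nu>) = ennreal l" .
  have "avg (G j) (S j) (\<lambda>c. real (h c)) = (\<Sum>t<B. avg (G j) (S j) (indicator {c. t < h c}))" for j
    unfolding avg_sum[symmetric]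
  proof (rule avg_cong)
    fix v assume "v \<in> verts (G j)"
    then have "real (h (root_class (G j) (S j) v)) = (\<Sum>t<B. if t < h (root_class (G j) (S j) v) then 1 else 0)"
      using sum_less_count[OF B, where 'b = real] by simp
    then show "real (h (root_class (G j) (S j) v)) = (\<Sum>t<B. indicator {c. t < h c} (root_class (G j) (S j) v))"
      by (simp only: indicator_def mem_Collect_eq of_bool_def)
  qed
  moreover have "((\<lambda>j. \<Sum>t<B. avg (G j) (S j) (indicator {c. t < h c})) \<longlongrightarrow> l) F"
    unfolding l_def
  proof (rule tendsto_sum)
    fix t
    have "local_at r (\<lambda>c. t < h c)" by (rule local_at_comp[OF h])
    then show "((\<lambda>j. avg (G j) (S j) (indicator {c. t < h c})) \<longlongrightarrow> measure \<nu> {c \<in> X. t < h c}) F"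
      using L unfolding lim_measure_def by blast
  qed
  ultimately show ?thesis using 1 by auto
qed

text \<open>Truncated sums of a cylinder indicator are local and at most \<open>(M + 1) ^ n\<close>,
  so both sides are limits of averages, and these agree on every finite graph.\<close>

lemma lim_measure_mass_transport:
  assumes L: "lim_measure F G S X \<nu>" and X: "X \<subseteq> mclasses" "X2 \<subseteq> mclasses" and F: "F \<noteq> bot"
    and cl: "\<And>c G S z D y b. c \<in> X \<Longrightarrow> rep c = (G, S, z, D) \<Longrightarrow> y \<in> verts G \<Longrightarrow> iso_class (two_pt b G S z y) \<in> X2"
  shows "mass_transport X2 \<nu>"
proof (rule mass_transport_from_cylinders[OF X cl])
  show "prob_space \<nu>" "sets \<nu> = sets (local_borel X)" using L by (auto simp: lim_measure_def)
  show "\<exists>B. AE c in \<nu>. massn True n (\<lambda>_. 1 :: nat) c \<le> B" for n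
  proof
    show "AE c in \<nu>. massn True n (\<lambda>_. 1 :: nat) c \<le> (M + 1) ^ n"
      by (rule lim_measure_AE[OF L X(1) F local_at_comp[OF massn_local[OF local_at_const[of 0]], where h = "\<lambda>a. a \<le> (M + 1) ^ n"]])
        (rule massn_root_class_le[OF G S], simp_all)
  qed
next
  fix n s and t :: mclass
  let ?f = "\<lambda>c. if ball_type s c = t then 1 else 0 :: nat"
  have loc: "local_at s ?f" by (rule local_at_comp[OF local_at_ball_type[OF order_refl]])
  have B: "massn b n ?f (root_class (G j) (S j) v) \<le> (M + 1) ^ n" if "v \<in> verts (G j)" for b j v
    by (rule massn_root_class_le[OF G S that]) simp
  obtain l where l: "(\<integral>\<^sup>+c. of_nat (massn True n ?f c) \<partial>\<nu>) = ennreal l"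
      "((\<lambda>j. avg (G j) (S j) (\<lambda>c. real (massn True n ?f c))) \<longlongrightarrow> l) F"
    using lim_measure_nat[OF L X(1) F massn_local[OF loc] B] by blast
  obtain l' where l': "(\<integral>\<^sup>+c. of_nat (massn False n ?f c) \<partial>\<nu>) = ennreal l'"
      "((\<lambda>j. avg (G j) (S j) (\<lambda>c. real (massn False n ?f c))) \<longlongrightarrow> l') F"
    using lim_measure_nat[OF L X(1) F massn_local[OF loc] B] by blast
  have "avg (G j) (S j) (\<lambda>c. real (massn True n ?f c)) = avg (G j) (S j) (\<lambda>c. real (massn False n ?f c))" for j
    unfolding avg_def of_nat_sum[symmetric] mass_balance[OF G S] ..
  then have "l = l'" using tendsto_unique[OF F l(2)] l'(2) by simp
  then show "(\<integral>\<^sup>+c. of_nat (massn True n ?f c) \<partial>\<nu>) = (\<integral>\<^sup>+c. of_nat (massn False n ?f c) \<partial>\<nu>)"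
    using l(1) l'(1) by simp
qed

end

lemma two_pt_rooted:
  assumes "c \<in> rooted_space" "rep c = (G, S, z, D)" "y \<in> verts G"
  shows "iso_class (two_pt b G S z y) \<in> birooted_space"
proof -
  have c: "c \<in> mclasses" "S = {}" using assms(1,2) by (auto simp: rooted_space_iff)
  have m: "two_pt b G S z y \<in> mgraphs"
    using two_pt_mgraphs[OF _ assms(3)] rep_mclass(1)[OF c(1)] assms(2) by metis
  obtain \<phi> where "rep (iso_class (two_pt b G S z y)) = mg_map \<phi> (two_pt b G S z y)" using rep_obtain[OF m] by blast
  then show ?thesis unfolding birooted_space_iff using iso_class_mclasses[OF m] c(2)
    by (simp add: two_pt_def mg_map_def split: if_splits)
qed

lemma two_pt_marked_rooted:
  assumes "c \<in> marked_rooted_space" "rep c = (G, S, z, D)" "y \<in> verts G"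
  shows "iso_class (two_pt b G S z y) \<in> marked_birooted_space"
proof -
  have c: "c \<in> mclasses" using assms(1,2) by (auto simp: marked_rooted_space_iff)
  have m: "two_pt b G S z y \<in> mgraphs"
    using two_pt_mgraphs[OF _ assms(3)] rep_mclass(1)[OF c(1)] assms(2) by metis
  obtain \<phi> where "rep (iso_class (two_pt b G S z y)) = mg_map \<phi> (two_pt b G S z y)" using rep_obtain[OF m] by blast
  then show ?thesis unfolding marked_birooted_space_iff using iso_class_mclasses[OF m]
    by (simp add: two_pt_def mg_map_def split: if_splits)
qed

section \<open>Weak convergence of finite graphs\<close>

lemma Psi_integral:
  assumes "G \<in> fin_graphs M" "local_at r f" shows "(\<integral>c. f c \<partial>Psi M G) = avg G {} f"
proof -
  note ff = fin_graphsD[OF assms(1)]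
  have p: "root_class G {} = (\<lambda>x. iso_class (component G x, {}, x, {}))"
    by (rule ext) (simp add: root_class_def comp_mg_def)
  have m: "root_class G {} \<in> measurable (uniform_count_measure (verts G)) (local_borel (rooted_space_deg M))"
    by (rule measurableI)
      (use root_class_rooted(1)[OF assms(1)] in \<open>auto simp: space_uniform_count_measure sets_uniform_count_measure\<close>)
  have "(\<integral>c. f c \<partial>Psi M G) = (\<integral>x. f (root_class G {} x) \<partial>uniform_count_measure (verts G))"
    unfolding Psi_def p[symmetric] by (rule integral_distr[OF m local_measurable[OF _ assms(2)]]) auto
  also have "\<dots> = avg G {} f"
    unfolding avg_def by (rule integral_uniform_count_measure[OF ff(2)])
  finally show ?thesis .
qed

lemma weak_limit_local:
  assumes G: "\<And>j. G j \<in> fin_graphs M" and w: "weakly_converges (rooted_space_deg M) (\<lambda>j. Psi M (G j)) \<mu>"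
    and f: "local_at r f" and bd: "\<And>c. c \<in> rooted_space_deg M \<Longrightarrow> \<bar>f c\<bar> \<le> B"
  shows "(\<lambda>j. avg (G j) {} f) \<longlonglongrightarrow> (\<integral>c. f c \<partial>\<mu>)"
proof -
  have "continuous_map (local_topology (rooted_space_deg M)) euclideanreal f"
    by (rule local_continuous[OF _ f]) simp
  moreover have "bounded (f ` rooted_space_deg M)" unfolding bounded_iff using bd by auto
  ultimately have "(\<lambda>j. \<integral>c. f c \<partial>Psi M (G j)) \<longlonglongrightarrow> (\<integral>c. f c \<partial>\<mu>)"
    using w unfolding weakly_converges_def by blast
  then show ?thesis unfolding Psi_integral[OF G f] .
qed

lemma extend_measurable:
  assumes "\<mu> \<in> prob_measures (rooted_space_deg M)"
  shows "(\<lambda>c. c) \<in> measurable \<mu> (local_borel rooted_space)" "prob_space \<mu>" "space \<mu> = rooted_space_deg M"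
    "sets \<mu> = sets (local_borel (rooted_space_deg M))"
proof -
  show p: "prob_space \<mu>" "sets \<mu> = sets (local_borel (rooted_space_deg M))"
    using assms by (auto simp: prob_measures_def)
  show sp: "space \<mu> = rooted_space_deg M" using sets_eq_imp_space_eq[OF p(2)] by simp
  have "(\<lambda>c. c) \<in> measurable \<mu> (sigma rooted_space {U. openin (local_topology rooted_space) U})"
  proof (rule measurable_measure_of)
    show "{U. openin (local_topology rooted_space) U} \<subseteq> Pow rooted_space" by (rule open_subset_Pow) simp
    show "(\<lambda>c. c) \<in> space \<mu> \<rightarrow> rooted_space" using sp spaces_subset(6) by blast
    fix U assume "U \<in> {U. openin (local_topology rooted_space) U}"
    then have U: "U \<subseteq> rooted_space" "\<forall>c\<in>U. \<exists>r. \<forall>d\<in>rooted_space. ball_type r d = ball_type r c \<longrightarrow> d \<in> U"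
      using openin_local[OF spaces_subset(1)] by auto
    have "openin (local_topology (rooted_space_deg M)) (U \<inter> rooted_space_deg M)"
      unfolding openin_local[OF spaces_subset(2)]
    proof (intro conjI ballI)
      fix c assume c: "c \<in> U \<inter> rooted_space_deg M"
      obtain r where r: "\<forall>d\<in>rooted_space. ball_type r d = ball_type r c \<longrightarrow> d \<in> U" using U(2) c by auto
      have "d \<in> U \<inter> rooted_space_deg M" if d: "d \<in> rooted_space_deg M" "ball_type r d = ball_type r c" for d
        using r d subsetD[OF spaces_subset(6) d(1)] by simp
      then show "\<exists>r. \<forall>d\<in>rooted_space_deg M. ball_type r d = ball_type r c \<longrightarrow> d \<in> U \<inter> rooted_space_deg M" by blast
    qed simp
    then show "(\<lambda>c. c) -` U \<inter> space \<mu> \<in> sets \<mu>"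
      unfolding sp p(2) sets_local_borel[OF spaces_subset(2)] by (simp add: sigma_sets.Basic)
  qed
  then show "(\<lambda>c. c) \<in> measurable \<mu> (local_borel rooted_space)" by (simp add: local_borel_def)
qed

lemma lim_measure_extend:
  assumes G: "\<And>j. G j \<in> fin_graphs M" and w: "weakly_converges (rooted_space_deg M) (\<lambda>j. Psi M (G j)) \<mu>"
    and \<mu>: "\<mu> \<in> prob_measures (rooted_space_deg M)"
  shows "lim_measure sequentially G (\<lambda>_. {}) rooted_space (extend_measure_to_rooted \<mu>)"
  unfolding lim_measure_def
proof (intro conjI allI impI)
  note e = extend_measurable[OF \<mu>]
  interpret prob_space \<mu> by (rule e(2))
  show "prob_space (extend_measure_to_rooted \<mu>)"
    unfolding extend_measure_to_rooted_def by (rule prob_space_distr[OF e(1)])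
  show "sets (extend_measure_to_rooted \<mu>) = sets (local_borel rooted_space)"
    unfolding extend_measure_to_rooted_def by simp
  fix A :: "mclass \<Rightarrow> bool" and r :: nat assume A: "local_at r A"
  have loc: "local_at r (indicator {c. A c} :: mclass \<Rightarrow> real)"
    using local_at_comp[OF A, where h = "of_bool :: bool \<Rightarrow> real"] by (simp add: indicator_def[abs_def])
  have "measure (extend_measure_to_rooted \<mu>) {c \<in> rooted_space. A c} = measure \<mu> ((\<lambda>c. c) -` {c \<in> rooted_space. A c} \<inter> space \<mu>)"
    unfolding extend_measure_to_rooted_def
    by (rule measure_distr[OF e(1) local_sets[OF _ A, of _ "\<lambda>a. a"]]) simp
  also have "(\<lambda>c. c) -` {c \<in> rooted_space. A c} \<inter> space \<mu> = {c. A c} \<inter> space \<mu>"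
    unfolding e(3) using spaces_subset(6)[of M] by blast
  also have "measure \<mu> ({c. A c} \<inter> space \<mu>) = (\<integral>c. indicator {c. A c} c \<partial>\<mu>)" by simp
  finally show "((\<lambda>j. avg (G j) {} (indicator {c. A c})) \<longlongrightarrow> measure (extend_measure_to_rooted \<mu>) {c \<in> rooted_space. A c}) sequentially"
    using weak_limit_local[OF G w loc, of 1] by (simp add: indicator_def)
qed

section \<open>Existence of a limit measure for finite marked graphs\<close>

section \<open>Subsequential limits of finite marked graphs\<close>

lemma ball_type_marked_rooted:
  assumes "c \<in> marked_rooted_space" shows "ball_type n c \<in> marked_rooted_space"
proof -
  obtain G S x where c: "c \<in> mclasses" "rep c = (G, S, x, {})" using assms by (auto simp: marked_rooted_space_iff)
  have m: "mg_ball n (rep c) \<in> mgraphs" by (rule mg_ball_mgraphs[OF rep_mclass(1)[OF c(1)]])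
  obtain \<phi> where "rep (ball_type n c) = mg_map \<phi> (mg_ball n (rep c))" using rep_obtain[OF m] unfolding ball_type_def by blast
  then show ?thesis unfolding marked_rooted_space_iff using ball_type_mclasses[OF c(1)] by (simp add: c(2) mg_ball_eq mg_map_def)
qed

text \<open>The degree bound makes the types of \<open>n\<close>-balls of points of
  \<open>A n\<close> finite in number. Since the sets decrease, restriction maps level
  \<open>n + 1\<close> to level \<open>n\<close>, and a coherent sequence of types is realized by a
  class.\<close>

lemma local_decseq_compact:
  assumes A: "\<And>i. A i = {c \<in> marked_rooted_space. P i c}" and loc: "\<And>i. local_at (r i) (P i)" and dec: "decseq A"
    and ne: "\<And>i. \<exists>c\<in>A i. max_degree_le M (fst (rep c))"
  shows "(\<Inter>i. A i) \<noteq> {}"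
proof -
  define T where "T n = ball_type n ` {c \<in> A n. max_degree_le M (fst (rep c))}" for n
  have AX: "A i \<subseteq> mclasses" for i using A spaces_subset(4) by blast
  have "\<exists>s. \<forall>n. s n \<in> T n \<and> ball_type n (s (Suc n)) = s n"
  proof (rule inverse_limit_nonempty)
    show "finite (T n)" for n unfolding T_def by (rule finite_ball_type) (use AX in auto)
    show "T n \<noteq> {}" for n using ne[of n] unfolding T_def by blast
    fix n t assume "t \<in> T (Suc n)"
    then obtain c where c: "c \<in> A (Suc n)" "max_degree_le M (fst (rep c))" "t = ball_type (Suc n) c" unfolding T_def by blast
    have "c \<in> A n" using c(1) dec by (auto simp: decseq_Suc_iff)
    moreover have "ball_type n t = ball_type n c" unfolding c(3) using c(1) AX by (intro ball_type_ball_type) auto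
    ultimately show "ball_type n t \<in> T n" unfolding T_def using c(2) by simp
  qed
  then obtain s where s: "\<And>n. s n \<in> T n" "\<And>n. ball_type n (s (Suc n)) = s n" by blast
  have sd: "\<exists>d\<in>A n. s n = ball_type n d" for n using s(1)[of n] unfolding T_def by blast
  have sm: "s n \<in> marked_rooted_space" for n
  proof -
    obtain d where d: "d \<in> A n" "s n = ball_type n d" using sd by blast
    have "d \<in> marked_rooted_space" using d(1) A by blast
    then show ?thesis unfolding d(2) by (rule ball_type_marked_rooted)
  qed
  have smc: "s n \<in> mclasses" for n using sm spaces_subset(4) by blast
  obtain c where c: "c \<in> mclasses" "\<And>n. ball_type n c = s n" using mclass_limit[OF smc s(2)] by blast
  have cm: "c \<in> marked_rooted_space" by (rule marked_rooted_ball_type[OF c(1)]) (simp add: c(2) sm)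
  have "c \<in> A i" for i
  proof -
    \<comment> \<open>Large enough that a witness in \<open>A n\<close> lies in \<open>A i\<close>
      and that its type of level \<open>n\<close> decides \<open>P i\<close>.\<close>
    define n where "n = max i (r i)"
    obtain d where d: "d \<in> A n" "s n = ball_type n d" using sd by blast
    have "A n \<subseteq> A i" using dec by (simp add: decseq_def n_def)
    then have di: "d \<in> A i" using d by blast
    have dm: "d \<in> mclasses" using di AX by blast
    have bn: "ball_type n c = ball_type n d" using c(2) d(2) by simp
    have "ball_type (r i) c = ball_type (r i) d" by (rule ball_type_mono[OF c(1) dm bn]) (simp add: n_def)
    then have "P i c = P i d" by (rule local_atD[OF loc c(1) dm])
    then show ?thesis using di cm unfolding A by simp
  qed
  then show ?thesis by blast
qed

context finite_graph_seq
begin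

text \<open>Compactness of the product yields a cluster point, which need not be the limit of a
  subsequence; a filter avoids that question and handles all sets of classes at once.\<close>

lemma exists_limit_filter:
  "\<exists>F L. F \<noteq> bot \<and> F \<le> sequentially \<and> (\<forall>A. ((\<lambda>j. avg (G j) (S j) (indicator A)) \<longlongrightarrow> L A) F)"
proof -
  define T where "T j = (\<lambda>A. avg (G j) (S j) (indicator A))" for j
  define K where "K = PiE (UNIV :: mclass set set) (\<lambda>_. {0..1::real})"
  have "compactin (product_topology (\<lambda>_. euclidean) (UNIV :: mclass set set)) K"
    unfolding K_def compactin_PiE by simp
  then have K: "compact K" by (simp add: euclidean_product_topology)
  have T01: "0 \<le> T j A \<and> T j A \<le> 1" for j A
  proof -
    have "avg (G j) (S j) (indicator A) \<le> avg (G j) (S j) (\<lambda>_. 1)" by (rule avg_mono) (simp add: indicator_def)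
    moreover have "avg (G j) (S j) (\<lambda>_. 0) \<le> avg (G j) (S j) (indicator A)" by (rule avg_mono) simp
    moreover have "avg (G j) (S j) (\<lambda>_. 1) = 1" "avg (G j) (S j) (\<lambda>_. 0) = 0" by (rule avg_const[OF G], simp)+
    ultimately show ?thesis by (simp add: T_def)
  qed
  have TK: "T j \<in> K" for j using T01 by (simp add: K_def PiE_iff)
  have "filtermap T sequentially \<noteq> bot" by (simp add: filtermap_bot_iff)
  moreover have "eventually (\<lambda>x. x \<in> K) (filtermap T sequentially)" by (simp add: eventually_filtermap TK)
  ultimately obtain L where L: "inf (nhds L) (filtermap T sequentially) \<noteq> bot"
    using K[unfolded compact_filter] by blast
  \<comment> \<open>The trace on the indices of the neighbourhoods of the cluster point; it is
    proper because \<open>L\<close> is a cluster point of the sequence.\<close>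
  define F where "F = inf sequentially (filtercomap T (nhds L))"
  have "F \<noteq> bot"
  proof
    assume "F = bot"
    then have "eventually (\<lambda>_. False) F" by simp
    then obtain Q R where QR: "eventually Q sequentially" "eventually R (filtercomap T (nhds L))" "\<And>j. Q j \<Longrightarrow> R j \<Longrightarrow> False"
      unfolding F_def eventually_inf by blast
    then obtain R' where R': "eventually R' (nhds L)" "\<And>j. R' (T j) \<Longrightarrow> R j" unfolding eventually_filtercomap by blast
    have "eventually (\<lambda>j. \<not> R' (T j)) sequentially" by (rule eventually_mono[OF QR(1)]) (use QR(3) R'(2) in blast)
    then have "eventually (\<lambda>x. \<not> R' x) (filtermap T sequentially)" by (simp add: eventually_filtermap)
    then have "eventually (\<lambda>_. False) (inf (nhds L) (filtermap T sequentially))"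
      unfolding eventually_inf using R'(1) by blast
    then show False using L by (simp add: eventually_False)
  qed
  moreover have "F \<le> sequentially" by (simp add: F_def)
  moreover have "((\<lambda>j. avg (G j) (S j) (indicator A)) \<longlongrightarrow> L A) F" for A
  proof -
    have lim: "filterlim T (nhds L) F"
      by (rule filterlim_mono[OF filterlim_filtercomap order_refl]) (simp add: F_def)
    have cont: "continuous_on UNIV (\<lambda>x :: mclass set \<Rightarrow> real. x A)"
      by (rule continuous_on_product_coordinates)
    have "((\<lambda>j. T j A) \<longlongrightarrow> L A) F"
      by (rule continuous_on_tendsto_compose[OF cont lim UNIV_I]) simp
    then show ?thesis by (simp add: T_def)
  qed
  ultimately show ?thesis by blast
qed

lemma exists_lim_measure:
  "\<exists>F \<nu>. F \<noteq> bot \<and> F \<le> sequentially \<and> lim_measure F G S marked_rooted_space \<nu>"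
proof -
  obtain F L where FL: "F \<noteq> bot \<and> F \<le> sequentially \<and> (\<forall>A. ((\<lambda>j. avg (G j) (S j) (indicator A)) \<longlongrightarrow> L A) F)"
    using exists_limit_filter by (elim exE)
  have F: "F \<noteq> bot" "F \<le> sequentially"
    and L: "((\<lambda>j. avg (G j) (S j) (indicator A)) \<longlongrightarrow> L A) F" for A
    using FL by simp_all
  let ?\<Omega> = "marked_rooted_space"
  \<comment> \<open>\<open>L\<close> is finitely additive on all sets, but compactness is available
    only for local events, so the measure is built from this algebra.\<close>
  define \<A> where "\<A> = {A. \<exists>P r. A = {c \<in> ?\<Omega>. P c} \<and> local_at r P}"
  have \<A>I: "{c \<in> ?\<Omega>. P c} \<in> \<A>" if "local_at r P" for P r using that unfolding \<A>_def by blast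
  have \<A>E: "\<exists>P r. A = {c \<in> ?\<Omega>. P c} \<and> local_at r P" if "A \<in> \<A>" for A using that unfolding \<A>_def by blast
  interpret algebra ?\<Omega> \<A>
    unfolding algebra_iff_Un
  proof (intro conjI ballI)
    show "\<A> \<subseteq> Pow ?\<Omega>" unfolding \<A>_def by blast
    show "{} \<in> \<A>" using \<A>I[OF local_at_const[of 0 False]] by simp
  next
    fix A assume "A \<in> \<A>"
    then obtain P r where P: "A = {c \<in> ?\<Omega>. P c}" "local_at r P" using \<A>E by blast
    have "?\<Omega> - A = {c \<in> ?\<Omega>. \<not> P c}" unfolding P(1) by blast
    then show "?\<Omega> - A \<in> \<A>" using \<A>I[OF local_at_comp[OF P(2), where h = Not]] by simp
  next
    fix A B assume "A \<in> \<A>" "B \<in> \<A>"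
    obtain P r where P: "A = {c \<in> ?\<Omega>. P c}" "local_at r P" using \<A>E[OF \<open>A \<in> \<A>\<close>] by blast
    obtain Q s where Q: "B = {c \<in> ?\<Omega>. Q c}" "local_at s Q" using \<A>E[OF \<open>B \<in> \<A>\<close>] by blast
    have "A \<union> B = {c \<in> ?\<Omega>. P c \<or> Q c}" unfolding P(1) Q(1) by blast
    then show "A \<union> B \<in> \<A>" using \<A>I[OF local_at_comp2[OF P(2) Q(2), where h = "(\<or>)"]] by simp
  qed
  have L0: "0 \<le> L A" for A
  proof (rule tendsto_lowerbound[OF L _ F(1)])
    have "0 \<le> avg (G j) (S j) (indicator A)" for j unfolding avg_def by (intro divide_nonneg_nonneg sum_nonneg) auto
    then show "\<forall>\<^sub>F j in F. 0 \<le> avg (G j) (S j) (indicator A)" by simp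
  qed
  have Lconst: "L A = a" if "\<And>j v. v \<in> verts (G j) \<Longrightarrow> indicator A (root_class (G j) (S j) v) = a" for A a
  proof -
    have "avg (G j) (S j) (indicator A) = a" for j by (rule avg_const[OF G]) (rule that)
    then have "((\<lambda>j. a) \<longlongrightarrow> L A) F" using L[of A] by simp
    then show ?thesis by (rule tendsto_unique[OF F(1) _ tendsto_const])
  qed
  have ptm: "root_class (G j) (S j) v \<in> ?\<Omega>" if "v \<in> verts (G j)" for j v by (rule root_class_mem(3)[OF G S that])
  have Ladd: "L (A \<union> B) = L A + L B" if "A \<inter> B = {}" for A B
  proof -
    have "avg (G j) (S j) (indicator (A \<union> B)) = avg (G j) (S j) (indicator A) + avg (G j) (S j) (indicator B)" for j
      unfolding avg_add[symmetric] by (rule avg_cong) (simp add: indicator_disj_union[OF that])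
    then have "((\<lambda>j. avg (G j) (S j) (indicator (A \<union> B))) \<longlongrightarrow> L A + L B) F"
      using tendsto_add[OF L[of A] L[of B]] by simp
    then show ?thesis by (rule tendsto_unique[OF F(1) L])
  qed
  have "\<exists>m :: mclass set \<Rightarrow> ennreal. (\<forall>s\<in>\<A>. m s = ennreal (L s)) \<and> measure_space ?\<Omega> (sigma_sets ?\<Omega> \<A>) m"
  proof (rule caratheodory_empty_continuous)
    have "L {} = 0" by (rule Lconst) simp
    then show "positive \<A> (\<lambda>A. ennreal (L A))" by (simp add: positive_def)
    show "additive \<A> (\<lambda>A. ennreal (L A))" by (auto simp: additive_def Ladd ennreal_plus L0)
    show "ennreal (L A) \<noteq> \<infinity>" for A by simp
    fix A :: "nat \<Rightarrow> mclass set"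
    assume A: "range A \<subseteq> \<A>" "decseq A" "(\<Inter>i. A i) = {}"
    have AA: "A i \<in> \<A>" for i using A(1) by blast
    have "\<forall>i. \<exists>P r. A i = {c \<in> ?\<Omega>. P c} \<and> local_at r P" by (intro allI \<A>E AA)
    from choice[OF this] obtain P where "\<forall>i. \<exists>r. A i = {c \<in> ?\<Omega>. P i c} \<and> local_at r (P i)"
      by (elim exE)
    from choice[OF this] obtain r where Pr: "\<forall>i. A i = {c \<in> ?\<Omega>. P i c} \<and> local_at (r i) (P i)"
      by (elim exE)
    have P: "A i = {c \<in> ?\<Omega>. P i c}" "local_at (r i) (P i)" for i
      by (rule conjunct1[OF spec[OF Pr]], rule conjunct2[OF spec[OF Pr]])
    \<comment> \<open>Continuity at the empty set holds in the strongest form. By compactness some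
      \<open>A N\<close> has no point of degree at most \<open>M\<close>, so no root class of a
      finite graph lies in \<open>A i\<close> for any \<open>i\<close> from \<open>N\<close> on, and
      \<open>L (A i)\<close> is exactly 0.\<close>
    have "\<not> (\<forall>i. \<exists>c\<in>A i. max_degree_le M (fst (rep c)))"
      using local_decseq_compact[of A P r M, OF P A(2)] A(3) by blast
    then obtain N where N: "\<And>c. c \<in> A N \<Longrightarrow> \<not> max_degree_le M (fst (rep c))" by blast
    have "L (A i) = 0" if i: "N \<le> i" for i
    proof (rule Lconst)
      fix j v assume v: "v \<in> verts (G j)"
      have "A i \<subseteq> A N" using A(2) i by (simp add: decseq_def)
      then have "root_class (G j) (S j) v \<notin> A i" using N root_class_mem(4)[OF G S v] by blast
      then show "indicator (A i) (root_class (G j) (S j) v) = 0" by simp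
    qed
    then have "eventually (\<lambda>i. ennreal (L (A i)) = 0) sequentially"
      unfolding eventually_sequentially by (intro exI[of _ N]) simp
    then show "(\<lambda>i. ennreal (L (A i))) \<longlonglongrightarrow> 0" by (rule tendsto_eventually)
  qed
  then obtain m :: "mclass set \<Rightarrow> ennreal" where m: "\<And>s. s \<in> \<A> \<Longrightarrow> m s = ennreal (L s)" "measure_space ?\<Omega> (sigma_sets ?\<Omega> \<A>) m"
    by blast
  define \<nu> where "\<nu> = measure_of ?\<Omega> \<A> m"
  have sig: "sets \<nu> = sigma_sets ?\<Omega> \<A>" unfolding \<nu>_def by (rule sets_measure_of[OF space_closed])
  have em: "emeasure \<nu> A = ennreal (L A)" if "A \<in> \<A>" for A
    unfolding m(1)[OF that, symmetric]
    by (rule emeasure_measure_of[OF \<nu>_def space_closed])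
      (use m(2) that in \<open>auto simp: sig measure_space_def intro: sigma_sets.Basic\<close>)
  have sts: "sets \<nu> = sets (local_borel ?\<Omega>)"
    unfolding sig
  proof (rule antisym)
    have "\<A> \<subseteq> sets (local_borel ?\<Omega>)"
    proof
      fix A assume "A \<in> \<A>"
      then obtain P r where P: "A = {c \<in> ?\<Omega>. P c}" "local_at r P" using \<A>E by blast
      show "A \<in> sets (local_borel ?\<Omega>)" unfolding P(1) by (rule local_sets[OF spaces_subset(4) P(2), where P = "\<lambda>a. a"])
    qed
    then show "sigma_sets ?\<Omega> \<A> \<subseteq> sets (local_borel ?\<Omega>)"
      using sets.sigma_sets_subset[of \<A> "local_borel ?\<Omega>"] by simp
    have "cylinders ?\<Omega> \<subseteq> \<A>"
    proof
      fix A assume "A \<in> cylinders ?\<Omega>"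
      then show "A \<in> \<A>"
      proof (cases rule: cylinders_cases)
        case 1 then show ?thesis by simp
      next
        case (2 s t)
        show ?thesis unfolding 2 by (rule \<A>I[OF local_at_comp[OF local_at_ball_type[OF order_refl]]])
      qed
    qed
    then show "sets (local_borel ?\<Omega>) \<subseteq> sigma_sets ?\<Omega> \<A>"
      unfolding sets_local_borel_cylinders[OF spaces_subset(4)] by (rule sigma_sets_mono')
  qed
  have sp: "space \<nu> = ?\<Omega>" using sets_eq_imp_space_eq[OF sts] by simp
  have "L ?\<Omega> = 1" by (rule Lconst) (simp add: ptm)
  then have "emeasure \<nu> (space \<nu>) = 1" unfolding sp using em[OF top] by simp
  then have pr: "prob_space \<nu>" by (rule prob_spaceI)
  have "lim_measure F G S ?\<Omega> \<nu>"
    unfolding lim_measure_def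
  proof (intro conjI allI impI pr sts)
    fix A :: "mclass \<Rightarrow> bool" and r assume A: "local_at r A"
    have "measure \<nu> {c \<in> ?\<Omega>. A c} = L {c \<in> ?\<Omega>. A c}"
      unfolding measure_def em[OF \<A>I[OF A]] by (simp add: L0)
    moreover have "avg (G j) (S j) (indicator {c. A c}) = avg (G j) (S j) (indicator {c \<in> ?\<Omega>. A c})" for j
      by (rule avg_cong) (simp add: indicator_def ptm)
    ultimately show "((\<lambda>j. avg (G j) (S j) (indicator {c. A c})) \<longlongrightarrow> measure \<nu> {c \<in> ?\<Omega>. A c}) F"
      using L[of "{c \<in> ?\<Omega>. A c}"] by simp
  qed
  then show ?thesis using F by blast
qed

end

section \<open>Hyperfinite graphs give a hyperfinite limit\<close>

section \<open>From hyperfinite graphs to hyperfinite measures\<close>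

definition unmark :: "'v mgraph \<Rightarrow> 'v mgraph" where
  "unmark = (\<lambda>(G, S, x, D). (G, {}, x, {}))"

lemma unmark_mgraphs: "g \<in> mgraphs \<Longrightarrow> unmark g \<in> mgraphs"
  by (cases g) (auto simp: unmark_def mgraphs_def)

lemma forget_marks_eq: "forget_marks c = iso_class (unmark (rep c))"
  by (simp add: forget_marks_def unmark_def split: prod.split)

lemma forget_iso_class:
  assumes "g \<in> mgraphs" shows "forget_marks (iso_class g) = iso_class (unmark g)"
proof -
  obtain \<phi> where \<phi>: "inj_on \<phi> (verts (fst g))" "rep (iso_class g) = mg_map \<phi> g" using rep_obtain[OF assms] by blast
  have "unmark (mg_map \<phi> g) = mg_map \<phi> (unmark g)" by (cases g) (simp add: unmark_def mg_map_def)
  moreover have "iso_class (mg_map \<phi> (unmark g)) = iso_class (unmark g)"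
    by (rule iso_class_map[OF unmark_mgraphs[OF assms]]) (use \<phi>(1) in \<open>cases g; simp add: unmark_def\<close>)
  ultimately show ?thesis unfolding forget_marks_eq \<phi>(2) by simp
qed

lemma forget_mem:
  assumes "c \<in> mclasses" shows "forget_marks c \<in> rooted_space" "forget_marks c \<in> mclasses"
proof -
  have m: "unmark (rep c) \<in> mgraphs" by (rule unmark_mgraphs[OF rep_mclass(1)[OF assms]])
  obtain \<phi> where "rep (iso_class (unmark (rep c))) = mg_map \<phi> (unmark (rep c))" using rep_obtain[OF m] by blast
  then show "forget_marks c \<in> rooted_space"
    unfolding rooted_space_iff forget_marks_eq using iso_class_mclasses[OF m]
    by (cases "rep c") (simp add: unmark_def mg_map_def)
  then show "forget_marks c \<in> mclasses" using spaces_subset(1) by blast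
qed

lemma ball_type_forget:
  assumes "c \<in> mclasses" "d \<in> mclasses" "ball_type r c = ball_type r d"
  shows "ball_type r (forget_marks c) = ball_type r (forget_marks d)"
proof -
  obtain \<phi> where p: "piso r \<phi> (rep c) (rep d)" using pisoE[OF assms] by blast
  obtain G S x D where g: "rep c = (G, S, x, D)" by (metis prod_cases4)
  obtain G' S' x' D' where h: "rep d = (G', S', x', D')" by (metis prod_cases4)
  note p = p[unfolded g h]
  have "piso r \<phi> (G, {}, x, {}) (G', {}, \<phi> x, {})"
    by (rule piso_shift(2)[OF p, of x 0 r "{}" "{}" "{}"]) auto
  then have "piso r \<phi> (unmark (rep c)) (unmark (rep d))" using piso_facts(3)[OF p] by (simp add: g h unmark_def)
  then show ?thesis unfolding forget_marks_eq
    using ball_type_eq_iff[OF unmark_mgraphs[OF rep_mclass(1)[OF assms(1)]] unmark_mgraphs[OF rep_mclass(1)[OF assms(2)]]] by blast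
qed

lemma local_forget:
  assumes "local_at r f" shows "local_at r (\<lambda>c. f (forget_marks c))"
  by (rule local_atI0) (intro local_atD[OF assms] forget_mem(2) ball_type_forget)

lemma forget_root_class:
  assumes "G \<in> fin_graphs M" "S \<subseteq> edges G" "v \<in> verts G" shows "forget_marks (root_class G S v) = root_class G {} v"
  unfolding root_class_def forget_iso_class[OF root_class_mem(1)[OF assms]] by (simp add: unmark_def comp_mg_def)

lemma forget_measurable: "forget_marks \<in> measurable (local_borel marked_rooted_space) (local_borel rooted_space)"
  unfolding local_borel_def[of rooted_space]
proof (rule measurable_measure_of)
  show "{U. openin (local_topology rooted_space) U} \<subseteq> Pow rooted_space" by (rule open_subset_Pow) simp
  show "forget_marks \<in> space (local_borel marked_rooted_space) \<rightarrow> rooted_space"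
  proof
    fix c assume "c \<in> space (local_borel marked_rooted_space)"
    then have "c \<in> marked_rooted_space" by simp
    then have "c \<in> mclasses" by (rule subsetD[OF spaces_subset(4)])
    then show "forget_marks c \<in> rooted_space" by (rule forget_mem(1))
  qed
  fix U assume "U \<in> {U. openin (local_topology rooted_space) U}"
  then have U: "U \<subseteq> rooted_space" "\<forall>c\<in>U. \<exists>r. \<forall>d\<in>rooted_space. ball_type r d = ball_type r c \<longrightarrow> d \<in> U"
    using openin_local[OF spaces_subset(1)] by auto
  have "openin (local_topology marked_rooted_space) {c \<in> marked_rooted_space. forget_marks c \<in> U}"
    unfolding openin_local[OF spaces_subset(4)]
  proof (intro conjI ballI)
    fix c assume c: "c \<in> {c \<in> marked_rooted_space. forget_marks c \<in> U}"
    then have cm: "c \<in> mclasses" using spaces_subset(4) by blast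
    obtain r where r: "\<forall>d\<in>rooted_space. ball_type r d = ball_type r (forget_marks c) \<longrightarrow> d \<in> U" using U(2) c by blast
    have "forget_marks d \<in> U" if d: "d \<in> marked_rooted_space" "ball_type r d = ball_type r c" for d
    proof -
      have dm: "d \<in> mclasses" using d(1) spaces_subset(4) by blast
      show ?thesis using r forget_mem(1)[OF dm] ball_type_forget[OF dm cm d(2)] by blast
    qed
    then show "\<exists>r. \<forall>d\<in>marked_rooted_space. ball_type r d = ball_type r c \<longrightarrow> d \<in> {c \<in> marked_rooted_space. forget_marks c \<in> U}"
      by blast
  qed blast
  moreover have "forget_marks -` U \<inter> space (local_borel marked_rooted_space) = {c \<in> marked_rooted_space. forget_marks c \<in> U}"
    by auto
  ultimately show "forget_marks -` U \<inter> space (local_borel marked_rooted_space) \<in> sets (local_borel marked_rooted_space)"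
    unfolding sets_local_borel[OF spaces_subset(4)] by (simp add: sigma_sets.Basic)
qed

lemma measure_eq_cylinders:
  assumes X: "X \<subseteq> mclasses" and \<mu>: "sets \<mu> = sets (local_borel X)" "sets \<nu> = sets (local_borel X)" "finite_measure \<mu>"
    and eq: "\<And>A r. local_at r A \<Longrightarrow> emeasure \<mu> {c \<in> X. A c} = emeasure \<nu> {c \<in> X. A c}"
  shows "\<mu> = \<nu>"
proof (rule measure_eqI_generator_eq_countable[OF Int_stable_cylinders[OF X] cylinders_Pow])
  show "emeasure \<mu> A = emeasure \<nu> A" if "A \<in> cylinders X" for A
    using that
  proof (cases rule: cylinders_cases)
    case (2 s t)
    show ?thesis unfolding 2 by (rule eq[OF local_at_comp[OF local_at_ball_type[OF order_refl]]])
  qed simp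
  show "sets \<mu> = sigma_sets X (cylinders X)" "sets \<nu> = sigma_sets X (cylinders X)"
    unfolding \<mu> sets_local_borel_cylinders[OF X] by simp_all
  show "\<Union>(cylinders X) = X"
  proof (intro equalityI subsetI)
    fix c assume "c \<in> X"
    then show "c \<in> \<Union>(cylinders X)" using cylinders_I[OF X, of c 0] by blast
  qed (use cylinders_Pow in blast)
  show "emeasure \<mu> a \<noteq> \<infinity>" for a using finite_measure.emeasure_finite[OF \<mu>(3)] by simp
qed (auto simp: countable_cylinders)

definition root_marks :: "'v mgraph \<Rightarrow> nat" where
  "root_marks = (\<lambda>(G, S, x, D). card (incident_edges S x))"

lemma root_marks_map:
  assumes "g \<in> mgraphs" "inj_on \<phi> (verts (fst g))" shows "root_marks (mg_map \<phi> g) = root_marks g"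
proof -
  obtain G S x D where g: "g = (G, S, x, D)" by (metis prod_cases4)
  have a: "is_graph G" "x \<in> verts G" "S \<subseteq> edges G" using assms(1) by (auto simp: g mgraphs_def)
  then have "\<forall>e\<in>S. e \<subseteq> verts G" using edges_subset[OF a(1)] by blast
  then show ?thesis using incident_gmap(2)[of \<phi> G S x] assms(2) a by (simp add: g root_marks_def mg_map_def)
qed

lemma ball_1: "is_graph G \<Longrightarrow> e \<in> edges G \<Longrightarrow> x \<in> e \<Longrightarrow> e \<subseteq> ball_verts G x (Suc 0)"
  by (erule (1) edgeE) (auto simp: ball_verts_Suc adj_sym)

lemma root_marks_local: "local_at 1 (\<lambda>c. root_marks (rep c))"
proof (rule local_atI)
  fix g h :: "nat mgraph" and \<phi> assume gh: "g \<in> mgraphs" "h \<in> mgraphs" and p: "piso 1 \<phi> g h"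
  obtain G S x D where g: "g = (G, S, x, D)" by (metis prod_cases4)
  obtain G' S' x' D' where h: "h = (G', S', x', D')" by (metis prod_cases4)
  note p = p[unfolded g h]
  note ff = piso_facts[OF p]
  have m: "is_graph G" "S \<subseteq> edges G" "is_graph G'" "S' \<subseteq> edges G'" using gh by (auto simp: g h mgraphs_def)
  let ?W = "ball_verts G x 1"
  have W: "e \<subseteq> ?W" if "e \<in> incident_edges S x" for e
    using ball_1[OF m(1), of e x] that m(2) by (auto simp: incident_edges_def)
  have W': "e \<subseteq> \<phi> ` ?W" if "e \<in> incident_edges S' x'" for e
    using ball_1[OF m(3), of e x'] that m(4) ff(2) by (auto simp: incident_edges_def)
  have mem: "x' \<in> \<phi> ` e \<longleftrightarrow> x \<in> e" if "e \<subseteq> ?W" for e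
    using inj_on_image_mem_iff[OF ff(1) _ that, of x] ff(3) by simp
  have "incident_edges S' x' = (\<lambda>e. \<phi> ` e) ` incident_edges S x"
  proof (intro equalityI subsetI)
    fix e' assume e': "e' \<in> incident_edges S' x'"
    obtain e where e: "e \<subseteq> ?W" "e' = \<phi> ` e" using W'[OF e'] by (rule subset_imageE)
    then have "e \<in> incident_edges S x" using e' ff(5)[OF e(1)] mem[OF e(1)] by (simp add: incident_edges_def)
    then show "e' \<in> (\<lambda>e. \<phi> ` e) ` incident_edges S x" using e(2) by blast
  next
    fix e' assume "e' \<in> (\<lambda>e. \<phi> ` e) ` incident_edges S x"
    then obtain e where e: "e \<in> incident_edges S x" "e' = \<phi> ` e" by blast
    then show "e' \<in> incident_edges S' x'" using ff(5)[OF W[OF e(1)]] mem[OF W[OF e(1)]] by (simp add: incident_edges_def)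
  qed
  moreover have "inj_on (\<lambda>e. \<phi> ` e) (incident_edges S x)"
    by (rule inj_on_subset[OF inj_on_image_Pow[OF ff(1)]]) (use W in blast)
  ultimately have "card (incident_edges S' x') = card (incident_edges S x)" by (simp add: card_image)
  then show "root_marks g = root_marks h" by (simp add: g h root_marks_def)
qed

lemma root_marks_root_class:
  assumes "G \<in> fin_graphs M" "S \<subseteq> edges G" "v \<in> verts G"
  shows "root_marks (rep (root_class G S v)) = card (incident_edges S v)"
proof -
  note ff = fin_graphsD[OF assms(1)] and m = root_class_mem(1)[OF assms]
  obtain \<phi> where \<phi>: "inj_on \<phi> (verts (fst (comp_mg G S v {})))" "rep (root_class G S v) = mg_map \<phi> (comp_mg G S v {})"
    using rep_obtain[OF m] unfolding root_class_def by blast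
  have "root_marks (rep (root_class G S v)) = root_marks (comp_mg G S v {})"
    unfolding \<phi>(2) by (rule root_marks_map[OF m \<phi>(1)])
  moreover have "incident_edges {e \<in> S. e \<subseteq> comp_verts G v} v = incident_edges S v"
  proof -
    have "e \<subseteq> comp_verts G v" if "e \<in> S" "v \<in> e" for e
      using ball_1[OF ff(1), of e v] that assms(2) ball_subset_comp[of G v "Suc 0"] by blast
    then show ?thesis unfolding incident_edges_def by blast
  qed
  ultimately show ?thesis by (simp add: root_marks_def comp_mg_def)
qed

text \<open>The finite-range form of \<open>components_le\<close>: by \<open>small_comp_iff\<close>
  a component is small as soon as its \<open>k\<close>-ball is, and letting \<open>r\<close> grow
  recovers the condition at every vertex.\<close>

definition small_clusters :: "nat \<Rightarrow> nat \<Rightarrow> 'v mgraph \<Rightarrow> bool" where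
  "small_clusters k r = (\<lambda>(G, S, x, D). \<forall>v\<in>ball_verts G x r. card (ball_verts (delete_edges G S) v k) \<le> k)"

lemma small_clusters_map:
  assumes "g \<in> mgraphs" "inj_on \<phi> (verts (fst g))"
  shows "small_clusters k r (mg_map \<phi> g) \<longleftrightarrow> small_clusters k r g"
proof -
  obtain G S x D where g: "g = (G, S, x, D)" by (metis prod_cases4)
  have a: "is_graph G" "x \<in> verts G" "S \<subseteq> edges G" using assms(1) by (auto simp: g mgraphs_def)
  have i: "inj_on \<phi> (verts G)" using assms(2) by (simp add: g)
  have "card (ball_verts (delete_edges (gmap \<phi> G) ((\<lambda>e. \<phi> ` e) ` S)) (\<phi> v) k) = card (ball_verts (delete_edges G S) v k)"
    if v: "v \<in> ball_verts G x r" for v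
  proof -
    have vV: "v \<in> verts G" using v ball_subset_verts[OF a(1,2)] by blast
    have "ball_verts (delete_edges (gmap \<phi> G) ((\<lambda>e. \<phi> ` e) ` S)) (\<phi> v) k = \<phi> ` ball_verts (delete_edges G S) v k"
      unfolding delete_gmap[OF i a(1,3)] by (rule ball_gmap) (use i a(1) vV is_graph_delete in auto)
    moreover have "inj_on \<phi> (ball_verts (delete_edges G S) v k)"
      by (rule inj_on_subset[OF i order_trans[OF ball_delete_subset ball_subset_verts[OF a(1) vV]]])
    ultimately show ?thesis by (simp add: card_image)
  qed
  then show ?thesis by (simp add: g small_clusters_def mg_map_def ball_gmap[OF i a(1,2)])
qed

lemma small_clusters_local: "local_at (r + k) (\<lambda>c. small_clusters k r (rep c))"
proof (rule local_atI)
  fix g h :: "nat mgraph" and \<phi> assume gh: "g \<in> mgraphs" "h \<in> mgraphs" and p: "piso (r + k) \<phi> g h"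
  obtain G S x D where g: "g = (G, S, x, D)" by (metis prod_cases4)
  obtain G' S' x' D' where h: "h = (G', S', x', D')" by (metis prod_cases4)
  note p = p[unfolded g h]
  note ff = piso_facts[OF p]
  have b: "ball_verts G' x' r = \<phi> ` ball_verts G x r" using piso_ball(2)[OF p, of x 0 r] ff(3) by simp
  have "card (ball_verts (delete_edges G' S') (\<phi> v) k) = card (ball_verts (delete_edges G S) v k)"
    if v: "v \<in> ball_verts G x r" for v
    unfolding piso_ball(3)[OF p v order_refl]
    by (rule card_image[OF inj_on_subset[OF ff(1) order_trans[OF ball_delete_subset piso_ball(4)[OF p v order_refl]]]])
  then show "small_clusters k r g = small_clusters k r h" by (simp add: g h small_clusters_def b)
qed

lemma small_clusters_iff:
  assumes "(G, S, x, D) \<in> mgraphs"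
  shows "(\<forall>r. small_clusters k r (G, S, x, D)) \<longleftrightarrow> components_le k (delete_edges G S)"
proof -
  have V: "verts G = (\<Union>r. ball_verts G x r)"
    using assms by (simp add: comp_verts_ball[symmetric] mgraphs_def connected_graph_def)
  have fin: "finite (ball_verts (delete_edges G S) v k)" if "v \<in> verts G" for v
    by (rule finite_subset[OF ball_delete_subset finite_ball]) (use assms that in \<open>auto simp: mgraphs_def\<close>)
  have "(\<forall>r. small_clusters k r (G, S, x, D)) \<longleftrightarrow> (\<forall>v\<in>verts G. card (ball_verts (delete_edges G S) v k) \<le> k)"
    unfolding V by (auto simp: small_clusters_def)
  also have "\<dots> \<longleftrightarrow> components_le k (delete_edges G S)"
    unfolding components_le_def small_comp_iff using fin by simp
  finally show ?thesis .
qed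

lemma small_clusters_root_class:
  assumes "G \<in> fin_graphs M" "S \<subseteq> edges G" "v \<in> verts G" "components_le k (delete_edges G S)"
  shows "small_clusters k r (rep (root_class G S v))"
proof -
  note ff = fin_graphsD[OF assms(1)] and m = root_class_mem(1)[OF assms(1-3)]
  obtain \<phi> where \<phi>: "inj_on \<phi> (verts (fst (comp_mg G S v {})))" "rep (root_class G S v) = mg_map \<phi> (comp_mg G S v {})"
    using rep_obtain[OF m] unfolding root_class_def by blast
  have "card (ball_verts (delete_edges (component G v) {e \<in> S. e \<subseteq> comp_verts G v}) u k) \<le> k"
    if "u \<in> ball_verts (component G v) v r" for u
  proof -
    have u: "u \<in> comp_verts G v"
      using that ball_subset_comp[of G v r] unfolding ball_component[OF self_in_comp] by blast
    then have "u \<in> verts G" using comp_subset_verts[OF ff(1) assms(3)] by blast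
    then have "card (ball_verts (delete_edges G S) u k) \<le> k"
      using assms(4) unfolding components_le_def small_comp_iff by simp
    then show ?thesis unfolding ball_delete_component[OF u] .
  qed
  then have "small_clusters k r (comp_mg G S v {})" by (simp add: small_clusters_def comp_mg_def)
  then show ?thesis unfolding \<phi>(2) small_clusters_map[OF m \<phi>(1)] .
qed

text \<open>Handshaking: each marked edge is counted at its two ends, which is the origin of the
  factor 2 in the cost of a hyperfinite measure.\<close>

lemma sum_incident:
  assumes "G \<in> fin_graphs M" "S \<subseteq> edges G"
  shows "(\<Sum>v\<in>verts G. card (incident_edges S v)) = 2 * card S"
proof -
  note ff = fin_graphsD[OF assms(1)]
  have fE: "finite (edges G)" by (rule finite_subset[of _ "Pow (verts G)"]) (use ff edges_subset in auto)
  then have fS: "finite S" using assms(2) finite_subset by blast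
  have "(\<Sum>v\<in>verts G. card (incident_edges S v)) = (\<Sum>v\<in>verts G. \<Sum>e\<in>{e \<in> S. v \<in> e}. 1)"
    by (simp add: incident_edges_def)
  also have "\<dots> = (\<Sum>e\<in>S. \<Sum>v\<in>{v \<in> verts G. v \<in> e}. 1)" by (rule sum.swap_restrict[OF ff(2) fS])
  also have "\<dots> = (\<Sum>e\<in>S. 2)"
  proof (rule sum.cong[OF refl])
    fix e assume "e \<in> S"
    then obtain u v where uv: "u \<in> verts G" "v \<in> verts G" "u \<noteq> v" "e = {u, v}"
      using assms(2) ff(1) edgeE by (metis subsetD)
    then have "{v \<in> verts G. v \<in> e} = {u, v}" by blast
    then show "(\<Sum>v\<in>{v \<in> verts G. v \<in> e}. 1) = 2" using uv(3) by simp
  qed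
  finally show ?thesis by simp
qed

theorem hyperfinite_measure_if_graphs:
  fixes G :: "nat \<Rightarrow> 'v ugraph"
  assumes G: "\<And>j. G j \<in> fin_graphs M" and \<mu>: "\<mu> \<in> prob_measures (rooted_space_deg M)"
    and w: "weakly_converges (rooted_space_deg M) (\<lambda>j. Psi M (G j)) \<mu>"
    and hyp: "hyperfinite_graphs (range G)"
  shows "hyperfinite_measure (extend_measure_to_rooted \<mu>)"
  unfolding hyperfinite_measure_def
proof (intro allI impI)
  fix \<epsilon> :: real assume \<epsilon>: "\<epsilon> > 0"
  obtain k where k: "k > 0" "hyperfinite_graphs_at k \<epsilon> (range G)" using hyp \<epsilon> unfolding hyperfinite_graphs_def by blast
  have "\<forall>j. \<exists>S. S \<subseteq> edges (G j) \<and> real (card S) \<le> \<epsilon> * real (card (verts (G j))) \<and> components_le k (delete_edges (G j) S)"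
    using k(2) unfolding hyperfinite_graphs_at_def by blast
  then obtain S where hS: "\<And>j. S j \<subseteq> edges (G j)" "\<And>j. real (card (S j)) \<le> \<epsilon> * real (card (verts (G j)))"
    "\<And>j. components_le k (delete_edges (G j) (S j))" by metis
  interpret finite_graph_seq M G S by unfold_locales (fact G, fact hS(1))
  interpret E: finite_graph_seq M G "\<lambda>_. {}" by unfold_locales (fact G, simp)
  let ?\<mu> = "extend_measure_to_rooted \<mu>"
  note L\<mu> = lim_measure_extend[OF G w \<mu>]
  obtain F \<nu> where F: "F \<noteq> bot" "F \<le> sequentially" and L: "lim_measure F G S marked_rooted_space \<nu>"
    using exists_lim_measure by blast
  have p: "prob_space \<nu>" "sets \<nu> = sets (local_borel marked_rooted_space)" using L by (auto simp: lim_measure_def)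
  have p\<mu>: "prob_space ?\<mu>" "sets ?\<mu> = sets (local_borel rooted_space)" using L\<mu> by (auto simp: lim_measure_def)
  have sp: "space \<nu> = marked_rooted_space" using sets_eq_imp_space_eq[OF p(2)] by simp
  interpret p: prob_space \<nu> by (rule p(1))
  have mt\<mu>: "mass_transport birooted_space ?\<mu>"
    by (rule E.lim_measure_mass_transport[OF L\<mu> spaces_subset(1,3) sequentially_bot]) (rule two_pt_rooted)
  have mt\<nu>: "mass_transport marked_birooted_space \<nu>"
    by (rule lim_measure_mass_transport[OF L spaces_subset(4,5) F(1)]) (rule two_pt_marked_rooted)
  have u\<mu>: "?\<mu> \<in> unimodular"
    unfolding unimodular_def prob_measures_def
    using p\<mu> mt\<mu> by simp
  have u\<nu>: "\<nu> \<in> unimodular_marked"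
    unfolding unimodular_marked_def prob_measures_def
    using p mt\<nu> by simp
  have fm: "forget_marks \<in> measurable \<nu> (local_borel rooted_space)"
    using forget_measurable measurable_cong_sets[OF p(2) refl] by blast
  \<comment> \<open>Forgetting the marks of a finite graph returns its unmarked root class, so both
    measures are limits along \<open>F\<close> of the same averages; \<open>F\<close> refines
    \<open>sequentially\<close>, where the convergence to \<open>\<mu>\<close> is given.\<close>
  have "?\<mu> = distr \<nu> (local_borel rooted_space) forget_marks"
  proof (rule measure_eq_cylinders[OF spaces_subset(1) p\<mu>(2)])
    show "finite_measure ?\<mu>" using p\<mu>(1) by (rule prob_space.finite_measure)
    fix A :: "mclass \<Rightarrow> bool" and r assume A: "local_at r A"
    have mA: "{c \<in> rooted_space. A c} \<in> sets (local_borel rooted_space)"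
      by (rule local_sets[OF spaces_subset(1) A, where P = "\<lambda>a. a"])
    have pre: "forget_marks -` {c \<in> rooted_space. A c} \<inter> space \<nu> = {c \<in> marked_rooted_space. A (forget_marks c)}"
      unfolding sp using forget_mem(1) spaces_subset(4) by blast
    have "((\<lambda>j. avg (G j) {} (indicator {c. A c})) \<longlongrightarrow> measure ?\<mu> {c \<in> rooted_space. A c}) F"
      using L\<mu> A tendsto_mono[OF F(2)] unfolding lim_measure_def by blast
    moreover have "((\<lambda>j. avg (G j) (S j) (indicator {c. A (forget_marks c)})) \<longlongrightarrow>
        measure \<nu> {c \<in> marked_rooted_space. A (forget_marks c)}) F"
      using L local_forget[OF A] unfolding lim_measure_def by blast
    moreover have "avg (G j) (S j) (indicator {c. A (forget_marks c)}) = avg (G j) {} (indicator {c. A c})" for j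
      by (rule avg_cong) (simp add: indicator_def forget_root_class[OF G hS(1)])
    ultimately have "measure ?\<mu> {c \<in> rooted_space. A c} = measure \<nu> {c \<in> marked_rooted_space. A (forget_marks c)}"
      using tendsto_unique[OF F(1)] by simp
    then show "emeasure ?\<mu> {c \<in> rooted_space. A c} = emeasure (distr \<nu> (local_borel rooted_space) forget_marks) {c \<in> rooted_space. A c}"
      unfolding emeasure_distr[OF fm mA] pre p.emeasure_eq_measure
        finite_measure.emeasure_eq_measure[OF prob_space.finite_measure[OF p\<mu>(1)]] by simp
  qed simp
  then have proj: "distr \<nu> (local_borel rooted_space) forget_marks = ?\<mu>" ..
  \<comment> \<open>Having only small components is not a local event; it is the intersection of
    countably many local ones, each of probability 1.\<close>
  have "AE c in \<nu>. \<forall>r. small_clusters k r (rep c)"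
    unfolding AE_all_countable
    by (intro allI lim_measure_AE[OF L spaces_subset(4) F(1) small_clusters_local] small_clusters_root_class[OF G hS(1) _ hS(3)])
  then have ae: "AE c in \<nu>. case rep c of (G, S, x, D) \<Rightarrow> components_le k (delete_edges G S)"
    using AE_space
  proof eventually_elim
    case (elim c)
    then have cm: "c \<in> mclasses" unfolding sp using spaces_subset(4) by blast
    obtain H T x D where g: "rep c = (H, T, x, D)" by (metis prod_cases4)
    have "(H, T, x, D) \<in> mgraphs" using rep_mclass(1)[OF cm] g by simp
    then show ?case using small_clusters_iff[of H T x D k] elim(1) by (simp add: g)
  qed
  have bd: "root_marks (rep (root_class (G j) (S j) v)) \<le> M" if v: "v \<in> verts (G j)" for j v
  proof -
    note ff = fin_graphsD[OF G[of j]]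
    have "card (incident_edges (S j) v) \<le> card (incident_edges (edges (G j)) v)"
      by (rule card_mono) (use ff(5) v hS(1) in \<open>auto simp: locally_finite_def incident_edges_def\<close>)
    also have "\<dots> \<le> M" using ff(4) v by (simp add: max_degree_le_def)
    finally show ?thesis unfolding root_marks_root_class[OF G hS(1) v] .
  qed
  obtain l where l: "(\<integral>\<^sup>+c. of_nat (root_marks (rep c)) \<partial>\<nu>) = ennreal l"
      "((\<lambda>j. avg (G j) (S j) (\<lambda>c. real (root_marks (rep c)))) \<longlongrightarrow> l) F"
    using lim_measure_nat[OF L spaces_subset(4) F(1) root_marks_local bd] by blast
  have "avg (G j) (S j) (\<lambda>c. real (root_marks (rep c))) \<le> 2 * \<epsilon>" for j
  proof -
    have "(\<Sum>v\<in>verts (G j). real (root_marks (rep (root_class (G j) (S j) v)))) = real (2 * card (S j))"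
      unfolding sum_incident[OF G hS(1), symmetric] of_nat_sum
      by (rule sum.cong[OF refl]) (simp add: root_marks_root_class[OF G hS(1)])
    then show ?thesis unfolding avg_def using hS(2)[of j] fin_graphsD(6)[OF G, of j] by (simp add: field_simps)
  qed
  \<comment> \<open>Every average equals twice the number of marked edges per vertex, hence is at
    most \<open>2 * \<epsilon>\<close>.\<close>
  then have "l \<le> 2 * \<epsilon>" by (intro tendsto_upperbound[OF l(2) _ F(1)]) simp
  then have "(\<integral>\<^sup>+c. of_nat (root_marks (rep c)) \<partial>\<nu>) \<le> ennreal (2 * \<epsilon>)" unfolding l(1) by (rule ennreal_leI)
  moreover have "of_nat (root_marks (rep c)) = (case rep c of (G, S, x, D) \<Rightarrow> (of_nat (card (incident_edges S x)) :: ennreal))" for c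
    by (simp add: root_marks_def split: prod.split)
  ultimately have cost: "(\<integral>\<^sup>+c. (case rep c of (G, S, x, D) \<Rightarrow> of_nat (card (incident_edges S x))) \<partial>\<nu>) \<le> ennreal (2 * \<epsilon>)"
    by simp
  have "hyperfinite_measure_at k \<epsilon> ?\<mu>"
    unfolding hyperfinite_measure_at_def using u\<mu> u\<nu> proj ae cost by blast
  then show "\<exists>k>0. hyperfinite_measure_at k \<epsilon> ?\<mu>" using k(1) by blast
qed

section \<open>Rounding a fractional cover to a partition\<close>

section \<open>Greedy partitions of finite graphs\<close>

definition bdry :: "'v ugraph \<Rightarrow> 'v set \<Rightarrow> 'v set set" where
  "bdry G D = {e \<in> edges G. e \<inter> D \<noteq> {} \<and> \<not> e \<subseteq> D}"

lemma fin_graphs_finite_edges: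
  assumes "G \<in> fin_graphs M" shows "finite (edges G)"
proof (rule finite_subset)
  show "edges G \<subseteq> Pow (verts G)" using edges_subset[OF fin_graphsD(1)[OF assms]] by blast
  show "finite (Pow (verts G))" using fin_graphsD(2)[OF assms] by simp
qed

text \<open>The boundary of a chosen set is charged to the vertices it newly covers, so these costs
  sum to at most \<open>c\<close> per vertex. Once at most \<open>m\<close> vertices are left,
  isolating them removes at most \<open>M\<close> edges each.\<close>

lemma greedy_partition:
  fixes c m :: real
  assumes G: "G \<in> fin_graphs M" and L: "L \<ge> 1" and c: "c \<ge> 0"
    and choose: "\<And>U. U \<subseteq> verts G \<Longrightarrow> real (card U) > m \<Longrightarrow>
      \<exists>D. finite D \<and> card D \<le> L \<and> D \<inter> U \<noteq> {} \<and> real (card (bdry G D)) \<le> c * real (card (D \<inter> U))"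
    and U: "U \<subseteq> verts G"
  shows "\<exists>S P. S \<subseteq> edges G \<and> real (card S) \<le> c * real (card U) + M * m \<and>
    (\<forall>v\<in>U. v \<in> P v \<and> finite (P v) \<and> card (P v) \<le> L) \<and>
    (\<forall>u\<in>U. \<forall>v\<in>U. {u, v} \<in> edges G - S \<longrightarrow> P u = P v)"
  using U
proof (induction "card U" arbitrary: U rule: less_induct)
  case less
  note ff = fin_graphsD[OF G]
  have fU: "finite U" using less.prems ff(2) finite_subset by blast
  show ?case
  proof (cases "real (card U) > m")
    case False
    let ?S = "\<Union>u\<in>U. incident_edges (edges G) u"
    have "card ?S \<le> (\<Sum>u\<in>U. card (incident_edges (edges G) u))" by (rule card_UN_le[OF fU])
    also have "\<dots> \<le> (\<Sum>u\<in>U. M)" using less.prems ff(4) by (intro sum_mono) (auto simp: max_degree_le_def)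
    finally have "card ?S \<le> card U * M" by simp
    then have "real (card ?S) \<le> real (card U) * M" by (metis of_nat_le_iff of_nat_mult)
    also have "\<dots> \<le> m * M" using False by (intro mult_right_mono) auto
    also have "\<dots> \<le> c * real (card U) + M * m" using c by simp
    finally have 1: "real (card ?S) \<le> c * real (card U) + M * m" .
    show ?thesis
    proof (intro exI[of _ ?S] exI[of _ "\<lambda>v. {v}"] conjI 1)
      show "?S \<subseteq> edges G" by (auto simp: incident_edges_def)
      show "\<forall>v\<in>U. v \<in> {v} \<and> finite {v} \<and> card {v} \<le> L" using L by simp
      show "\<forall>u\<in>U. \<forall>v\<in>U. {u, v} \<in> edges G - ?S \<longrightarrow> {u} = {v}" by (auto simp: incident_edges_def)
    qed
  next
    case True
    obtain D where D: "finite D" "card D \<le> L" "D \<inter> U \<noteq> {}" "real (card (bdry G D)) \<le> c * real (card (D \<inter> U))"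
      using choose[OF less.prems True] by blast
    have cU: "card U = card (U - D) + card (D \<inter> U)"
      using card_Un_disjoint[of "U - D" "D \<inter> U"] fU by (metis Diff_disjoint Int_Diff_Un Int_assoc Int_commute Un_commute finite_Diff finite_Int inf_bot_right)
    have lt: "card (U - D) < card U" using D(3) fU cU card_gt_0_iff[of "D \<inter> U"] by auto
    have sub: "U - D \<subseteq> verts G" using less.prems by blast
    obtain S P where S: "S \<subseteq> edges G" "real (card S) \<le> c * real (card (U - D)) + M * m"
      and P: "\<forall>v\<in>U - D. v \<in> P v \<and> finite (P v) \<and> card (P v) \<le> L"
        "\<forall>u\<in>U - D. \<forall>v\<in>U - D. {u, v} \<in> edges G - S \<longrightarrow> P u = P v"
      using less.hyps[OF lt sub] by blast
    \<comment> \<open>\<open>D\<close> may reach beyond \<open>U\<close>, so blocks may overlap as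
      sets. It is enough that \<open>?P\<close> is constant along the remaining edges within
      \<open>U\<close> and that each block contains its vertex.\<close>
    let ?S = "S \<union> bdry G D" and ?P = "\<lambda>v. if v \<in> D then D else P v"
    have "real (card ?S) \<le> real (card S) + real (card (bdry G D))"
      using card_Un_le[of S "bdry G D"] by (metis of_nat_add of_nat_le_iff)
    also have "\<dots> \<le> c * real (card (U - D)) + M * m + c * real (card (D \<inter> U))" using S(2) D(4) by simp
    also have "\<dots> = c * real (card U) + M * m" unfolding cU by (simp add: algebra_simps)
    finally have 1: "real (card ?S) \<le> c * real (card U) + M * m" .
    show ?thesis
    proof (intro exI[of _ ?S] exI[of _ ?P] conjI 1)
      show "?S \<subseteq> edges G" using S(1) by (auto simp: bdry_def)
      show "\<forall>v\<in>U. v \<in> ?P v \<and> finite (?P v) \<and> card (?P v) \<le> L" using P(1) D(1,2) by simp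
      show "\<forall>u\<in>U. \<forall>v\<in>U. {u, v} \<in> edges G - ?S \<longrightarrow> ?P u = ?P v"
      proof (intro ballI impI)
        fix u v assume uv: "u \<in> U" "v \<in> U" "{u, v} \<in> edges G - ?S"
        then have "u \<in> D \<longleftrightarrow> v \<in> D" by (auto simp: bdry_def)
        moreover have "P u = P v" if "u \<notin> D" "v \<notin> D" using P(2) uv that by blast
        ultimately show "?P u = ?P v" by auto
      qed
    qed
  qed
qed

text \<open>The block is constant along remaining edges, hence on each component, so the component
  lies inside the block of any of its vertices.\<close>

lemma components_from_blocks:
  assumes "is_graph G" "\<forall>v\<in>verts G. v \<in> P v \<and> finite (P v) \<and> card (P v) \<le> L"
    and "\<forall>u\<in>verts G. \<forall>v\<in>verts G. {u, v} \<in> edges G - S \<longrightarrow> P u = P v"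
  shows "components_le L (delete_edges G S)"
  unfolding components_le_def
proof
  fix v assume "v \<in> verts (delete_edges G S)"
  then have v: "v \<in> verts G" by simp
  have "comp_verts (delete_edges G S) v \<subseteq> P v"
  proof
    fix u assume u: "u \<in> comp_verts (delete_edges G S) v"
    have "u \<in> {u \<in> verts G. P u = P v}"
    proof (rule comp_inv[OF u])
      fix a b assume a: "a \<in> {u \<in> verts G. P u = P v}" and ab: "adj (delete_edges G S) a b"
      have "a \<in> verts G" "b \<in> verts G" using adj_verts[OF is_graph_delete[OF assms(1)] ab] by simp_all
      moreover have "{a, b} \<in> edges G - S" using ab by (simp add: adj_def)
      ultimately have "b \<in> verts G" "P a = P b" using assms(3) by blast+
      then show "b \<in> {u \<in> verts G. P u = P v}" using a by simp
    qed (use v in simp)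
    then show "u \<in> P v" using assms(2) by auto
  qed
  then show "finite (comp_verts (delete_edges G S) v) \<and> card (comp_verts (delete_edges G S) v) \<le> L"
    using assms(2) v by (meson card_mono finite_subset le_trans)
qed

text \<open>A fractional cover of cheap sets, covering most vertices at least half, always contains a
  set that is cheap relative to the number of not yet covered vertices it contains.\<close>

lemma fractional_to_integral:
  fixes a t :: real
  assumes G: "G \<in> fin_graphs M" and L: "L \<ge> 1" and a: "a > 0" and t: "t > 0"
    and F: "finite \<F>" "\<And>D. D \<in> \<F> \<Longrightarrow> D \<subseteq> verts G \<and> card D \<le> L" and W: "\<And>D. D \<in> \<F> \<Longrightarrow> W D \<ge> (0 :: real)"
    and cost: "(\<Sum>D\<in>\<F>. W D * real (card (bdry G D))) \<le> a * card (verts G)"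
    and cover: "real (card {v \<in> verts G. (\<Sum>D\<in>{D \<in> \<F>. v \<in> D}. W D) < 1 / 2}) \<le> t / 2 * card (verts G)"
  shows "\<exists>S. S \<subseteq> edges G \<and> real (card S) \<le> (4 * a / t + M * t) * card (verts G) \<and> components_le L (delete_edges G S)"
proof -
  note ff = fin_graphsD[OF G]
  let ?n = "real (card (verts G))"
  \<comment> \<open>A set of more than \<open>t * ?n\<close> vertices has total coverage above
    \<open>t * ?n / 4\<close> (half of its vertices, each covered at least 1/2), against a total
    cost of at most \<open>a * ?n\<close>; the ratio is \<open>4 * a / t\<close>.\<close>
  let ?c = "4 * a / t"
  let ?s = "\<lambda>v. \<Sum>D\<in>{D \<in> \<F>. v \<in> D}. W D"
  have "\<exists>D. finite D \<and> card D \<le> L \<and> D \<inter> U \<noteq> {} \<and> real (card (bdry G D)) \<le> ?c * real (card (D \<inter> U))"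
    if U: "U \<subseteq> verts G" and big: "real (card U) > t * ?n" for U
  proof -
    have fU: "finite U" using U ff(2) finite_subset by blast
    let ?B = "{v \<in> verts G. ?s v < 1 / 2}"
    have s0: "0 \<le> ?s v" for v using W by (intro sum_nonneg) auto
    have fB: "finite ?B" using ff(2) by simp
    have "real (card U) \<le> real (card (U - ?B)) + real (card ?B)"
      using card_Un_le[of "U - ?B" ?B] card_mono[of "(U - ?B) \<union> ?B" U] fU fB
      by (metis (no_types, lifting) Un_Diff_cancel2 finite_Diff finite_UnI le_trans of_nat_add of_nat_le_iff sup_ge1)
    \<comment> \<open>There are at most \<open>t * ?n / 2\<close> badly covered vertices, less than
      half of \<open>U\<close>.\<close>
    then have half: "real (card U) / 2 \<le> real (card (U - ?B))" using cover big by linarith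
    have "real (card U) / 4 \<le> (\<Sum>v\<in>U - ?B. 1 / 2 :: real)" using half by simp
    also have "\<dots> \<le> (\<Sum>v\<in>U - ?B. ?s v)" using U by (intro sum_mono) force
    also have "\<dots> \<le> (\<Sum>v\<in>U. ?s v)" by (rule sum_mono2[OF fU]) (use s0 in auto)
    also have "\<dots> = (\<Sum>D\<in>\<F>. \<Sum>v\<in>{v \<in> U. v \<in> D}. W D)" by (rule sum.swap_restrict[OF fU F(1)])
    also have "\<dots> = (\<Sum>D\<in>\<F>. W D * real (card (D \<inter> U)))"
      by (rule sum.cong[OF refl]) (simp add: Int_def conj_commute)
    finally have cov: "real (card U) / 4 \<le> (\<Sum>D\<in>\<F>. W D * real (card (D \<inter> U)))" .
    \<comment> \<open>Averaging: if every set were too expensive for the vertices it covers in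
      \<open>U\<close>, the weighted sum would exceed the total cost.\<close>
    have "\<exists>D\<in>\<F>. real (card (bdry G D)) < ?c * real (card (D \<inter> U))"
    proof (rule ccontr)
      assume "\<not> ?thesis"
      then have "(\<Sum>D\<in>\<F>. W D * (?c * real (card (D \<inter> U)))) \<le> (\<Sum>D\<in>\<F>. W D * real (card (bdry G D)))"
        using W by (intro sum_mono mult_left_mono) (auto simp: not_less)
      moreover have "(\<Sum>D\<in>\<F>. W D * (?c * real (card (D \<inter> U)))) = ?c * (\<Sum>D\<in>\<F>. W D * real (card (D \<inter> U)))"
        by (simp add: sum_distrib_left mult_ac)
      ultimately have "?c * (\<Sum>D\<in>\<F>. W D * real (card (D \<inter> U))) \<le> a * ?n" using cost by simp
      moreover have "?c * (real (card U) / 4) \<le> ?c * (\<Sum>D\<in>\<F>. W D * real (card (D \<inter> U)))"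
        using cov a t by (intro mult_left_mono) auto
      moreover have "?c * (t * ?n / 4) < ?c * (real (card U) / 4)"
        using big a t by (intro mult_strict_left_mono) auto
      moreover have "?c * (t * ?n / 4) = a * ?n" using t by simp
      ultimately show False by linarith
    qed
    then obtain D where D: "D \<in> \<F>" "real (card (bdry G D)) < ?c * real (card (D \<inter> U))" by blast
    have "D \<inter> U \<noteq> {}" using D(2) by (cases "D \<inter> U = {}") auto
    moreover have "finite D" using F(2)[OF D(1)] ff(2) finite_subset by blast
    ultimately show ?thesis using F(2)[OF D(1)] D(2) by (intro exI[of _ D]) auto
  qed
  then obtain S P where S: "S \<subseteq> edges G" "real (card S) \<le> ?c * ?n + M * (t * ?n)"
    and P: "\<forall>v\<in>verts G. v \<in> P v \<and> finite (P v) \<and> card (P v) \<le> L"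
      "\<forall>u\<in>verts G. \<forall>v\<in>verts G. {u, v} \<in> edges G - S \<longrightarrow> P u = P v"
    using greedy_partition[OF G L, of ?c "t * ?n" "verts G"] a t by auto
  show ?thesis
    by (intro exI[of _ S] conjI S(1) components_from_blocks[OF ff(1) P]) (use S(2) in \<open>simp add: algebra_simps\<close>)
qed

section \<open>Candidate clusters and their local statistics\<close>

section \<open>Close vertex sets\<close>

text \<open>The candidates for the component of the root, described by distances in the graph itself
  and so without reference to marks. The condition is symmetric in the members, hence a property of
  \<open>D\<close> alone, and components with at most \<open>k\<close> vertices satisfy it.\<close>

definition close_sets :: "nat \<Rightarrow> 'v ugraph \<Rightarrow> 'v \<Rightarrow> 'v set set" where
  "close_sets k G x = {D. x \<in> D \<and> (\<forall>u\<in>D. \<forall>v\<in>D. v \<in> ball_verts G u k)}"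

lemma close_sets_ball: "D \<in> close_sets k G x \<Longrightarrow> D \<subseteq> ball_verts G x k"
  by (auto simp: close_sets_def)

lemma close_sets_root: "D \<in> close_sets k G x \<Longrightarrow> y \<in> D \<Longrightarrow> D \<in> close_sets k G y"
  by (auto simp: close_sets_def)

lemma close_sets_Pow: "close_sets k G x \<subseteq> Pow (ball_verts G x k)"
  by (rule subsetI, rule PowI, rule close_sets_ball)

lemma close_sets_transport:
  assumes inj: "inj_on \<phi> W" and W: "ball_verts G x k \<subseteq> W"
    and b: "ball_verts G' (\<phi> x) k = \<phi> ` ball_verts G x k"
    and bu: "\<forall>u\<in>ball_verts G x k. ball_verts G' (\<phi> u) k = \<phi> ` ball_verts G u k \<and> ball_verts G u k \<subseteq> W"
  shows "\<And>D. D \<subseteq> ball_verts G x k \<Longrightarrow> \<phi> ` D \<in> close_sets k G' (\<phi> x) \<longleftrightarrow> D \<in> close_sets k G x"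
    "close_sets k G' (\<phi> x) = (\<lambda>D. \<phi> ` D) ` close_sets k G x" "inj_on (\<lambda>D. \<phi> ` D) (close_sets k G x)"
proof -
  show 1: "\<phi> ` D \<in> close_sets k G' (\<phi> x) \<longleftrightarrow> D \<in> close_sets k G x" if D: "D \<subseteq> ball_verts G x k" for D
  proof -
    have DW: "D \<subseteq> W" using D W by blast
    have xW: "x \<in> W" using W center_in_ball by fast
    have x: "\<phi> x \<in> \<phi> ` D \<longleftrightarrow> x \<in> D" by (rule inj_on_image_mem_iff[OF inj xW DW])
    have "\<phi> v \<in> ball_verts G' (\<phi> u) k \<longleftrightarrow> v \<in> ball_verts G u k" if "u \<in> D" "v \<in> D" for u v
    proof -
      have u: "u \<in> ball_verts G x k" "v \<in> W" using that D DW by blast+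
      show ?thesis using bspec[OF bu u(1)] inj_on_image_mem_iff[OF inj u(2), of "ball_verts G u k"] by simp
    qed
    then show ?thesis using x by (simp add: close_sets_def)
  qed
  show "close_sets k G' (\<phi> x) = (\<lambda>D. \<phi> ` D) ` close_sets k G x"
  proof (intro equalityI subsetI)
    fix D' assume D': "D' \<in> close_sets k G' (\<phi> x)"
    then have "D' \<subseteq> \<phi> ` ball_verts G x k" using close_sets_ball[OF D'] b by simp
    then obtain D where D: "D \<subseteq> ball_verts G x k" "D' = \<phi> ` D" by (rule subset_imageE)
    then have "D \<in> close_sets k G x" using 1[OF D(1)] D' by simp
    then show "D' \<in> (\<lambda>D. \<phi> ` D) ` close_sets k G x" using D(2) by blast
  next
    fix D' assume "D' \<in> (\<lambda>D. \<phi> ` D) ` close_sets k G x"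
    then obtain D where D: "D \<in> close_sets k G x" "D' = \<phi> ` D" by blast
    then show "D' \<in> close_sets k G' (\<phi> x)" using 1[OF close_sets_ball[OF D(1)]] by simp
  qed
  show "inj_on (\<lambda>D. \<phi> ` D) (close_sets k G x)"
    by (rule inj_on_subset[OF inj_on_image_Pow[OF inj] order_trans[OF close_sets_Pow Pow_mono[OF W]]])
qed

text \<open>Radius \<open>2 * k\<close>, because the balls of radius \<open>k\<close> around members
  of the \<open>k\<close>-ball have to be compared.\<close>

lemma piso_close_sets:
  assumes p: "piso R \<phi> (G, S, x, E) (G', S', x', E')" and R: "2 * k \<le> R"
  shows "\<And>D. D \<subseteq> ball_verts G x k \<Longrightarrow> \<phi> ` D \<in> close_sets k G' x' \<longleftrightarrow> D \<in> close_sets k G x"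
    "close_sets k G' x' = (\<lambda>D. \<phi> ` D) ` close_sets k G x" "inj_on (\<lambda>D. \<phi> ` D) (close_sets k G x)"
proof -
  note f = piso_facts[OF p]
  have W: "ball_verts G x k \<subseteq> ball_verts G x R" by (rule ball_verts_mono) (use R in simp)
  have b: "ball_verts G' (\<phi> x) k = \<phi> ` ball_verts G x k" by (rule piso_ball(2)[OF p, of x 0 k]) (use R in auto)
  have bu: "\<forall>u\<in>ball_verts G x k. ball_verts G' (\<phi> u) k = \<phi> ` ball_verts G u k \<and> ball_verts G u k \<subseteq> ball_verts G x R"
  proof
    fix u assume "u \<in> ball_verts G x k"
    from piso_ball(2,4)[OF p this, of k] show "ball_verts G' (\<phi> u) k = \<phi> ` ball_verts G u k \<and> ball_verts G u k \<subseteq> ball_verts G x R"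
      using R by simp
  qed
  note t = close_sets_transport[OF f(1) W b bu]
  show "\<phi> ` D \<in> close_sets k G' x' \<longleftrightarrow> D \<in> close_sets k G x" if "D \<subseteq> ball_verts G x k" for D using t(1)[OF that] f(3) by simp
  show "close_sets k G' x' = (\<lambda>D. \<phi> ` D) ` close_sets k G x" using t(2) f(3) by simp
  show "inj_on (\<lambda>D. \<phi> ` D) (close_sets k G x)" by (rule t(3))
qed

lemma piso_rep:
  assumes "g \<in> mgraphs" shows "\<exists>\<phi>. piso r \<phi> g (rep (iso_class g))"
proof -
  have "ball_type r (iso_class g) = ball_type r (iso_class (rep (iso_class g)))"
    using iso_class_cong[OF assms rep_iso_class(2)[OF assms]] by simp
  then show ?thesis using ball_type_eq_iff[OF assms rep_iso_class(1)[OF assms]] by blast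
qed

lemma local_piso:
  assumes w: "local_at s w" and p: "piso s \<phi> g h" and gh: "g \<in> mgraphs" "h \<in> mgraphs"
  shows "w (iso_class g) = w (iso_class h)"
  by (rule local_atD[OF w iso_class_mclasses[OF gh(1)] iso_class_mclasses[OF gh(2)]])
    (use ball_type_eq_iff[OF gh] p in blast)

lemma mgraphs_change:
  "(G, S, x, D) \<in> mgraphs \<Longrightarrow> y \<in> verts G \<Longrightarrow> E \<subseteq> verts G \<Longrightarrow> (G, {}, y, E) \<in> mgraphs"
  "(G, S, x, D) \<in> mgraphs \<Longrightarrow> y \<in> verts G \<Longrightarrow> E \<subseteq> verts G \<Longrightarrow> (G, S, y, E) \<in> mgraphs"
  by (auto simp: mgraphs_def)

lemma mgraphs_ball: "(G, S, x, D) \<in> mgraphs \<Longrightarrow> ball_verts G x k \<subseteq> verts G"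
  by (rule ball_subset_verts) (auto simp: mgraphs_def)

text \<open>Distance \<open>t\<close> to reach the new root plus the range \<open>s\<close> of
  \<open>w\<close> must fit into the known ball.\<close>

lemma local_piso_shift:
  assumes w: "local_at s w" and p: "piso R \<phi> (G, S, x, D) (G', S', x', D')"
    and m: "(G, S, x, D) \<in> mgraphs" "(G', S', x', D') \<in> mgraphs"
    and y: "y \<in> ball_verts G x t" and R: "t + s \<le> R" and E: "E \<subseteq> ball_verts G x R"
  shows "w (iso_class (G', {}, \<phi> y, \<phi> ` E)) = w (iso_class (G, {}, y, E))"
proof -
  note f = piso_facts[OF p]
  have ps: "piso s \<phi> (G, {}, y, E) (G', {}, \<phi> y, \<phi> ` E)"
    by (rule piso_shift(2)[OF p y R refl refl E])
  have "y \<in> verts G" "\<phi> y \<in> verts G'"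
    using y mgraphs_ball[OF m(1), of t] mgraphs_ball[OF m(2), of t] piso_ball(1)[OF p y R] by blast+
  moreover have "E \<subseteq> verts G" "\<phi> ` E \<subseteq> verts G'"
    using E mgraphs_ball[OF m(1), of R] mgraphs_ball[OF m(2), of R] f(2) by blast+
  ultimately show ?thesis
    by (intro local_piso[OF w ps, symmetric] mgraphs_change(1)[OF m(1)] mgraphs_change(1)[OF m(2)])
qed

section \<open>Local functionals of close sets\<close>

text \<open>A ball in place of the component, so that it is local; the two coincide when all
  components have at most \<open>k\<close> vertices.\<close>

definition cluster :: "nat \<Rightarrow> 'v ugraph \<Rightarrow> 'v set set \<Rightarrow> 'v \<Rightarrow> 'v set" where
  "cluster k G S x = ball_verts (delete_edges G S) x k"

definition Nsum :: "nat \<Rightarrow> (mclass \<Rightarrow> real) \<Rightarrow> 'v mgraph \<Rightarrow> real" where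
  "Nsum k w = (\<lambda>(G, S, x, E). \<Sum>D\<in>close_sets k G x. w (iso_class (G, {}, x, D)))"

text \<open>Forgets from which of its members a set is seen. The marked set is cut to the
  \<open>k\<close>-ball to keep the function local, and the value off the close sets is set to
  0.\<close>

definition root_avg :: "nat \<Rightarrow> (mclass \<Rightarrow> real) \<Rightarrow> 'v mgraph \<Rightarrow> real" where
  "root_avg k w = (\<lambda>(G, S, x, E). if E \<inter> ball_verts G x k \<in> close_sets k G x
     then (\<Sum>y\<in>E \<inter> ball_verts G x k. w (iso_class (G, {}, y, E \<inter> ball_verts G x k))) / card (E \<inter> ball_verts G x k) else 0)"

definition at_cluster :: "nat \<Rightarrow> (mclass \<Rightarrow> real) \<Rightarrow> 'v mgraph \<Rightarrow> real" where
  "at_cluster k w = (\<lambda>(G, S, x, E). w (iso_class (G, {}, x, cluster k G S x)))"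

text \<open>A mass transport: the root \<open>x\<close> splits the value of \<open>w\<close> at its
  cluster equally among the cluster's vertices. The marked set \<open>E\<close> plays the part of
  the receiving vertex.\<close>

definition cluster_share :: "nat \<Rightarrow> (mclass \<Rightarrow> real) \<Rightarrow> 'v mgraph \<Rightarrow> real" where
  "cluster_share k w = (\<lambda>(G, S, x, E). if E \<inter> cluster k G S x \<noteq> {}
     then w (iso_class (G, {}, x, cluster k G S x)) / card (cluster k G S x) else 0)"

definition escape :: "'v mgraph \<Rightarrow> nat" where
  "escape = (\<lambda>(G, S, x, E). card {e \<in> edges G. x \<in> e \<and> \<not> e \<subseteq> E})"

lemma cluster_subset: "cluster k G S x \<subseteq> ball_verts G x k"
  unfolding cluster_def by (rule ball_delete_subset)

lemma self_in_cluster [simp]: "x \<in> cluster k G S x"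
  by (simp add: cluster_def)

lemma Nsum_piso:
  assumes w: "local_at s w" and gh: "g \<in> mgraphs" "h \<in> mgraphs" and p: "piso (2 * k + s) \<phi> g h"
  shows "Nsum k w g = Nsum k w h"
proof -
  obtain G S x E where g: "g = (G, S, x, E)" by (metis prod_cases4)
  obtain G' S' x' E' where h: "h = (G', S', x', E')" by (metis prod_cases4)
  note p = p[unfolded g h] and m = gh[unfolded g h]
  note d = piso_close_sets[OF p, of k]
  have B: "ball_verts G x k \<subseteq> ball_verts G x (2 * k + s)" by (rule ball_verts_mono) simp
  have eq: "w (iso_class (G', {}, x', \<phi> ` D)) = w (iso_class (G, {}, x, D))" if "D \<in> close_sets k G x" for D
    using local_piso_shift[OF w p m, of x 0 D] close_sets_ball[OF that] B piso_facts(3)[OF p] by auto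
  have "Nsum k w h = (\<Sum>D\<in>(\<lambda>D. \<phi> ` D) ` close_sets k G x. w (iso_class (G', {}, x', D)))"
    using d(2) by (simp add: h Nsum_def)
  also have "\<dots> = Nsum k w g" using eq d(3) by (simp add: sum.reindex g Nsum_def)
  finally show ?thesis ..
qed

lemma root_avg_piso:
  assumes w: "local_at s w" and gh: "g \<in> mgraphs" "h \<in> mgraphs" and p: "piso (2 * k + s) \<phi> g h"
  shows "root_avg k w g = root_avg k w h"
proof -
  obtain G S x E where g: "g = (G, S, x, E)" by (metis prod_cases4)
  obtain G' S' x' E' where h: "h = (G', S', x', E')" by (metis prod_cases4)
  note p = p[unfolded g h] and m = gh[unfolded g h]
  note d = piso_close_sets[OF p, of k] and f = piso_facts[OF p]
  have k: "k \<le> 2 * k + s" by simp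
  note fk = piso_facts[OF piso_mono[OF p k]]
  have B: "ball_verts G x k \<subseteq> ball_verts G x (2 * k + s)" by (rule ball_verts_mono[OF k])
  let ?D = "E \<inter> ball_verts G x k" and ?D' = "E' \<inter> ball_verts G' x' k"
  have D': "?D' = \<phi> ` ?D" using fk(2,6) by simp
  have DW: "?D \<subseteq> ball_verts G x (2 * k + s)" using B by blast
  have i: "inj_on \<phi> ?D" by (rule inj_on_subset[OF f(1) DW])
  have iff: "?D' \<in> close_sets k G' x' \<longleftrightarrow> ?D \<in> close_sets k G x" unfolding D' by (rule d(1)) auto
  have eq: "w (iso_class (G', {}, \<phi> y, \<phi> ` ?D)) = w (iso_class (G, {}, y, ?D))" if "y \<in> ?D" for y
    using local_piso_shift[OF w p m, of y k ?D] that DW by auto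
  have "(\<Sum>y\<in>?D'. w (iso_class (G', {}, y, ?D'))) = (\<Sum>y\<in>?D. w (iso_class (G, {}, y, ?D)))"
    unfolding D' sum.reindex[OF i] using eq by simp
  moreover have "card ?D' = card ?D" unfolding D' by (rule card_image[OF i])
  ultimately show ?thesis using iff by (simp add: g h root_avg_def)
qed

lemma piso_cluster:
  assumes p: "piso R \<phi> (G, S, x, E) (G', S', x', E')" and k: "k \<le> R"
  shows "cluster k G' S' x' = \<phi> ` cluster k G S x" "cluster k G S x \<subseteq> ball_verts G x R"
    "inj_on \<phi> (cluster k G S x)" "E' \<inter> cluster k G' S' x' = \<phi> ` (E \<inter> cluster k G S x)"
proof -
  note f = piso_facts[OF p]
  show 1: "cluster k G' S' x' = \<phi> ` cluster k G S x"
    using piso_ball(3)[OF p, of x 0 k] k f(3) by (simp add: cluster_def)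
  show 2: "cluster k G S x \<subseteq> ball_verts G x R"
    by (rule order_trans[OF cluster_subset ball_verts_mono[OF k]])
  show "inj_on \<phi> (cluster k G S x)" by (rule inj_on_subset[OF f(1) 2])
  have "E' \<inter> cluster k G' S' x' = E' \<inter> \<phi> ` ball_verts G x R \<inter> \<phi> ` cluster k G S x" unfolding 1 using 2 by blast
  also have "\<dots> = \<phi> ` (E \<inter> ball_verts G x R) \<inter> \<phi> ` cluster k G S x" by (simp only: f(6))
  also have "\<dots> = \<phi> ` (E \<inter> ball_verts G x R \<inter> cluster k G S x)"
    by (rule inj_on_image_Int[OF f(1) _ 2, symmetric]) blast
  also have "E \<inter> ball_verts G x R \<inter> cluster k G S x = E \<inter> cluster k G S x" using 2 by blast
  finally show "E' \<inter> cluster k G' S' x' = \<phi> ` (E \<inter> cluster k G S x)" .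
qed

lemma at_cluster_piso:
  assumes w: "local_at s w" and gh: "g \<in> mgraphs" "h \<in> mgraphs" and p: "piso (k + s) \<phi> g h"
  shows "at_cluster k w g = at_cluster k w h" "cluster_share k w g = cluster_share k w h"
proof -
  obtain G S x E where g: "g = (G, S, x, E)" by (metis prod_cases4)
  obtain G' S' x' E' where h: "h = (G', S', x', E')" by (metis prod_cases4)
  note p = p[unfolded g h] and m = gh[unfolded g h]
  have k: "k \<le> k + s" by simp
  note c = piso_cluster[OF p k]
  have eq: "w (iso_class (G', {}, x', cluster k G' S' x')) = w (iso_class (G, {}, x, cluster k G S x))"
    unfolding c(1) using local_piso_shift[OF w p m, of x 0, OF _ _ c(2)] piso_facts(3)[OF p] by simp
  then show "at_cluster k w g = at_cluster k w h" by (simp add: g h at_cluster_def)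
  have "card (cluster k G' S' x') = card (cluster k G S x)" unfolding c(1) by (rule card_image[OF c(3)])
  then show "cluster_share k w g = cluster_share k w h" using eq c(4) by (simp add: g h cluster_share_def)
qed

lemma escape_piso:
  assumes gh: "g \<in> mgraphs" "h \<in> mgraphs" and p: "piso 1 \<phi> g h"
  shows "escape g = escape h"
proof -
  obtain G S x E where g: "g = (G, S, x, E)" by (metis prod_cases4)
  obtain G' S' x' E' where h: "h = (G', S', x', E')" by (metis prod_cases4)
  note p = p[unfolded g h]
  note ff = piso_facts[OF p]
  have m: "is_graph G" "is_graph G'" using gh by (auto simp: g h mgraphs_def)
  let ?W = "ball_verts G x 1"
  have mem: "x' \<in> \<phi> ` e \<longleftrightarrow> x \<in> e" if "e \<subseteq> ?W" for e
    using inj_on_image_mem_iff[OF ff(1) _ that, of x] ff(3) by simp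
  have sub: "\<phi> ` e \<subseteq> E' \<longleftrightarrow> e \<subseteq> E" if e: "e \<subseteq> ?W" for e
  proof -
    have "\<phi> ` e \<subseteq> E' \<longleftrightarrow> \<phi> ` e \<subseteq> E' \<inter> \<phi> ` ?W" using e by blast
    also have "\<dots> \<longleftrightarrow> e \<subseteq> E \<inter> ?W" unfolding ff(6) by (rule inj_on_image_subset_iff[OF ff(1) e]) simp
    finally show ?thesis using e by blast
  qed
  let ?X = "{e \<in> edges G. x \<in> e \<and> \<not> e \<subseteq> E}" and ?X' = "{e \<in> edges G'. x' \<in> e \<and> \<not> e \<subseteq> E'}"
  have W: "e \<subseteq> ?W" if "e \<in> ?X" for e using ball_1[OF m(1), of e x] that by simp
  have "?X' = (\<lambda>e. \<phi> ` e) ` ?X"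
  proof (intro equalityI subsetI)
    fix e' assume e': "e' \<in> ?X'"
    then have "e' \<subseteq> \<phi> ` ?W" using ball_1[OF m(2), of e' x'] ff(2) by simp
    then obtain e where e: "e \<subseteq> ?W" "e' = \<phi> ` e" by (rule subset_imageE)
    then have "e \<in> ?X" using e' ff(4)[OF e(1)] mem[OF e(1)] sub[OF e(1)] by simp
    then show "e' \<in> (\<lambda>e. \<phi> ` e) ` ?X" using e(2) by blast
  next
    fix e' assume "e' \<in> (\<lambda>e. \<phi> ` e) ` ?X"
    then obtain e where e: "e \<in> ?X" "e' = \<phi> ` e" by blast
    note We = W[OF e(1)]
    show "e' \<in> ?X'" using e ff(4)[OF We] mem[OF We] sub[OF We] by simp
  qed
  moreover have "inj_on (\<lambda>e. \<phi> ` e) ?X"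
    by (rule inj_on_subset[OF inj_on_image_Pow[OF ff(1)]]) (use W in blast)
  ultimately have "card ?X' = card ?X" by (simp add: card_image)
  then show ?thesis by (simp add: g h escape_def)
qed

lemma functional_local:
  assumes "local_at s w"
  shows "local_at (2 * k + s) (\<lambda>c. Nsum k w (rep c))" "local_at (2 * k + s) (\<lambda>c. root_avg k w (rep c))"
    "local_at (k + s) (\<lambda>c. at_cluster k w (rep c))" "local_at (k + s) (\<lambda>c. cluster_share k w (rep c))"
  by (rule local_atI, erule (2) Nsum_piso[OF assms], rule local_atI, erule (2) root_avg_piso[OF assms],
      rule local_atI, erule (2) at_cluster_piso(1)[OF assms], rule local_atI, erule (2) at_cluster_piso(2)[OF assms])

lemma escape_local: "local_at 1 (\<lambda>c. escape (rep c))"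
  by (rule local_atI, erule (2) escape_piso)

text \<open>Locality makes these functionals invariant under isomorphism, so they may be evaluated
  on any convenient representative, such as a component of a finite graph.\<close>

lemma functional_rep:
  assumes w: "local_at s w" and g: "g \<in> mgraphs"
  shows "Nsum k w (rep (iso_class g)) = Nsum k w g" "root_avg k w (rep (iso_class g)) = root_avg k w g"
    "at_cluster k w (rep (iso_class g)) = at_cluster k w g" "cluster_share k w (rep (iso_class g)) = cluster_share k w g"
proof -
  note r = rep_iso_class(1)[OF g]
  obtain \<phi> where "piso (2 * k + s) \<phi> g (rep (iso_class g))" using piso_rep[OF g] by blast
  then show "Nsum k w (rep (iso_class g)) = Nsum k w g" "root_avg k w (rep (iso_class g)) = root_avg k w g"
    using Nsum_piso[OF w g r] root_avg_piso[OF w g r] by metis+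
  obtain \<phi> where "piso (k + s) \<phi> g (rep (iso_class g))" using piso_rep[OF g] by blast
  then show "at_cluster k w (rep (iso_class g)) = at_cluster k w g" "cluster_share k w (rep (iso_class g)) = cluster_share k w g"
    using at_cluster_piso[OF w g r] by metis+
qed

lemma escape_rep:
  assumes g: "g \<in> mgraphs" shows "escape (rep (iso_class g)) = escape g"
proof -
  obtain \<phi> where "piso 1 \<phi> g (rep (iso_class g))" using piso_rep[OF g] by blast
  then show ?thesis using escape_piso[OF g rep_iso_class(1)[OF g]] by metis
qed

section \<open>Bounded local functions\<close>

text \<open>The class of functions over which the quadratic functional is minimized, closed under
  sums, products, positive parts and \<open>root_avg\<close>.\<close>

definition bounded_local :: "(mclass \<Rightarrow> real) \<Rightarrow> bool" where
  "bounded_local w \<longleftrightarrow> (\<exists>s. local_at s w) \<and> (\<exists>B. \<forall>c. \<bar>w c\<bar> \<le> B)"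

lemma bounded_localI: "local_at s w \<Longrightarrow> (\<And>c. \<bar>w c\<bar> \<le> B) \<Longrightarrow> bounded_local w"
  unfolding bounded_local_def by blast

lemma bounded_localE:
  assumes "bounded_local w" obtains s B where "local_at s w" "\<And>c. \<bar>w c\<bar> \<le> B" "0 \<le> B"
proof -
  obtain s B where "local_at s w" "\<forall>c. \<bar>w c\<bar> \<le> B" using assms unfolding bounded_local_def by blast
  moreover from this have "0 \<le> B" using abs_ge_zero order_trans by blast
  ultimately show ?thesis using that by blast
qed

lemma bounded_local_const: "bounded_local (\<lambda>_. a)"
  by (rule bounded_localI[OF local_at_const[of 0 a], where B = "\<bar>a\<bar>"]) simp

lemma bounded_local_add: assumes "bounded_local w" "bounded_local g" shows "bounded_local (\<lambda>c. w c + g c)"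
proof -
  obtain s B where w: "local_at s w" "\<And>c. \<bar>w c\<bar> \<le> B" "0 \<le> B" by (rule bounded_localE[OF assms(1)], rule that)
  obtain t C where g: "local_at t g" "\<And>c. \<bar>g c\<bar> \<le> C" "0 \<le> C" by (rule bounded_localE[OF assms(2)], rule that)
  show ?thesis by (rule bounded_localI[OF local_at_comp2[OF w(1) g(1)], where B = "B + C"])
      (use w(2) g(2) in \<open>intro order_trans[OF abs_triangle_ineq] add_mono\<close>)
qed

lemma bounded_local_mult: assumes "bounded_local w" "bounded_local g" shows "bounded_local (\<lambda>c. w c * g c)"
proof -
  obtain s B where w: "local_at s w" "\<And>c. \<bar>w c\<bar> \<le> B" "0 \<le> B" by (rule bounded_localE[OF assms(1)], rule that)
  obtain t C where g: "local_at t g" "\<And>c. \<bar>g c\<bar> \<le> C" "0 \<le> C" by (rule bounded_localE[OF assms(2)], rule that)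
  show ?thesis by (rule bounded_localI[OF local_at_comp2[OF w(1) g(1)], where B = "B * C"])
      (use w g in \<open>auto simp: abs_mult intro!: mult_mono\<close>)
qed

lemma bounded_local_max: assumes "bounded_local w" shows "bounded_local (\<lambda>c. max 0 (w c))"
proof -
  obtain s B where w: "local_at s w" "\<And>c. \<bar>w c\<bar> \<le> B" "0 \<le> B" by (rule bounded_localE[OF assms], rule that)
  show ?thesis
  proof (rule bounded_localI[OF local_at_comp[OF w(1)], where B = B])
    show "\<bar>max 0 (w c)\<bar> \<le> B" for c using w(2)[of c] by (auto simp: max_def abs_le_iff)
  qed
qed

lemma bounded_local_power2: "bounded_local w \<Longrightarrow> bounded_local (\<lambda>c. (w c)\<^sup>2)"
  using bounded_local_mult[of w w] by (simp add: power2_eq_square)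

lemma root_avg_bound:
  assumes "\<And>c. \<bar>w c\<bar> \<le> B" "0 \<le> B" shows "\<bar>root_avg k w g\<bar> \<le> B"
proof -
  obtain G S x E where g: "g = (G, S, x, E)" by (metis prod_cases4)
  let ?D = "E \<inter> ball_verts G x k"
  have "\<bar>\<Sum>y\<in>?D. w (iso_class (G, {}, y, ?D))\<bar> \<le> (\<Sum>y\<in>?D. B)"
    by (rule order_trans[OF sum_abs]) (intro sum_mono assms(1))
  then have "\<bar>\<Sum>y\<in>?D. w (iso_class (G, {}, y, ?D))\<bar> \<le> card ?D * B" by simp
  then show ?thesis using assms(2)
    by (cases "card ?D = 0") (auto simp: g root_avg_def abs_divide divide_le_eq mult.commute)
qed

lemma bounded_local_root_avg: assumes "bounded_local w" shows "bounded_local (\<lambda>c. root_avg k w (rep c))"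
proof -
  obtain s B where w: "local_at s w" "\<And>c. \<bar>w c\<bar> \<le> B" "0 \<le> B" by (rule bounded_localE[OF assms], rule that)
  show ?thesis by (rule bounded_localI[OF functional_local(2)[OF w(1)], where B = B]) (rule root_avg_bound[OF w(2,3)])
qed

lemma finite_close_sets: "(G, S, x, E) \<in> mgraphs \<Longrightarrow> finite (close_sets k G x)"
  by (rule finite_subset[OF close_sets_Pow]) (auto simp: mgraphs_def intro: finite_ball)

lemma finite_close_sets_mem: "(G, S, x, E) \<in> mgraphs \<Longrightarrow> D \<in> close_sets k G x \<Longrightarrow> finite D \<and> D \<noteq> {} \<and> D \<subseteq> verts G"
proof -
  assume m: "(G, S, x, E) \<in> mgraphs" and D: "D \<in> close_sets k G x"
  have "finite (ball_verts G x k)" using m by (auto simp: mgraphs_def intro: finite_ball)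
  then show ?thesis using close_sets_ball[OF D] finite_subset mgraphs_ball[OF m, of k] D by (auto simp: close_sets_def)
qed

text \<open>A close set is a subset of the \<open>k\<close>-ball, which has at most
  \<open>(M + 1) ^ k\<close> vertices.\<close>

lemma Nsum_bound:
  assumes m: "(G, S, x, E) \<in> mgraphs" "max_degree_le M G" and B: "\<And>c. \<bar>w c\<bar> \<le> B" "0 \<le> B"
  shows "\<bar>Nsum k w (G, S, x, E)\<bar> \<le> B * 2 ^ ((M + 1) ^ k)"
proof -
  have fb: "finite (ball_verts G x k)" using m by (auto simp: mgraphs_def intro: finite_ball)
  have "card (close_sets k G x) \<le> card (Pow (ball_verts G x k))"
    by (rule card_mono[OF _ close_sets_Pow]) (use fb in simp)
  also have "\<dots> = 2 ^ card (ball_verts G x k)" by (rule card_Pow[OF fb])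
  also have "\<dots> \<le> 2 ^ ((M + 1) ^ k)"
    using card_ball[of G M x k] m by (intro power_increasing) (auto simp: mgraphs_def)
  finally have "real (card (close_sets k G x)) \<le> real (2 ^ ((M + 1) ^ k))" by (rule of_nat_mono)
  then have c: "real (card (close_sets k G x)) \<le> 2 ^ ((M + 1) ^ k)" by simp
  have "\<bar>Nsum k w (G, S, x, E)\<bar> \<le> (\<Sum>D\<in>close_sets k G x. B)"
    unfolding Nsum_def prod.case by (rule order_trans[OF sum_abs]) (intro sum_mono B(1))
  also have "\<dots> = B * real (card (close_sets k G x))" by simp
  also have "\<dots> \<le> B * 2 ^ ((M + 1) ^ k)" by (rule mult_left_mono[OF c B(2)])
  finally show ?thesis .
qed

text \<open>With all components of size at most \<open>k\<close>, the \<open>k\<close>-ball after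
  deletion is the whole component. Hence clusters partition the graph, and their members are at
  distance at most \<open>k\<close> already before deletion.\<close>

lemma cluster_comp:
  assumes "components_le k (delete_edges G S)" "x \<in> verts G"
  shows "cluster k G S x = comp_verts (delete_edges G S) x" "finite (cluster k G S x)"
    "y \<in> cluster k G S x \<Longrightarrow> cluster k G S y = cluster k G S x" "cluster k G S x \<in> close_sets k G x"
proof -
  have sm: "finite (ball_verts (delete_edges G S) y k) \<and> card (ball_verts (delete_edges G S) y k) \<le> k"
    if "y \<in> verts G" for y
    using assms(1) that unfolding components_le_def small_comp_iff by simp
  have eq: "cluster k G S y = comp_verts (delete_edges G S) y" if "y \<in> verts G" for y
    unfolding cluster_def using comp_eq_ball[of "delete_edges G S" y k] sm[OF that] by simp
  show 1: "cluster k G S x = comp_verts (delete_edges G S) x" by (rule eq[OF assms(2)])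
  show "finite (cluster k G S x)" using sm[OF assms(2)] by (simp add: cluster_def)
  have any: "cluster k G S y = cluster k G S x" if y: "y \<in> cluster k G S x" for y
  proof -
    have yc: "y \<in> comp_verts (delete_edges G S) x" using y 1 by simp
    have "finite (comp_verts (delete_edges G S) x) \<and> card (comp_verts (delete_edges G S) x) \<le> k"
      using assms by (simp add: components_le_def)
    then have "finite (comp_verts (delete_edges G S) y) \<and> card (comp_verts (delete_edges G S) y) \<le> k"
      unfolding comp_verts_eq[OF yc] .
    then have "cluster k G S y = comp_verts (delete_edges G S) y"
      unfolding cluster_def small_comp_iff using comp_eq_ball[of "delete_edges G S" y k] by simp
    then show ?thesis using comp_verts_eq[OF yc] 1 by simp
  qed
  then show "y \<in> cluster k G S x \<Longrightarrow> cluster k G S y = cluster k G S x" .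
  have "v \<in> ball_verts G u k" if "u \<in> cluster k G S x" "v \<in> cluster k G S x" for u v
    using any[OF that(1)] that(2) cluster_subset[of k G S u] by blast
  then show "cluster k G S x \<in> close_sets k G x" by (simp add: close_sets_def)
qed

section \<open>Finite graphs: families of close sets\<close>

definition set_class :: "'v ugraph \<Rightarrow> 'v \<Rightarrow> 'v set \<Rightarrow> mclass" where
  "set_class G v D = iso_class (component G v, {}, v, D)"

text \<open>The family on which the fractional cover lives. Its members through \<open>v\<close> are
  exactly the close sets of \<open>v\<close>, so sums over roots can be regrouped by sets.\<close>

definition close_family :: "nat \<Rightarrow> 'v ugraph \<Rightarrow> 'v set set" where
  "close_family k G = (\<Union>v\<in>verts G. close_sets k G v)"

lemma close_sets_component: "close_sets k (component G v) v = close_sets k G v"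
proof -
  have *: "D \<in> close_sets k (component G v) v \<longleftrightarrow> D \<in> close_sets k G v" if D: "D \<subseteq> comp_verts G v" for D
  proof -
    have "ball_verts (component G v) u k = ball_verts G u k" if "u \<in> D" for u
      by (rule ball_component) (use D that in blast)
    then show ?thesis by (simp add: close_sets_def)
  qed
  have 1: "D \<subseteq> comp_verts G v" if "D \<in> close_sets k (component G v) v" for D
    using close_sets_ball[OF that] ball_subset_comp[of G v k] unfolding ball_component[OF self_in_comp] by (rule order_trans)
  have 2: "D \<subseteq> comp_verts G v" if "D \<in> close_sets k G v" for D
    by (rule order_trans[OF close_sets_ball[OF that] ball_subset_comp])
  show ?thesis
  proof (intro equalityI subsetI)
    fix D assume "D \<in> close_sets k (component G v) v" then show "D \<in> close_sets k G v" using *[OF 1] by blast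
  next
    fix D assume "D \<in> close_sets k G v" then show "D \<in> close_sets k (component G v) v" using *[OF 2] by blast
  qed
qed

lemma set_class_mgraphs:
  assumes "G \<in> fin_graphs M" "v \<in> verts G" "D \<in> close_sets k G v"
  shows "(component G v, {}, v, D) \<in> mgraphs"
proof -
  have "D \<subseteq> comp_verts G v" by (rule order_trans[OF close_sets_ball[OF assms(3)] ball_subset_comp])
  then show ?thesis
    using comp_mg_mgraphs[of G "{}" v D] fin_graphsD[OF assms(1)] assms(2) by (simp add: comp_mg_def)
qed

lemma close_family_facts:
  assumes "G \<in> fin_graphs M"
  shows "finite (close_family k G)" "\<And>D. D \<in> close_family k G \<Longrightarrow> D \<subseteq> verts G \<and> card D \<le> (M + 1) ^ k \<and> D \<noteq> {} \<and> finite D"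
    "\<And>v. v \<in> verts G \<Longrightarrow> {D \<in> close_family k G. v \<in> D} = close_sets k G v"
proof -
  note ff = fin_graphsD[OF assms]
  show 2: "D \<subseteq> verts G \<and> card D \<le> (M + 1) ^ k \<and> D \<noteq> {} \<and> finite D" if DF: "D \<in> close_family k G" for D
  proof -
    obtain v where v: "v \<in> verts G" "D \<in> close_sets k G v" using DF unfolding close_family_def by (rule UN_E)
    have s: "D \<subseteq> ball_verts G v k" by (rule close_sets_ball[OF v(2)])
    have fb: "finite (ball_verts G v k)" by (rule finite_ball[OF ff(1,5) v(1)])
    have "card D \<le> card (ball_verts G v k)" by (rule card_mono[OF fb s])
    moreover have "v \<in> D" using v(2) by (simp add: close_sets_def)
    ultimately show ?thesis
      using card_ball[OF ff(1,4) v(1), of k] order_trans[OF s ball_subset_verts[OF ff(1) v(1)]] finite_subset[OF s fb]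
      by auto
  qed
  show "finite (close_family k G)" by (rule finite_subset[of _ "Pow (verts G)"]) (use 2 ff(2) in auto)
  show "{D \<in> close_family k G. v \<in> D} = close_sets k G v" if v: "v \<in> verts G" for v
  proof (intro equalityI subsetI)
    fix D assume D: "D \<in> {D \<in> close_family k G. v \<in> D}"
    then obtain u where u: "D \<in> close_sets k G u" unfolding close_family_def by blast
    show "D \<in> close_sets k G v" by (rule close_sets_root[OF u]) (use D in simp)
  next
    fix D assume D: "D \<in> close_sets k G v"
    then have "v \<in> D" by (simp add: close_sets_def)
    then show "D \<in> {D \<in> close_family k G. v \<in> D}" using v D unfolding close_family_def by blast
  qed
qed

lemma Nsum_root_class:
  assumes G: "G \<in> fin_graphs M" "v \<in> verts G" and w: "local_at s w"
  shows "Nsum k w (rep (root_class G {} v)) = (\<Sum>D\<in>close_sets k G v. w (set_class G v D))"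
proof -
  have m: "comp_mg G {} v {} \<in> mgraphs" by (rule root_class_mem(1)[OF G(1) _ G(2)]) simp
  show ?thesis unfolding root_class_def functional_rep(1)[OF w m]
    by (simp add: comp_mg_def Nsum_def close_sets_component set_class_def)
qed

lemma root_avg_set_class:
  assumes G: "G \<in> fin_graphs M" "v \<in> verts G" and w: "local_at s w" and D: "D \<in> close_sets k G v"
  shows "root_avg k w (rep (set_class G v D)) = (\<Sum>y\<in>D. w (set_class G y D)) / card D"
proof -
  have m: "(component G v, {}, v, D) \<in> mgraphs" by (rule set_class_mgraphs[OF G D])
  have DB: "D \<inter> ball_verts (component G v) v k = D"
    using close_sets_ball[OF D] unfolding ball_component[OF self_in_comp] by blast
  have "component G y = component G v" if "y \<in> D" for y
    by (rule component_cong) (use close_sets_ball[OF D] ball_subset_comp[of G v k] that in blast)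
  then show ?thesis unfolding set_class_def functional_rep(2)[OF w m]
    using D by (simp add: root_avg_def DB close_sets_component)
qed

lemma sum_Nsum:
  assumes G: "G \<in> fin_graphs M" and w: "local_at s w"
  shows "(\<Sum>v\<in>verts G. Nsum k w (rep (root_class G {} v))) = (\<Sum>D\<in>close_family k G. \<Sum>v\<in>D. w (set_class G v D))"
proof -
  note ff = close_family_facts[OF G, where k = k]
  have "(\<Sum>v\<in>verts G. Nsum k w (rep (root_class G {} v))) = (\<Sum>v\<in>verts G. \<Sum>D\<in>{D \<in> close_family k G. v \<in> D}. w (set_class G v D))"
    by (rule sum.cong[OF refl]) (simp add: Nsum_root_class[OF G _ w] ff(3))
  also have "\<dots> = (\<Sum>D\<in>close_family k G. \<Sum>v\<in>{v \<in> verts G. v \<in> D}. w (set_class G v D))"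
    by (rule sum.swap_restrict[OF fin_graphsD(2)[OF G] ff(1)])
  also have "\<dots> = (\<Sum>D\<in>close_family k G. \<Sum>v\<in>D. w (set_class G v D))"
  proof (rule sum.cong[OF refl])
    fix D assume "D \<in> close_family k G"
    then have "{v \<in> verts G. v \<in> D} = D" using ff(2) by blast
    then show "(\<Sum>v\<in>{v \<in> verts G. v \<in> D}. w (set_class G v D)) = (\<Sum>v\<in>D. w (set_class G v D))" by simp
  qed
  finally show ?thesis .
qed

text \<open>Grouped by sets, each \<open>D\<close> contributes the sum of \<open>w\<close> over its
  members, and replacing all members' values by their mean leaves this sum unchanged.\<close>

lemma avg_root_avg:
  assumes G: "G \<in> fin_graphs M" and w: "bounded_local w"
  shows "avg G {} (\<lambda>c. Nsum k (\<lambda>c. root_avg k w (rep c)) (rep c)) = avg G {} (\<lambda>c. Nsum k w (rep c))"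
proof -
  obtain s where s: "local_at s w" using w by (auto simp: bounded_local_def)
  note ff = close_family_facts[OF G, where k = k]
  have "(\<Sum>v\<in>D. root_avg k w (rep (set_class G v D))) = (\<Sum>v\<in>D. w (set_class G v D))" if D: "D \<in> close_family k G" for D
  proof -
    have "(\<Sum>v\<in>D. root_avg k w (rep (set_class G v D))) = (\<Sum>v\<in>D. (\<Sum>y\<in>D. w (set_class G y D)) / card D)"
    proof (rule sum.cong[OF refl])
      fix v assume v: "v \<in> D"
      then have vV: "v \<in> verts G" using ff(2)[OF D] by blast
      then have "D \<in> close_sets k G v" using ff(3)[OF vV] D v by blast
      then show "root_avg k w (rep (set_class G v D)) = (\<Sum>y\<in>D. w (set_class G y D)) / card D" by (rule root_avg_set_class[OF G vV s])
    qed
    also have "\<dots> = (\<Sum>y\<in>D. w (set_class G y D))" using ff(2)[OF D] by simp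
    finally show ?thesis .
  qed
  then show ?thesis
    unfolding avg_def sum_Nsum[OF G functional_local(2)[OF s]] sum_Nsum[OF G s] by simp
qed

section \<open>The quadratic functional, its near-minimizers and the partition of the finite
  graphs\<close>

section \<open>From hyperfinite measures to hyperfinite graphs\<close>

text \<open>The variance is nonnegative.\<close>

lemma average_square_le:
  fixes f :: "'a \<Rightarrow> real"
  shows "((\<Sum>y\<in>D. f y) / card D)\<^sup>2 \<le> (\<Sum>y\<in>D. (f y)\<^sup>2) / card D"
proof (cases "card D = 0")
  case False
  define a where "a = (\<Sum>y\<in>D. f y) / card D"
  have s: "(\<Sum>y\<in>D. f y) = card D * a" using False by (simp add: a_def)
  have "0 \<le> (\<Sum>y\<in>D. (f y - a)\<^sup>2)" by (rule sum_nonneg) simp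
  also have "\<dots> = (\<Sum>y\<in>D. (f y)\<^sup>2) - 2 * a * (\<Sum>y\<in>D. f y) + card D * a\<^sup>2"
  proof -
    have "(\<Sum>y\<in>D. (f y - a)\<^sup>2) = (\<Sum>y\<in>D. (f y)\<^sup>2 - 2 * a * f y + a\<^sup>2)"
      by (rule sum.cong[OF refl]) (simp add: power2_diff)
    then show ?thesis by (simp add: sum.distrib sum_subtractf sum_distrib_left)
  qed
  also have "\<dots> = (\<Sum>y\<in>D. (f y)\<^sup>2) - card D * a\<^sup>2" unfolding s by (simp add: power2_eq_square)
  finally show ?thesis using False unfolding a_def[symmetric] by (simp add: field_simps)
qed simp

locale hyper_limit =
  fixes M k :: nat and G :: "nat \<Rightarrow> 'v ugraph" and \<mu> \<nu> :: "mclass measure" and \<epsilon> :: real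
  assumes G: "\<And>j. G j \<in> fin_graphs M"
    and \<mu>: "\<mu> \<in> prob_measures (rooted_space_deg M)"
    and weak: "weakly_converges (rooted_space_deg M) (\<lambda>j. Psi M (G j)) \<mu>"
    and \<nu>: "\<nu> \<in> unimodular_marked"
    and proj: "distr \<nu> (local_borel rooted_space) forget_marks = extend_measure_to_rooted \<mu>"
    and comps: "AE c in \<nu>. case rep c of (G, S, x, D) \<Rightarrow> components_le k (delete_edges G S)"
    and cost: "(\<integral>\<^sup>+ c. (case rep c of (G, S, x, D) \<Rightarrow> of_nat (card (incident_edges S x))) \<partial>\<nu>) \<le> ennreal (2 * \<epsilon>)"
    and eps: "\<epsilon> \<ge> 0"
begin

lemma p\<mu>: "prob_space \<mu>" "sets \<mu> = sets (local_borel (rooted_space_deg M))" "space \<mu> = rooted_space_deg M"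
  using extend_measurable[OF \<mu>] by auto

lemma p\<nu>: "prob_space \<nu>" "sets \<nu> = sets (local_borel marked_rooted_space)"
  using \<nu> by (auto simp: unimodular_marked_def prob_measures_def)

lemma sp\<nu>: "space \<nu> = marked_rooted_space"
  using sets_eq_imp_space_eq[OF p\<nu>(2)] by simp

sublocale m: prob_space \<mu> by (rule p\<mu>(1))
sublocale n: prob_space \<nu> by (rule p\<nu>(1))

lemma meas\<mu>: assumes "local_at r f" shows "(f :: mclass \<Rightarrow> real) \<in> borel_measurable \<mu>"
  unfolding measurable_cong_sets[OF p\<mu>(2) refl] by (rule local_measurable[OF spaces_subset(2) assms]) simp

lemma meas\<nu>: assumes "local_at r f" shows "(f :: mclass \<Rightarrow> real) \<in> borel_measurable \<nu>"
  unfolding measurable_cong_sets[OF p\<nu>(2) refl] by (rule local_measurable[OF spaces_subset(4) assms]) simp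

lemma rep_\<mu>:
  assumes "c \<in> rooted_space_deg M"
  obtains H x where "rep c = (H, {}, x, {})" "(H, {}, x, {}) \<in> mgraphs" "max_degree_le M H" "c \<in> mclasses"
  using assms rep_mclass(1)[of c] unfolding rooted_space_deg_iff by metis

lemma AE_good:
  "AE c in \<nu>. c \<in> mclasses \<and> (\<exists>H S x. rep c = (H, S, x, {}) \<and> (H, S, x, {}) \<in> mgraphs \<and> components_le k (delete_edges H S))"
  using comps AE_space
proof eventually_elim
  case (elim c)
  then have c: "c \<in> marked_rooted_space" using sp\<nu> by simp
  then obtain H S x where g: "rep c = (H, S, x, {})" "c \<in> mclasses" by (auto simp: marked_rooted_space_iff)
  have "(H, S, x, {}) \<in> mgraphs" using rep_mclass(1)[OF g(2)] g(1) by simp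
  then show ?case using elim(1) g by auto
qed

definition N :: "(mclass \<Rightarrow> real) \<Rightarrow> real" where
  "N w = (\<integral>c. Nsum k w (rep c) \<partial>\<mu>)"

definition K :: "(mclass \<Rightarrow> real) \<Rightarrow> real" where
  "K w = (\<integral>c. at_cluster k w (rep c) \<partial>\<nu>)"

lemma int_N: assumes "bounded_local w" shows "integrable \<mu> (\<lambda>c. Nsum k w (rep c))"
proof -
  obtain s B where w: "local_at s w" "\<And>c. \<bar>w c\<bar> \<le> B" "0 \<le> B" by (rule bounded_localE[OF assms], rule that)
  have "AE c in \<mu>. norm (Nsum k w (rep c)) \<le> B * 2 ^ ((M + 1) ^ k)"
  proof (rule AE_I2)
    fix c assume "c \<in> space \<mu>"
    then have "c \<in> rooted_space_deg M" using p\<mu>(3) by simp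
    then obtain H x where "rep c = (H, {}, x, {})" "(H, {}, x, {}) \<in> mgraphs" "max_degree_le M H" by (rule rep_\<mu>)
    then show "norm (Nsum k w (rep c)) \<le> B * 2 ^ ((M + 1) ^ k)" using Nsum_bound[of H "{}" x "{}" M w B k] w by simp
  qed
  then show ?thesis by (rule m.integrable_const_bound) (rule meas\<mu>[OF functional_local(1)[OF w(1)]])
qed

lemma at_cluster_abs: "(\<And>c. \<bar>w c\<bar> \<le> B) \<Longrightarrow> \<bar>at_cluster k w g\<bar> \<le> B"
  by (cases g) (simp add: at_cluster_def)

lemma int_K: assumes "bounded_local w" shows "integrable \<nu> (\<lambda>c. at_cluster k w (rep c))"
proof -
  obtain s B where w: "local_at s w" "\<And>c. \<bar>w c\<bar> \<le> B" "0 \<le> B" by (rule bounded_localE[OF assms], rule that)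
  show ?thesis by (rule n.integrable_const_bound[of _ B]) (simp_all add: at_cluster_abs[OF w(2)] meas\<nu>[OF functional_local(3)[OF w(1)]])
qed

lemma N_add: "bounded_local w \<Longrightarrow> bounded_local g \<Longrightarrow> N (\<lambda>c. w c + g c) = N w + N g"
  using int_N[of w] int_N[of g] by (simp add: N_def Nsum_def case_prod_unfold sum.distrib)

lemma N_cmult: "N (\<lambda>c. a * w c) = a * N w"
proof -
  have "Nsum k (\<lambda>c. a * w c) g = a * Nsum k w g" for g :: "nat mgraph"
    by (cases g) (simp add: Nsum_def sum_distrib_left)
  then show ?thesis by (simp add: N_def)
qed

lemma K_add: "bounded_local w \<Longrightarrow> bounded_local g \<Longrightarrow> K (\<lambda>c. w c + g c) = K w + K g"
  using int_K[of w] int_K[of g] by (simp add: K_def at_cluster_def case_prod_unfold)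

lemma K_cmult: "K (\<lambda>c. a * w c) = a * K w"
proof -
  have "at_cluster k (\<lambda>c. a * w c) g = a * at_cluster k w g" for g :: "nat mgraph" by (cases g) (simp add: at_cluster_def)
  then show ?thesis by (simp add: K_def)
qed

lemma N_mono:
  assumes "bounded_local w" "bounded_local g" "\<And>c. w c \<le> g c" shows "N w \<le> N g"
  unfolding N_def
  by (rule integral_mono[OF int_N[OF assms(1)] int_N[OF assms(2)]])
    (auto simp: Nsum_def intro!: sum_mono assms(3) split: prod.split)

lemma K_mono:
  assumes "bounded_local w" "bounded_local g" "\<And>c. w c \<le> g c" shows "K w \<le> K g"
  unfolding K_def
  by (rule integral_mono[OF int_K[OF assms(1)] int_K[OF assms(2)]])
    (auto simp: at_cluster_def intro!: assms(3) split: prod.split)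

lemma K_one: "K (\<lambda>_. 1) = 1"
proof -
  have "at_cluster k (\<lambda>_. 1) g = 1" for g :: "nat mgraph" by (cases g) (simp add: at_cluster_def)
  then show ?thesis by (simp add: K_def n.prob_space)
qed

lemma avg_limit:
  assumes "bounded_local w" shows "(\<lambda>j. avg (G j) {} (\<lambda>c. Nsum k w (rep c))) \<longlonglongrightarrow> N w"
proof -
  obtain s B where w: "local_at s w" "\<And>c. \<bar>w c\<bar> \<le> B" "0 \<le> B" by (rule bounded_localE[OF assms], rule that)
  show ?thesis unfolding N_def
  proof (rule weak_limit_local[OF G weak functional_local(1)[OF w(1)]])
    fix c assume "c \<in> rooted_space_deg M"
    then obtain H x where "rep c = (H, {}, x, {})" "(H, {}, x, {}) \<in> mgraphs" "max_degree_le M H" by (rule rep_\<mu>)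
    then show "\<bar>Nsum k w (rep c)\<bar> \<le> B * 2 ^ ((M + 1) ^ k)" using Nsum_bound[of H "{}" x "{}" M w B k] w by simp
  qed
qed

text \<open>Both sides are limits of the same finite averages, by the regrouping in
  \<open>avg_root_avg\<close>.\<close>

lemma N_root_avg: assumes "bounded_local w" shows "N (\<lambda>c. root_avg k w (rep c)) = N w"
  using LIMSEQ_unique[OF avg_limit[OF bounded_local_root_avg[OF assms, where k = k]]] avg_limit[OF assms]
  unfolding avg_root_avg[OF G assms] by blast

lemma integral_forget:
  assumes h: "local_at r (h :: mclass \<Rightarrow> real)" and i: "integrable \<mu> h"
  shows "integrable \<nu> (\<lambda>c. h (forget_marks c))" "(\<integral>c. h (forget_marks c) \<partial>\<nu>) = (\<integral>c. h c \<partial>\<mu>)"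
proof -
  have fm: "forget_marks \<in> measurable \<nu> (local_borel rooted_space)"
    using forget_measurable measurable_cong_sets[OF p\<nu>(2) refl] by blast
  have hm: "h \<in> borel_measurable (local_borel rooted_space)" by (rule local_measurable[OF spaces_subset(1) h]) simp
  note id = extend_measurable(1)[OF \<mu>]
  have "integrable (extend_measure_to_rooted \<mu>) h"
    unfolding extend_measure_to_rooted_def integrable_distr_eq[OF id hm] by (rule i)
  then show "integrable \<nu> (\<lambda>c. h (forget_marks c))"
    unfolding proj[symmetric] integrable_distr_eq[OF fm hm] .
  show "(\<integral>c. h (forget_marks c) \<partial>\<nu>) = (\<integral>c. h c \<partial>\<mu>)"
    unfolding integral_distr[OF fm hm, symmetric] proj
    unfolding extend_measure_to_rooted_def by (rule integral_distr[OF id hm])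
qed

lemma Nsum_forget:
  assumes "local_at s w" "c \<in> mclasses" shows "Nsum k w (rep (forget_marks c)) = Nsum k w (rep c)"
proof -
  have "Nsum k w (rep (forget_marks c)) = Nsum k w (unmark (rep c))"
    unfolding forget_marks_eq by (rule functional_rep(1)[OF assms(1) unmark_mgraphs[OF rep_mclass(1)[OF assms(2)]]])
  then show ?thesis by (cases "rep c") (simp add: unmark_def Nsum_def)
qed

text \<open>Almost surely the cluster of the root is one of the close sets, so for nonnegative
  \<open>w\<close> its value is one term of the sum over all of them; that sum ignores the marks and
  is integrated against \<open>\<mu>\<close>.\<close>

lemma K_le_N: assumes w: "bounded_local w" and pos: "\<And>c. 0 \<le> w c" shows "K w \<le> N w"
proof -
  obtain s where s: "local_at s w" using w by (auto simp: bounded_local_def)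
  note f = integral_forget[OF functional_local(1)[OF s] int_N[OF w]]
  have "K w \<le> (\<integral>c. Nsum k w (rep (forget_marks c)) \<partial>\<nu>)"
    unfolding K_def
  proof (rule integral_mono_AE[OF int_K[OF w] f(1)])
    show "AE c in \<nu>. at_cluster k w (rep c) \<le> Nsum k w (rep (forget_marks c))"
      using AE_good
    proof eventually_elim
      case (elim c)
      then obtain H S x where g: "rep c = (H, S, x, {})" "(H, S, x, {}) \<in> mgraphs" "components_le k (delete_edges H S)" by blast
      have "x \<in> verts H" using g(2) by (simp add: mgraphs_def)
      then have "cluster k H S x \<in> close_sets k H x" by (rule cluster_comp(4)[OF g(3)])
      then have "w (iso_class (H, {}, x, cluster k H S x)) \<le> (\<Sum>D\<in>close_sets k H x. w (iso_class (H, {}, x, D)))"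
        using member_le_sum[of _ "close_sets k H x" "\<lambda>D. w (iso_class (H, {}, x, D))"] finite_close_sets[OF g(2)] pos by blast
      then show ?case using Nsum_forget[OF s] elim by (simp add: g(1) at_cluster_def Nsum_def)
    qed
  qed
  then show ?thesis unfolding f(2) N_def .
qed

text \<open>Mass transport for \<open>\<nu>\<close> with \<open>cluster_share\<close>: a root sends
  out the value of \<open>w\<close> at its cluster and receives the mean of the values seen from the
  cluster's members. Nonnegativity lets the masses be taken in \<open>ennreal\<close>.\<close>

lemma K_root_avg: assumes w: "bounded_local w" and pos: "\<And>c. 0 \<le> w c" shows "K (\<lambda>c. root_avg k w (rep c)) = K w"
proof -
  obtain s where s: "local_at s w" using w by (auto simp: bounded_local_def)
  let ?f = "\<lambda>c. ennreal (cluster_share k w (rep c))"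
  have "?f \<in> borel_measurable (local_borel marked_birooted_space)"
    by (rule local_measurable[OF spaces_subset(5) local_at_comp[OF functional_local(4)[OF s]]]) simp
  then have mt: "(\<integral>\<^sup>+c. mass_in ?f c \<partial>\<nu>) = (\<integral>\<^sup>+c. mass_out ?f c \<partial>\<nu>)"
    using \<nu> by (simp add: unimodular_marked_def mass_transport_def)
  have out: "AE c in \<nu>. mass_out ?f c = ennreal (at_cluster k w (rep c))"
    and inn: "AE c in \<nu>. mass_in ?f c = ennreal (at_cluster k (\<lambda>c. root_avg k w (rep c)) (rep c))"
  proof -
    have *: "mass_out ?f c = ennreal (at_cluster k w (rep c)) \<and> mass_in ?f c = ennreal (at_cluster k (\<lambda>c. root_avg k w (rep c)) (rep c))"
      if c: "c \<in> mclasses \<and> (\<exists>H S x. rep c = (H, S, x, {}) \<and> (H, S, x, {}) \<in> mgraphs \<and> components_le k (delete_edges H S))" for c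
    proof -
      obtain H S z where g: "rep c = (H, S, z, {})" "(H, S, z, {}) \<in> mgraphs" "components_le k (delete_edges H S)" using c by blast
      have z: "z \<in> verts H" using g(2) by (simp add: mgraphs_def)
      let ?K = "cluster k H S z"
      note cc = cluster_comp[OF g(3) z]
      have KV: "?K \<subseteq> verts H" by (rule order_trans[OF cluster_subset mgraphs_ball[OF g(2)]])
      have zK: "card ?K > 0" using cc(2) self_in_cluster[of z k H S] card_gt_0_iff by blast
      have f_eq: "?f (iso_class (H, S, x, {y})) = ennreal (cluster_share k w (H, S, x, {y}))" if "x \<in> verts H" "y \<in> verts H" for x y
        by (rule arg_cong[OF functional_rep(4)[OF s mgraphs_change(2)[OF g(2) that(1)]]]) (use that(2) in simp)
      have "mass_out ?f c = (\<integral>\<^sup>+y. ennreal (cluster_share k w (H, S, z, {y})) \<partial>count_space (verts H))"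
        unfolding mass_out_def g(1) prod.case by (rule nn_integral_cong) (simp add: f_eq[OF z])
      also have "\<dots> = (\<Sum>y\<in>?K. ennreal (cluster_share k w (H, S, z, {y})))"
        by (rule nn_integral_count_space'[OF cc(2) _ KV]) (simp add: cluster_share_def)
      also have "\<dots> = (\<Sum>y\<in>?K. ennreal (w (iso_class (H, {}, z, ?K)) / card ?K))"
        by (rule sum.cong[OF refl]) (simp add: cluster_share_def)
      also have "\<dots> = ennreal (\<Sum>y\<in>?K. w (iso_class (H, {}, z, ?K)) / card ?K)"
        by (rule sum_ennreal) (simp add: pos)
      also have "\<dots> = ennreal (at_cluster k w (rep c))" using zK by (simp add: g(1) at_cluster_def)
      finally have o: "mass_out ?f c = ennreal (at_cluster k w (rep c))" .
      \<comment> \<open>Almost surely clusters are equivalence classes, so sender and receiver have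
        the same cluster.\<close>
      have sym: "z \<in> cluster k H S x \<longleftrightarrow> x \<in> ?K" if "x \<in> verts H" for x
        using cluster_comp(3)[OF g(3) that, of z] cluster_comp(3)[OF g(3) z, of x] self_in_cluster[of x k H S]
          self_in_cluster[of z k H S] by blast
      have F2in: "cluster_share k w (H, S, x, {z}) = (if x \<in> ?K then w (iso_class (H, {}, x, ?K)) / card ?K else 0)" if x: "x \<in> verts H" for x
      proof (cases "x \<in> ?K")
        case True
        then have "cluster k H S x = ?K" by (rule cc(3))
        then show ?thesis using True by (simp add: cluster_share_def)
      next
        case False
        then show ?thesis using sym[OF x] by (simp add: cluster_share_def)
      qed
      have "mass_in ?f c = (\<integral>\<^sup>+x. ennreal (cluster_share k w (H, S, x, {z})) \<partial>count_space (verts H))"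
        unfolding mass_in_def g(1) prod.case by (rule nn_integral_cong) (simp add: f_eq[OF _ z])
      also have "\<dots> = (\<Sum>x\<in>?K. ennreal (cluster_share k w (H, S, x, {z})))"
        by (rule nn_integral_count_space'[OF cc(2) _ KV]) (simp add: F2in)
      also have "\<dots> = (\<Sum>x\<in>?K. ennreal (w (iso_class (H, {}, x, ?K)) / card ?K))"
        by (rule sum.cong[OF refl]) (use KV F2in in auto)
      also have "\<dots> = ennreal (\<Sum>x\<in>?K. w (iso_class (H, {}, x, ?K)) / card ?K)"
        by (rule sum_ennreal) (simp add: pos)
      also have "(\<Sum>x\<in>?K. w (iso_class (H, {}, x, ?K)) / card ?K) = root_avg k w (H, {}, z, ?K)"
      proof -
        have "?K \<inter> ball_verts H z k = ?K" using cluster_subset[of k H S z] by blast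
        then show ?thesis using cc(4) by (simp add: root_avg_def sum_divide_distrib)
      qed
      also have "\<dots> = at_cluster k (\<lambda>c. root_avg k w (rep c)) (rep c)"
        unfolding g(1) at_cluster_def prod.case
        by (rule functional_rep(2)[OF s mgraphs_change(1)[OF g(2) z KV], symmetric])
      finally show ?thesis using o by simp
    qed
    show "AE c in \<nu>. mass_out ?f c = ennreal (at_cluster k w (rep c))" using AE_good by eventually_elim (use * in blast)
    show "AE c in \<nu>. mass_in ?f c = ennreal (at_cluster k (\<lambda>c. root_avg k w (rep c)) (rep c))" using AE_good by eventually_elim (use * in blast)
  qed
  have pos': "0 \<le> root_avg k w g" for g :: "nat mgraph"
    by (cases g) (auto simp: root_avg_def intro!: divide_nonneg_nonneg sum_nonneg pos)
  have Kn: "K u = enn2real (\<integral>\<^sup>+c. ennreal (at_cluster k u (rep c)) \<partial>\<nu>)" if "bounded_local u" "\<And>c. 0 \<le> u c" for u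
    unfolding K_def
    by (rule integral_eq_nn_integral)
      (use int_K[OF that(1)] that(2) in \<open>auto simp: at_cluster_def split: prod.split\<close>)
  have "(\<integral>\<^sup>+c. ennreal (at_cluster k (\<lambda>c. root_avg k w (rep c)) (rep c)) \<partial>\<nu>) = (\<integral>\<^sup>+c. mass_in ?f c \<partial>\<nu>)"
    by (rule nn_integral_cong_AE) (use inn in auto)
  also have "\<dots> = (\<integral>\<^sup>+c. ennreal (at_cluster k w (rep c)) \<partial>\<nu>)"
    unfolding mt by (rule nn_integral_cong_AE) (use out in auto)
  finally show ?thesis using Kn[OF bounded_local_root_avg[OF w] pos'] Kn[OF w pos] by simp
qed

text \<open>If p denotes the density of \<open>K\<close> with respect to \<open>N\<close>, this is
  the \<open>N\<close>-integral of \<open>(w - p)\<close> squared minus that of p squared, written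
  without p.\<close>

definition J :: "(mclass \<Rightarrow> real) \<Rightarrow> real" where
  "J w = N (\<lambda>c. (w c)\<^sup>2) - 2 * K w"

text \<open>Pointwise, twice \<open>w\<close> is at most its square plus 1; then \<open>K\<close> of
  1 is 1, and \<open>K\<close> is at most \<open>N\<close> on squares.\<close>

lemma J_lower: assumes "bounded_local w" shows "- 1 \<le> J w"
proof -
  note b2 = bounded_local_power2[OF assms]
  have "2 * K w = K (\<lambda>c. 2 * w c)" by (simp add: K_cmult)
  also have "\<dots> \<le> K (\<lambda>c. (w c)\<^sup>2 + 1)"
  proof (rule K_mono)
    show "bounded_local (\<lambda>c. 2 * w c)" by (rule bounded_local_mult[OF bounded_local_const assms])
    show "bounded_local (\<lambda>c. (w c)\<^sup>2 + 1)" by (rule bounded_local_add[OF b2 bounded_local_const])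
    show "2 * w c \<le> (w c)\<^sup>2 + 1" for c using sum_squares_bound[of "w c" 1] by simp
  qed
  also have "\<dots> = K (\<lambda>c. (w c)\<^sup>2) + 1" using K_add[OF b2 bounded_local_const[of 1]] K_one by simp
  also have "\<dots> \<le> N (\<lambda>c. (w c)\<^sup>2) + 1" using K_le_N[OF b2] by simp
  finally show ?thesis by (simp add: J_def)
qed

lemma J_perturb:
  assumes w: "bounded_local w" and g: "bounded_local g"
  shows "J (\<lambda>c. w c + a * g c) = J w + 2 * a * (N (\<lambda>c. w c * g c) - K g) + a\<^sup>2 * N (\<lambda>c. (g c)\<^sup>2)"
proof -
  note b = bounded_local_power2[OF w] bounded_local_mult[OF w g] bounded_local_power2[OF g]
  have "N (\<lambda>c. (w c + a * g c)\<^sup>2) = N (\<lambda>c. (w c)\<^sup>2 + ((2 * a) * (w c * g c) + a\<^sup>2 * (g c)\<^sup>2))"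
    by (rule arg_cong[of _ _ N]) (auto simp: power2_eq_square algebra_simps)
  also have "\<dots> = N (\<lambda>c. (w c)\<^sup>2) + N (\<lambda>c. (2 * a) * (w c * g c) + a\<^sup>2 * (g c)\<^sup>2)"
    by (intro N_add b bounded_local_add bounded_local_mult[OF bounded_local_const])
  also have "N (\<lambda>c. (2 * a) * (w c * g c) + a\<^sup>2 * (g c)\<^sup>2) = N (\<lambda>c. (2 * a) * (w c * g c)) + N (\<lambda>c. a\<^sup>2 * (g c)\<^sup>2)"
    by (intro N_add b bounded_local_mult[OF bounded_local_const])
  finally have 1: "N (\<lambda>c. (w c + a * g c)\<^sup>2) = N (\<lambda>c. (w c)\<^sup>2) + (2 * a * N (\<lambda>c. w c * g c) + a\<^sup>2 * N (\<lambda>c. (g c)\<^sup>2))"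
    unfolding N_cmult .
  have "K (\<lambda>c. w c + a * g c) = K w + a * K g"
    using K_add[OF w bounded_local_mult[OF bounded_local_const g]] by (simp add: K_cmult)
  then show ?thesis unfolding J_def 1 by (simp add: algebra_simps)
qed

text \<open>Replacing \<open>w\<close> by its positive part lowers the square and raises
  \<open>K\<close>; this comes first because \<open>K_root_avg\<close> is for nonnegative functions.
  Averaging then preserves \<open>K\<close> and, by convexity of the square, does not raise the
  quadratic term.\<close>

lemma J_improve:
  assumes w: "bounded_local w"
  defines "w1 \<equiv> \<lambda>c. max 0 (w c)"
  shows "J (\<lambda>c. root_avg k w1 (rep c)) \<le> J w"
proof -
  have b1: "bounded_local w1" unfolding w1_def by (rule bounded_local_max[OF w])
  have "(w1 c)\<^sup>2 \<le> (w c)\<^sup>2" "w c \<le> w1 c" "0 \<le> w1 c" for c by (auto simp: w1_def max_def)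
  note pw = this
  have "J w1 \<le> J w"
    using N_mono[OF bounded_local_power2[OF b1] bounded_local_power2[OF w] pw(1)] K_mono[OF w b1 pw(2)] by (simp add: J_def)
  moreover have "N (\<lambda>c. (root_avg k w1 (rep c))\<^sup>2) \<le> N (\<lambda>c. root_avg k (\<lambda>c. (w1 c)\<^sup>2) (rep c))"
  proof (rule N_mono[OF bounded_local_power2[OF bounded_local_root_avg[OF b1]] bounded_local_root_avg[OF bounded_local_power2[OF b1]]])
    show "(root_avg k w1 (rep c))\<^sup>2 \<le> root_avg k (\<lambda>c. (w1 c)\<^sup>2) (rep c)" for c
      by (cases "rep c") (simp add: root_avg_def average_square_le)
  qed
  then have "J (\<lambda>c. root_avg k w1 (rep c)) \<le> J w1"
    unfolding J_def N_root_avg[OF bounded_local_power2[OF b1]] K_root_avg[OF b1 pw(3)] by simp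
  ultimately show ?thesis by simp
qed

text \<open>First-order optimality in quantitative form: moving from a near-minimizer by
  \<open>- a * g\<close> cannot lower \<open>J\<close> by more than \<open>\<delta>\<close>, which
  bounds the derivative in direction \<open>g\<close>. The near-minimizer is put in nonnegative,
  root-averaged form beforehand by \<open>J_improve\<close>.\<close>

lemma near_minimizer:
  assumes \<eta>: "\<eta> > 0" and B: "B \<ge> 0"
  shows "\<exists>w1. bounded_local w1 \<and> (\<forall>c. 0 \<le> w1 c) \<and>
    (\<forall>g. bounded_local g \<longrightarrow> (\<forall>c. \<bar>g c\<bar> \<le> B) \<longrightarrow> N (\<lambda>c. root_avg k w1 (rep c) * g c) - K g \<le> \<eta>)"
proof -
  define C where "C = N (\<lambda>_. B\<^sup>2)"
  have C0: "C \<ge> 0"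
    unfolding C_def using N_mono[OF bounded_local_const[of 0] bounded_local_const[of "B\<^sup>2"]] N_cmult[of 0 "\<lambda>_. 0"] by simp
  \<comment> \<open>The step size balances the two errors: with
    \<open>\<delta> = \<eta> * a\<close>, both \<open>\<delta>\<close> and the quadratic term
    \<open>a\<^sup>2 * C\<close> are at most \<open>a * \<eta>\<close>, against the linear term with
    factor \<open>2 * a\<close>. The 1 in the denominator guards against
    \<open>C = 0\<close>.\<close>
  define a where "a = \<eta> / (C + 1)"
  have a: "a > 0" "a * C \<le> \<eta>" using \<eta> C0 by (auto simp: a_def divide_simps mult_left_mono)
  define \<delta> where "\<delta> = \<eta> * a"
  have \<delta>: "\<delta> > 0" using \<eta> a by (simp add: \<delta>_def)
  define I where "I = Inf (J ` {w. bounded_local w})"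
  have bdd: "bdd_below (J ` {w. bounded_local w})" using J_lower by (intro bdd_belowI[of _ "- 1"]) auto
  have ne: "J ` {w. bounded_local w} \<noteq> {}" using bounded_local_const[of 0] by fast
  have lt: "Inf (J ` {w. bounded_local w}) < I + \<delta>" using \<delta> by (simp add: I_def)
  obtain w0 where w0: "bounded_local w0" "J w0 < I + \<delta>" using cInf_lessD[OF ne lt] by auto
  define w1 where "w1 = (\<lambda>c. max 0 (w0 c))"
  have b1: "bounded_local w1" unfolding w1_def by (rule bounded_local_max[OF w0(1)])
  let ?w = "\<lambda>c. root_avg k w1 (rep c)"
  have bw: "bounded_local ?w" by (rule bounded_local_root_avg[OF b1])
  have Jw: "J ?w < I + \<delta>" using J_improve[OF w0(1)] w0(2) unfolding w1_def by linarith
  have "N (\<lambda>c. ?w c * g c) - K g \<le> \<eta>" if g: "bounded_local g" "\<And>c. \<bar>g c\<bar> \<le> B" for g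
  proof -
    have bwg: "bounded_local (\<lambda>c. ?w c + (- a) * g c)" by (rule bounded_local_add[OF bw bounded_local_mult[OF bounded_local_const g(1)]])
    have "I \<le> J (\<lambda>c. ?w c + (- a) * g c)"
      unfolding I_def by (rule cInf_lower[OF imageI bdd], rule CollectI, rule bwg)
    then have "2 * a * (N (\<lambda>c. ?w c * g c) - K g) \<le> \<delta> + a\<^sup>2 * N (\<lambda>c. (g c)\<^sup>2)"
      unfolding J_perturb[OF bw g(1)] using Jw by simp
    also have "N (\<lambda>c. (g c)\<^sup>2) \<le> C"
      unfolding C_def by (rule N_mono[OF bounded_local_power2[OF g(1)] bounded_local_const]) (use g(2) B in \<open>simp add: abs_le_square_iff[symmetric]\<close>)
    then have "\<delta> + a\<^sup>2 * N (\<lambda>c. (g c)\<^sup>2) \<le> \<delta> + a\<^sup>2 * C" by (simp add: mult_left_mono)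
    also have "\<dots> \<le> 2 * a * \<eta>"
      using mult_left_mono[OF a(2), of a] a(1) by (simp add: \<delta>_def power2_eq_square algebra_simps)
    finally show ?thesis using a(1) by simp
  qed
  then show ?thesis using b1 by (intro exI[of _ w1]) (simp add: w1_def)
qed

text \<open>The cutoff at \<open>M\<close> makes the function bounded everywhere; on graphs of
  degree at most \<open>M\<close> it changes nothing.\<close>

definition escape_cost :: "mclass \<Rightarrow> real" where
  "escape_cost c = real (min M (escape (rep c)))"

lemma bounded_local_escape_cost: "bounded_local escape_cost" "\<bar>escape_cost c\<bar> \<le> M"
proof -
  show b: "\<bar>escape_cost c\<bar> \<le> M" for c by (simp add: escape_cost_def)
  show "bounded_local escape_cost" by (rule bounded_localI[OF _ b, of 1]) (unfold escape_cost_def, rule local_at_comp[OF escape_local])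
qed

text \<open>An edge that leaves the component of the root in the graph without \<open>S\<close> must
  belong to \<open>S\<close>, so the hypothesis on the expected number of marked edges
  applies.\<close>

lemma K_escape_cost: "K escape_cost \<le> 2 * \<epsilon>"
proof -
  have "AE c in \<nu>. ennreal (at_cluster k escape_cost (rep c)) \<le> (case rep c of (G, S, x, D) \<Rightarrow> of_nat (card (incident_edges S x)))"
    using AE_good
  proof eventually_elim
    case (elim c)
    then obtain H S x where g: "rep c = (H, S, x, {})" "(H, S, x, {}) \<in> mgraphs" "components_le k (delete_edges H S)" by blast
    have x: "x \<in> verts H" "is_graph H" "S \<subseteq> edges H" "locally_finite H" using g(2) by (auto simp: mgraphs_def)
    let ?K = "cluster k H S x"
    have KV: "?K \<subseteq> verts H" by (rule order_trans[OF cluster_subset mgraphs_ball[OF g(2)]])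
    have "{e \<in> edges H. x \<in> e \<and> \<not> e \<subseteq> ?K} \<subseteq> incident_edges S x"
    proof
      fix e assume e: "e \<in> {e \<in> edges H. x \<in> e \<and> \<not> e \<subseteq> ?K}"
      then obtain u where u: "e = {x, u}" "adj H x u"
        using edgeE[OF x(2), of e] by (metis (no_types, lifting) adj_sym insertE insert_commute mem_Collect_eq singletonD)
      have "e \<in> S"
      proof (rule ccontr)
        assume "e \<notin> S"
        then have "adj (delete_edges H S) x u" using u by (simp add: adj_delete)
        then have "u \<in> ?K" unfolding cluster_comp(1)[OF g(3) x(1)] by (rule adj_in_comp[OF self_in_comp])
        then show False using e u(1) by simp
      qed
      then show "e \<in> incident_edges S x" using e by (simp add: incident_edges_def)
    qed
    moreover have "finite (incident_edges S x)"
      by (rule finite_subset[of _ "incident_edges (edges H) x"])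
        (use x in \<open>auto simp: incident_edges_def locally_finite_def\<close>)
    ultimately have "escape (H, {}, x, ?K) \<le> card (incident_edges S x)" by (simp add: escape_def card_mono)
    moreover have "escape (rep (iso_class (H, {}, x, ?K))) = escape (H, {}, x, ?K)"
      by (rule escape_rep[OF mgraphs_change(1)[OF g(2) x(1) KV]])
    ultimately have "at_cluster k escape_cost (rep c) \<le> real (card (incident_edges S x))" by (simp add: g(1) at_cluster_def escape_cost_def)
    then show ?case by (simp add: g(1) ennreal_of_nat_eq_real_of_nat)
  qed
  then have "(\<integral>\<^sup>+c. ennreal (at_cluster k escape_cost (rep c)) \<partial>\<nu>) \<le> ennreal (2 * \<epsilon>)"
    by (rule order_trans[OF nn_integral_mono_AE cost])
  moreover have "K escape_cost = enn2real (\<integral>\<^sup>+c. ennreal (at_cluster k escape_cost (rep c)) \<partial>\<nu>)"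
    unfolding K_def by (rule integral_eq_nn_integral)
      (use int_K[OF bounded_local_escape_cost(1)] in \<open>auto simp: at_cluster_def escape_cost_def split: prod.split\<close>)
  ultimately show ?thesis using eps by (simp add: enn2real_leI)
qed

text \<open>Near-optimality is tested against \<open>escape_cost\<close>, which bounds the cost of
  the weights, and against minus the indicator that the root is undercovered. The latter does not
  depend on the marked set \<open>D\<close>, so it factors out of the sum over close sets.\<close>

lemma limit_weights:
  assumes \<eta>: "\<eta> > 0"
  shows "\<exists>w1. bounded_local w1 \<and> (\<forall>c. 0 \<le> w1 c) \<and> N (\<lambda>c. root_avg k w1 (rep c) * escape_cost c) \<le> 2 * \<epsilon> + \<eta> \<and>
    (\<integral>c. of_bool (Nsum k (\<lambda>c. root_avg k w1 (rep c)) (rep c) < 1 / 2) \<partial>\<mu>) \<le> 2 * \<eta>"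
proof -
  \<comment> \<open>The bound \<open>M + 1\<close> covers both test functions, of size at most
    \<open>M\<close> and 1.\<close>
  obtain w1 where w1: "bounded_local w1" "\<forall>c. 0 \<le> w1 c"
    and near: "\<And>g. bounded_local g \<Longrightarrow> (\<forall>c. \<bar>g c\<bar> \<le> real M + 1) \<Longrightarrow> N (\<lambda>c. root_avg k w1 (rep c) * g c) - K g \<le> \<eta>"
    using near_minimizer[OF \<eta>, of "real M + 1"] by auto
  let ?w = "\<lambda>c. root_avg k w1 (rep c)"
  have bw: "bounded_local ?w" by (rule bounded_local_root_avg[OF w1(1)])
  obtain s where s: "local_at s ?w" using bw by (auto simp: bounded_local_def)
  have "\<bar>escape_cost c\<bar> \<le> real M + 1" for c using bounded_local_escape_cost(2)[of c] by linarith
  then have 1: "N (\<lambda>c. ?w c * escape_cost c) \<le> 2 * \<epsilon> + \<eta>" using near[OF bounded_local_escape_cost(1)] K_escape_cost by force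
  let ?b = "\<lambda>g :: nat mgraph. of_bool (Nsum k ?w g < 1 / 2) :: real"
  \<comment> \<open>The sign is chosen so that the one-sided estimate bounds the probability:
    \<open>K h\<close> is minus that probability, while \<open>N\<close> of the product is at least
    minus one half of it.\<close>
  define h where "h = (\<lambda>c. - ?b (rep c))"
  have hloc: "local_at (2 * k + s) (\<lambda>c. ?b (rep c))" by (rule local_at_comp[OF functional_local(1)[OF s]])
  have bh: "bounded_local h"
    unfolding h_def by (rule bounded_localI[OF local_at_comp[OF hloc, where h = uminus], where B = 1]) simp
  have hrep: "h (iso_class g) = - ?b g" if "g \<in> mgraphs" for g
    unfolding h_def functional_rep(1)[OF s that] ..
  have ib: "integrable \<mu> (\<lambda>c. ?b (rep c))"
    by (rule m.integrable_const_bound[OF _ meas\<mu>[OF hloc], of 1]) simp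
  have Kh: "K h = - (\<integral>c. ?b (rep c) \<partial>\<mu>)"
  proof -
    have "K h = (\<integral>c. - ?b (rep (forget_marks c)) \<partial>\<nu>)"
      unfolding K_def
    proof (rule integral_cong_AE)
      show "(\<lambda>c. at_cluster k h (rep c)) \<in> borel_measurable \<nu>" using int_K[OF bh] by (rule borel_measurable_integrable)
      show "(\<lambda>c. - ?b (rep (forget_marks c))) \<in> borel_measurable \<nu>"
        by (intro borel_measurable_uminus meas\<nu>[OF local_forget[OF hloc]])
      show "AE c in \<nu>. at_cluster k h (rep c) = - ?b (rep (forget_marks c))"
        using AE_good
      proof eventually_elim
        case (elim c)
        then obtain H S x where g: "rep c = (H, S, x, {})" "(H, S, x, {}) \<in> mgraphs" by blast
        have x: "x \<in> verts H" using g(2) by (simp add: mgraphs_def)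
        have KV: "cluster k H S x \<subseteq> verts H" by (rule order_trans[OF cluster_subset mgraphs_ball[OF g(2)]])
        have "at_cluster k h (rep c) = - ?b (H, {}, x, cluster k H S x)"
          unfolding g(1) at_cluster_def prod.case by (rule hrep[OF mgraphs_change(1)[OF g(2) x KV]])
        also have "\<dots> = - ?b (rep c)" by (simp add: g(1) Nsum_def)
        finally show ?case using Nsum_forget[OF s] elim by simp
      qed
    qed
    also have "\<dots> = - (\<integral>c. ?b (rep (forget_marks c)) \<partial>\<nu>)" by simp
    also have "\<dots> = - (\<integral>c. ?b (rep c) \<partial>\<mu>)" by (simp only: integral_forget(2)[OF hloc ib])
    finally show ?thesis .
  qed
  have "- (1 / 2) * (\<integral>c. ?b (rep c) \<partial>\<mu>) = (\<integral>c. - (1 / 2) * ?b (rep c) \<partial>\<mu>)" by simp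
  \<comment> \<open>Where the indicator is 1 the total weight is below 1/2, and elsewhere both sides
    vanish.\<close>
  also have "\<dots> \<le> N (\<lambda>c. ?w c * h c)"
    unfolding N_def
  proof (rule integral_mono)
    show "integrable \<mu> (\<lambda>c. - (1 / 2) * ?b (rep c))" using ib by simp
    show "integrable \<mu> (\<lambda>c. Nsum k (\<lambda>c. ?w c * h c) (rep c))" by (rule int_N[OF bounded_local_mult[OF bw bh]])
    fix c assume "c \<in> space \<mu>"
    then have "c \<in> rooted_space_deg M" using p\<mu>(3) by simp
    then obtain H x where g: "rep c = (H, {}, x, {})" "(H, {}, x, {}) \<in> mgraphs" by (rule rep_\<mu>)
    have x: "x \<in> verts H" using g(2) by (simp add: mgraphs_def)
    have hD: "h (iso_class (H, {}, x, D)) = - ?b (rep c)" if D: "D \<in> close_sets k H x" for D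
    proof -
      have DV: "D \<subseteq> verts H" using finite_close_sets_mem[OF g(2) D] by simp
      have "h (iso_class (H, {}, x, D)) = - ?b (H, {}, x, D)" by (rule hrep[OF mgraphs_change(1)[OF g(2) x DV]])
      then show ?thesis by (simp add: g(1) Nsum_def)
    qed
    have "Nsum k (\<lambda>c. ?w c * h c) (rep c) = (\<Sum>D\<in>close_sets k H x. ?w (iso_class (H, {}, x, D)) * (- ?b (rep c)))"
      unfolding g(1) Nsum_def prod.case by (rule sum.cong[OF refl]) (simp add: hD[unfolded g(1)] Nsum_def)
    also have "\<dots> = Nsum k ?w (rep c) * (- ?b (rep c))"
      by (simp add: g(1) Nsum_def sum_distrib_right sum_negf)
    finally show "- (1 / 2) * ?b (rep c) \<le> Nsum k (\<lambda>c. ?w c * h c) (rep c)" by auto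
  qed
  finally have 2: "- (1 / 2) * (\<integral>c. ?b (rep c) \<partial>\<mu>) \<le> N (\<lambda>c. ?w c * h c)" .
  have "N (\<lambda>c. ?w c * h c) - K h \<le> \<eta>" by (rule near[OF bh]) (simp add: h_def)
  then have "(\<integral>c. ?b (rep c) \<partial>\<mu>) \<le> 2 * \<eta>" using 2 unfolding Kh by linarith
  then show ?thesis using w1 1 by blast
qed

text \<open>Cost and undercoverage of the local weights lie strictly below \<open>a\<close> and
  \<open>t / 2\<close> in the limit, hence also on all late \<open>G j\<close>. There the weights
  form an honest fractional cover by sets of at most \<open>(M + 1) ^ k\<close> vertices, which is
  then rounded.\<close>

lemma finite_partition:
  fixes a t :: real
  assumes a: "a > 0" "2 * \<epsilon> < a" and t: "t > 0"
  shows "\<forall>\<^sub>F j in sequentially. \<exists>S. S \<subseteq> edges (G j) \<and>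
    real (card S) \<le> (4 * a / t + M * t) * card (verts (G j)) \<and> components_le ((M + 1) ^ k) (delete_edges (G j) S)"
proof -
  \<comment> \<open>The first entry leaves room between \<open>2 * \<epsilon> + \<eta>\<close> and
    \<open>a\<close>, the second between \<open>2 * \<eta>\<close> and \<open>t / 2\<close>.\<close>
  define \<eta> where "\<eta> = min ((a - 2 * \<epsilon>) / 2) (t / 6)"
  have \<eta>: "\<eta> > 0" "2 * \<epsilon> + \<eta> < a" "2 * \<eta> < t / 2" using a t by (auto simp: \<eta>_def min_def field_simps)
  obtain w1 where w1: "bounded_local w1" "\<forall>c. 0 \<le> w1 c" and Nc: "N (\<lambda>c. root_avg k w1 (rep c) * escape_cost c) \<le> 2 * \<epsilon> + \<eta>"
    and cov: "(\<integral>c. of_bool (Nsum k (\<lambda>c. root_avg k w1 (rep c)) (rep c) < 1 / 2) \<partial>\<mu>) \<le> 2 * \<eta>"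
    using limit_weights[OF \<eta>(1)] by blast
  let ?w = "\<lambda>c. root_avg k w1 (rep c)"
  let ?b = "\<lambda>c. of_bool (Nsum k ?w (rep c) < 1 / 2) :: real"
  have bw: "bounded_local ?w" by (rule bounded_local_root_avg[OF w1(1)])
  obtain s1 where s1: "local_at s1 w1" using w1(1) by (auto simp: bounded_local_def)
  obtain s where s: "local_at s ?w" using bw by (auto simp: bounded_local_def)
  have bwg: "bounded_local (\<lambda>c. ?w c * escape_cost c)" by (rule bounded_local_mult[OF bw bounded_local_escape_cost(1)])
  obtain s2 where s2: "local_at s2 (\<lambda>c. ?w c * escape_cost c)" using bwg by (auto simp: bounded_local_def)
  have e1: "\<forall>\<^sub>F j in sequentially. avg (G j) {} (\<lambda>c. Nsum k (\<lambda>c. ?w c * escape_cost c) (rep c)) < a"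
    by (rule order_tendstoD(2)[OF avg_limit[OF bwg]]) (use Nc \<eta>(2) in linarith)
  have "(\<lambda>j. avg (G j) {} ?b) \<longlonglongrightarrow> (\<integral>c. ?b c \<partial>\<mu>)"
    by (rule weak_limit_local[OF G weak local_at_comp[OF functional_local(1)[OF s]], where B = 1]) simp
  then have e2: "\<forall>\<^sub>F j in sequentially. avg (G j) {} ?b < t / 2"
    by (rule order_tendstoD(2)) (use cov \<eta>(3) in linarith)
  show ?thesis using e1 e2
  proof eventually_elim
    case (elim j)
    let ?G = "G j" let ?V = "verts (G j)" let ?F = "close_family k (G j)"
    note ff = fin_graphsD[OF G[of j]] and Fa = close_family_facts[OF G[of j], where k = k]
    \<comment> \<open>Thanks to the averaging over roots, \<open>?w\<close> at \<open>D\<close>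
      equals \<open>W D\<close> from each of its vertices, so \<open>D\<close> carries a single
      weight.\<close>
    define W where "W D = (\<Sum>y\<in>D. w1 (set_class ?G y D)) / card D" for D
    have W0: "0 \<le> W D" for D unfolding W_def using w1(2) by (intro divide_nonneg_nonneg sum_nonneg) auto
    have DDv: "D \<in> close_sets k ?G v \<and> v \<in> ?V" if "D \<in> ?F" "v \<in> D" for D v
    proof -
      have v: "v \<in> ?V" using Fa(2)[OF that(1)] that(2) by blast
      then show ?thesis using Fa(3)[OF v] that by blast
    qed
    have wW: "?w (set_class ?G v D) = W D" if "D \<in> close_sets k ?G v" "v \<in> ?V" for D v
      unfolding W_def by (rule root_avg_set_class[OF G that(2) s1 that(1)])
    have gc: "escape_cost (set_class ?G v D) = real (card {e \<in> edges ?G. v \<in> e \<and> \<not> e \<subseteq> D})" if D: "D \<in> close_sets k ?G v" and v: "v \<in> ?V" for D v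
    proof -
      have sub: "e \<subseteq> comp_verts ?G v" if "e \<in> edges ?G" "v \<in> e" for e
        using ball_1[OF ff(1) that] ball_subset_comp[of ?G v "Suc 0"] by (rule order_trans)
      have "{e \<in> edges (component ?G v). v \<in> e \<and> \<not> e \<subseteq> D} = {e \<in> edges ?G. v \<in> e \<and> \<not> e \<subseteq> D}"
        using sub by (auto simp: component_def)
      then have 1: "escape (rep (set_class ?G v D)) = card {e \<in> edges ?G. v \<in> e \<and> \<not> e \<subseteq> D}"
        unfolding set_class_def escape_rep[OF set_class_mgraphs[OF G v D]] by (simp add: escape_def)
      have "card {e \<in> edges ?G. v \<in> e \<and> \<not> e \<subseteq> D} \<le> card (incident_edges (edges ?G) v)"
        by (rule card_mono) (use ff(5) v in \<open>auto simp: locally_finite_def incident_edges_def\<close>)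
      also have "\<dots> \<le> M" using ff(4) v by (simp add: max_degree_le_def)
      finally show ?thesis unfolding escape_cost_def 1 by simp
    qed
    have "(\<Sum>D\<in>?F. W D * real (card (bdry ?G D))) \<le> (\<Sum>D\<in>?F. \<Sum>v\<in>D. ?w (set_class ?G v D) * escape_cost (set_class ?G v D))"
    proof (rule sum_mono)
      fix D assume D: "D \<in> ?F"
      \<comment> \<open>Each boundary edge is seen from its endpoint inside \<open>D\<close>, so the
        escape counts over \<open>D\<close> dominate the boundary.\<close>
      have "bdry ?G D \<subseteq> (\<Union>v\<in>D. {e \<in> edges ?G. v \<in> e \<and> \<not> e \<subseteq> D})" by (auto simp: bdry_def)
      then have "card (bdry ?G D) \<le> card (\<Union>v\<in>D. {e \<in> edges ?G. v \<in> e \<and> \<not> e \<subseteq> D})"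
        by (rule card_mono[rotated]) (use Fa(2)[OF D] fin_graphs_finite_edges[OF G[of j]] in auto)
      also have "\<dots> \<le> (\<Sum>v\<in>D. card {e \<in> edges ?G. v \<in> e \<and> \<not> e \<subseteq> D})"
        by (rule card_UN_le) (use Fa(2)[OF D] in simp)
      finally have cb: "card (bdry ?G D) \<le> (\<Sum>v\<in>D. card {e \<in> edges ?G. v \<in> e \<and> \<not> e \<subseteq> D})" .
      have "real (card (bdry ?G D)) \<le> (\<Sum>v\<in>D. real (card {e \<in> edges ?G. v \<in> e \<and> \<not> e \<subseteq> D}))"
        unfolding of_nat_sum[symmetric] by (rule of_nat_mono[OF cb])
      also have "\<dots> = (\<Sum>v\<in>D. escape_cost (set_class ?G v D))" by (rule sum.cong[OF refl]) (use gc DDv[OF D] in auto)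
      finally have "W D * real (card (bdry ?G D)) \<le> W D * (\<Sum>v\<in>D. escape_cost (set_class ?G v D))" by (rule mult_left_mono[OF _ W0])
      also have "\<dots> = (\<Sum>v\<in>D. ?w (set_class ?G v D) * escape_cost (set_class ?G v D))"
        unfolding sum_distrib_left by (rule sum.cong[OF refl]) (use wW DDv[OF D] in auto)
      finally show "W D * real (card (bdry ?G D)) \<le> (\<Sum>v\<in>D. ?w (set_class ?G v D) * escape_cost (set_class ?G v D))" .
    qed
    also have "\<dots> = (\<Sum>v\<in>?V. Nsum k (\<lambda>c. ?w c * escape_cost c) (rep (root_class ?G {} v)))" by (rule sum_Nsum[OF G s2, symmetric])
    also have "\<dots> \<le> a * card ?V" using elim(1) ff(6) by (simp add: avg_def divide_less_eq)
    finally have cst: "(\<Sum>D\<in>?F. W D * real (card (bdry ?G D))) \<le> a * card ?V" .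
    have ns: "Nsum k ?w (rep (root_class ?G {} v)) = (\<Sum>D\<in>{D \<in> ?F. v \<in> D}. W D)" if v: "v \<in> ?V" for v
      unfolding Nsum_root_class[OF G v s] Fa(3)[OF v] by (rule sum.cong[OF refl]) (simp add: wW v)
    have "real (card {v \<in> ?V. (\<Sum>D\<in>{D \<in> ?F. v \<in> D}. W D) < 1 / 2}) = (\<Sum>v\<in>?V. ?b (root_class ?G {} v))"
    proof -
      have "(\<Sum>v\<in>?V. ?b (root_class ?G {} v)) = (\<Sum>v\<in>?V. of_bool ((\<Sum>D\<in>{D \<in> ?F. v \<in> D}. W D) < 1 / 2))"
        by (rule sum.cong[OF refl]) (simp add: ns)
      also have "\<dots> = real (card {v \<in> ?V. (\<Sum>D\<in>{D \<in> ?F. v \<in> D}. W D) < 1 / 2})"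
        using ff(2) by (simp add: Int_def)
      finally show ?thesis ..
    qed
    also have "\<dots> \<le> t / 2 * card ?V" using elim(2) ff(6) by (simp add: avg_def divide_less_eq)
    finally have cvr: "real (card {v \<in> ?V. (\<Sum>D\<in>{D \<in> ?F. v \<in> D}. W D) < 1 / 2}) \<le> t / 2 * card ?V" .
    show ?case
      by (rule fractional_to_integral[OF G _ a(1) t Fa(1) _ W0 cst cvr]) (use Fa(2) in auto)
  qed
qed

end

lemma components_le_mono: "components_le L H \<Longrightarrow> L \<le> L' \<Longrightarrow> components_le L' H"
  unfolding components_le_def by (meson le_trans)

theorem hyperfinite_graphs_if_measure:
  fixes G :: "nat \<Rightarrow> 'v ugraph"
  assumes M: "M > 0" and G: "\<And>j. G j \<in> fin_graphs M" and \<mu>: "\<mu> \<in> prob_measures (rooted_space_deg M)"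
    and w: "weakly_converges (rooted_space_deg M) (\<lambda>j. Psi M (G j)) \<mu>"
    and hyp: "hyperfinite_measure (extend_measure_to_rooted \<mu>)"
  shows "hyperfinite_graphs (range G)"
  unfolding hyperfinite_graphs_def
proof (intro allI impI)
  fix e :: real assume e: "e > 0"
  \<comment> \<open>\<open>t\<close> and \<open>a\<close> are chosen so that the edges at leftover
    vertices and the boundaries of the chosen sets each account for \<open>e / 2\<close>.\<close>
  define t where "t = e / (2 * real M)"
  have t: "t > 0" "M * t = e / 2" using e M by (auto simp: t_def)
  define a where "a = e * t / 8"
  have a: "a > 0" "4 * a / t = e / 2" using e t by (auto simp: a_def)
  \<comment> \<open>Hyperfiniteness is used at \<open>a / 4\<close>, so that the expected number of
    marked edges at the root, at most \<open>a / 2\<close>, is strictly below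
    \<open>a\<close>.\<close>
  obtain k where k: "hyperfinite_measure_at k (a / 4) (extend_measure_to_rooted \<mu>)"
    using hyp a(1) unfolding hyperfinite_measure_def by (meson divide_pos_pos zero_less_numeral)
  then obtain \<nu> where \<nu>: "\<nu> \<in> unimodular_marked" "distr \<nu> (local_borel rooted_space) forget_marks = extend_measure_to_rooted \<mu>"
    "AE c in \<nu>. case rep c of (G, S, x, D) \<Rightarrow> components_le k (delete_edges G S)"
    "(\<integral>\<^sup>+ c. (case rep c of (G, S, x, D) \<Rightarrow> of_nat (card (incident_edges S x))) \<partial>\<nu>) \<le> ennreal (2 * (a / 4))"
    unfolding hyperfinite_measure_at_def by blast
  interpret hyper_limit M k G \<mu> \<nu> "a / 4"
    by unfold_locales (rule G, rule \<mu>, rule w, rule \<nu>(1), rule \<nu>(2), rule \<nu>(3), rule \<nu>(4), use a(1) in simp)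
  obtain j0 where j0: "\<And>j. j \<ge> j0 \<Longrightarrow> \<exists>S. S \<subseteq> edges (G j) \<and>
      real (card S) \<le> (4 * a / t + M * t) * card (verts (G j)) \<and> components_le ((M + 1) ^ k) (delete_edges (G j) S)"
    using finite_partition[OF a(1) _ t(1)] a(1) unfolding eventually_sequentially by auto
  \<comment> \<open>The added sum deals with the finitely many early graphs: each has at most
    \<open>L\<close> vertices, so removing no edge suffices there.\<close>
  define L where "L = (M + 1) ^ k + (\<Sum>j<j0. card (verts (G j)))"
  have "\<exists>S. S \<subseteq> edges (G j) \<and> real (card S) \<le> e * real (card (verts (G j))) \<and> components_le L (delete_edges (G j) S)" for j
  proof (cases "j0 \<le> j")
    case True
    have "4 * a / t + M * t = e" using a(2) t(2) by simp
    then obtain S where "S \<subseteq> edges (G j)" "real (card S) \<le> e * card (verts (G j))" "components_le ((M + 1) ^ k) (delete_edges (G j) S)"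
      using j0[OF True] by auto
    then show ?thesis using components_le_mono[of "(M + 1) ^ k" _ L] by (auto simp: L_def)
  next
    case False
    note ff = fin_graphsD[OF assms(2), of j]
    have "card (verts (G j)) \<le> (\<Sum>j<j0. card (verts (G j)))" by (rule member_le_sum) (use False in auto)
    then have cL: "card (verts (G j)) \<le> L" by (simp add: L_def)
    have "components_le L (delete_edges (G j) {})"
      unfolding components_le_def
    proof
      fix v assume "v \<in> verts (delete_edges (G j) {})"
      then have "comp_verts (delete_edges (G j) {}) v \<subseteq> verts (G j)"
        using comp_subset_verts[OF is_graph_delete[OF ff(1)]] by force
      then show "finite (comp_verts (delete_edges (G j) {}) v) \<and> card (comp_verts (delete_edges (G j) {}) v) \<le> L"
        using ff(2) cL card_mono finite_subset le_trans by metis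
    qed
    then show ?thesis using e by (intro exI[of _ "{}"]) simp
  qed
  then have "hyperfinite_graphs_at L e (range G)" unfolding hyperfinite_graphs_at_def by blast
  moreover have "L > 0" by (simp add: L_def)
  ultimately show "\<exists>k>0. hyperfinite_graphs_at k e (range G)" by blast
qed

theorem theorem1p1:
  fixes M :: nat and G :: "nat \<Rightarrow> 'v ugraph" and \<mu> :: "mclass measure"
  assumes "M > 0"
    and "\<And>j. G j \<in> fin_graphs M"
    and "\<mu> \<in> prob_measures (rooted_space_deg M)"
    and "weakly_converges (rooted_space_deg M) (\<lambda>j. Psi M (G j)) \<mu>"
  shows "hyperfinite_measure (extend_measure_to_rooted \<mu>) \<longleftrightarrow> hyperfinite_graphs (range G)"
  using hyperfinite_graphs_if_measure[OF assms] hyperfinite_measure_if_graphs[OF assms(2,3,4)] by blast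

end
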